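(* Let $\bar\beta=\{\beta_k\}_{k=1}^\infty$, $\beta_k\in\mathbb R$, and let $\psi(k)>0$, $k\in\mathbb N$, satisfy $\sum_{k=1}^\infty\psi^2(k)<\infty$. Let $P_N$ denote any one of the widths $b_N, d_N,\lambda_N,\pi_N$. Then for all $n\in\mathbb N$ $$\frac1{\sqrt{\pi}}\left(\frac1{\psi^2(n)}+2\sum_{k=1}^{n-1}\frac1{\psi^2(k)}\right)^{-\frac12}\le P_{2n}(C_{\bar\beta,2}^\psi,C)\le P_{2n-1}(C_{\bar\beta,2}^\psi,C)\le \frac1{\sqrt{\pi}}\left(\sum_{k=n}^\infty\psi^2(k)\right)^{\frac12}.$$ If, in addition, $\psi$ satisfies $$\lim_{n\to\infty}\max\left\{\psi(n)\left(\sum_{k=1}^{n-1}\frac1{\psi^2(k)}\right)^{\frac12},\ \frac1{\psi(n)}\left(\sum_{k=n+1}^\infty\psi^2(k)\right)^{\frac12}\right\}=0,$$ then the following asymptotic equalities (as $n\to\infty$) hold: each of the two quantities $P_{2n}(C_{\bar\beta,2}^\psi,C)$ and $P_{2n-1}(C_{\bar\beta,2}^\psi,C)$ is equal to $$\psi(n)\left(\frac1{\sqrt\pi}+\mathcal O(1)\max\left\{\psi(n)\left(\sum_{k=1}^{n-1}\frac1{\psi^2(k)}\right)^{\frac12},\ \frac1{\psi(n)}\left(\sum_{k=n+1}^\infty\psi^2(k)\right)^{\frac12}\right\}\right),$$ where $\mathcal O(1)$ are quantities uniformly bounded in all parameters. These asymptotic equalities are realized by the trigonometric Fourier sums $S_{n-1}(f)$,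 i.e. the quantity $\sup_{f\in C^\psi_{\bar\beta,2}}\|f-S_{n-1}(f)\|_C$ is also equal to $$\psi(n)\left(\frac1{\sqrt\pi}+\mathcal O(1)\max\left\{\psi(n)\left(\sum_{k=1}^{n-1}\frac1{\psi^2(k)}\right)^{\frac12},\ \frac1{\psi(n)}\left(\sum_{k=n+1}^\infty\psi^2(k)\right)^{\frac12}\right\}\right),$$ where $\mathcal O(1)$ is a quantity uniformly bounded in all parameters.
   Context: $L_2$ is the space of (real-valued) $2\pi$-periodic functions with norm $\|f\|_2=\left(\int_{-\pi}^{\pi}|f(t)|^2dt\right)^{1/2}$; $C$ is the space of (real-valued) continuous $2\pi$-periodic functions with norm $\|f\|_C=\max_t|f(t)|$. Sums over an empty index set are $0$. The class $C^\psi_{\bar\beta,2}$ is the set of all $2\pi$-periodic functions $f$ representable as $$f(x)=\frac{a_0}{2}+\frac1\pi\int_{-\pi}^{\pi}\varphi(x-t)\Psi_{\bar\beta}(t)\,dt,\quad a_0\in\mathbb R,\ \varphi\in L_2,\ \|\varphi\|_2\le 1,\ \int_{-\pi}^{\pi}\varphi(t)\,dt=0,$$ where $\Psi_{\bar\beta}\in L_2$ is the fixed function with Fourier series $\sum_{k=1}^\infty\psi(k)\cos\left(kt-\frac{\beta_k\pi}{2}\right)$. One has $C^\psi_{\bar\beta,2}\subset C$. Widths: let $K$ be a convex centrally symmetric subset of $C$, $B$ the unit ball of $C$, $F_N$ an arbitrary $N$-dimensional subspace of $C$, $\mathscr L(C,F_N)$ the set of linear operators from $C$ to $F_N$, and $\mathscr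 P(C,F_N)\subset\mathscr L(C,F_N)$ the subset of projections, i.e. operators $A$ with $Af=f$ for $f\in F_N$. The Bernstein, Kolmogorov, linear and projection $N$-widths of $K$ in $C$ are, respectively, $$b_N(K,C)=\sup_{F_{N+1}}\sup\{\varepsilon>0:\ \varepsilon B\cap F_{N+1}\subset K\},\qquad d_N(K,C)=\inf_{F_N}\sup_{f\in K}\inf_{u\in F_N}\|f-u\|_C,$$ $$\lambda_N(K,C)=\inf_{F_N}\inf_{A\in\mathscr L(C,F_N)}\sup_{f\in K}\|f-Af\|_C,\qquad \pi_N(K,C)=\inf_{F_N}\inf_{A\in\mathscr P(C,F_N)}\sup_{f\in K}\|f-Af\|_C.$$ $S_{n-1}(f)$ is the partial Fourier sum of order $n-1$ of $f$. "$\mathcal O(1)$ uniformly bounded in all parameters" means bounded in absolute value by an absolute constant, independent of $n$, $\psi$, $\bar\beta$ and of the choice of width. *)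

theory Defs
  imports "HOL-Analysis.Analysis"
begin

section \<open>Widths in a subspace of a normed space\<close>

text \<open>
  The ambient normed space is a linear subspace \<open>X\<close> of a normed-space type.  Widths take values
  in \<open>[0, \<infinity>]\<close>, since the deviation of an unbounded set from a given subspace may be infinite.
  Dimension is expressed by a basis because \<^const>\<open>dim\<close> is \<open>0\<close> on infinite-dimensional subspaces.
\<close>

definition subspaces_of_dim :: "'a::real_normed_vector set \<Rightarrow> nat \<Rightarrow> 'a set set" where
  "subspaces_of_dim X N =
     {F. F \<subseteq> X \<and> (\<exists>B. finite B \<and> card B = N \<and> independent B \<and> F = span B)}"

text \<open>Operators are only linear, not assumed continuous; values outside \<open>X\<close> are irrelevant.\<close>

definition linear_operators :: "'a::real_normed_vector set \<Rightarrow> 'a set \<Rightarrow> ('a \<Rightarrow> 'a) set" where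
  "linear_operators X F =
     {A. (\<forall>f\<in>X. A f \<in> F) \<and> (\<forall>f\<in>X. \<forall>g\<in>X. A (f + g) = A f + A g) \<and>
         (\<forall>c. \<forall>f\<in>X. A (c *\<^sub>R f) = c *\<^sub>R A f)}"

definition projections :: "'a::real_normed_vector set \<Rightarrow> 'a set \<Rightarrow> ('a \<Rightarrow> 'a) set" where
  "projections X F = {A \<in> linear_operators X F. \<forall>f\<in>F. A f = f}"

definition bernstein_width :: "'a::real_normed_vector set \<Rightarrow> 'a set \<Rightarrow> nat \<Rightarrow> ennreal" where
  "bernstein_width K X N =
     (SUP F\<in>subspaces_of_dim X (N + 1). SUP \<epsilon>\<in>{\<epsilon>. \<epsilon> > 0 \<and> cball 0 \<epsilon> \<inter> F \<subseteq> K}. ennreal \<epsilon>)"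

definition kolmogorov_width :: "'a::real_normed_vector set \<Rightarrow> 'a set \<Rightarrow> nat \<Rightarrow> ennreal" where
  "kolmogorov_width K X N =
     (INF F\<in>subspaces_of_dim X N. SUP f\<in>K. INF u\<in>F. ennreal (norm (f - u)))"

definition linear_width :: "'a::real_normed_vector set \<Rightarrow> 'a set \<Rightarrow> nat \<Rightarrow> ennreal" where
  "linear_width K X N =
     (INF F\<in>subspaces_of_dim X N. INF A\<in>linear_operators X F. SUP f\<in>K. ennreal (norm (f - A f)))"

definition projection_width :: "'a::real_normed_vector set \<Rightarrow> 'a set \<Rightarrow> nat \<Rightarrow> ennreal" where
  "projection_width K X N =
     (INF F\<in>subspaces_of_dim X N. INF A\<in>projections X F. SUP f\<in>K. ennreal (norm (f - A f)))"

section \<open>Spaces of periodic functions and Fourier series\<close>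

definition periodic_2pi :: "(real \<Rightarrow> real) \<Rightarrow> bool" where
  "periodic_2pi f \<longleftrightarrow> (\<forall>x. f (x + 2 * pi) = f x)"

text \<open>A continuous periodic function is bounded, and the norm of \<open>real \<Rightarrow>\<^sub>C real\<close> is the sup norm.\<close>

definition C_per :: "(real \<Rightarrow>\<^sub>C real) set" where
  "C_per = {f. periodic_2pi (apply_bcontfun f)}"

definition L2_per :: "(real \<Rightarrow> real) set" where
  "L2_per = {f. periodic_2pi f \<and> f \<in> borel_measurable lebesgue \<and>
                set_integrable lebesgue {-pi..pi} (\<lambda>t. (f t)\<^sup>2)}"

definition L2_per_norm :: "(real \<Rightarrow> real) \<Rightarrow> real" where
  "L2_per_norm f = sqrt (LINT t:{-pi..pi}|lebesgue. (f t)\<^sup>2)"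

definition fourier_cos :: "(real \<Rightarrow> real) \<Rightarrow> nat \<Rightarrow> real" where
  "fourier_cos f k = 1 / pi * (LINT t:{-pi..pi}|lebesgue. f t * cos (real k * t))"

definition fourier_sin :: "(real \<Rightarrow> real) \<Rightarrow> nat \<Rightarrow> real" where
  "fourier_sin f k = 1 / pi * (LINT t:{-pi..pi}|lebesgue. f t * sin (real k * t))"

definition fourier_sum :: "nat \<Rightarrow> (real \<Rightarrow> real) \<Rightarrow> (real \<Rightarrow>\<^sub>C real)" where
  "fourier_sum m f = Bcontfun (\<lambda>x. fourier_cos f 0 / 2 +
     (\<Sum>k=1..m. fourier_cos f k * cos (real k * x) + fourier_sin f k * sin (real k * x)))"

lemma apply_fourier_sum:
  "apply_bcontfun (fourier_sum m f) x = fourier_cos f 0 / 2 +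
     (\<Sum>k=1..m. fourier_cos f k * cos (real k * x) + fourier_sin f k * sin (real k * x))"
proof -
  let ?S = "\<lambda>x. \<Sum>k=1..m. fourier_cos f k * cos (real k * x) + fourier_sin f k * sin (real k * x)"
  let ?T = "\<lambda>x. fourier_cos f 0 / 2 + ?S x"
  let ?R = "\<Sum>k=1..m. \<bar>fourier_cos f k\<bar> + \<bar>fourier_sin f k\<bar>"
  have *: "\<bar>a * cos y + b * sin y\<bar> \<le> \<bar>a\<bar> + \<bar>b\<bar>" for a b y :: real
  proof -
    have "\<bar>a * cos y\<bar> \<le> \<bar>a\<bar>" "\<bar>b * sin y\<bar> \<le> \<bar>b\<bar>"
      by (simp_all add: abs_mult mult_left_le)
    then show ?thesis by linarith
  qed
  have "\<bar>?S x\<bar> \<le> ?R" for x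
    by (rule order_trans[OF sum_abs sum_mono]) (rule *)
  then have "norm (?T x) \<le> \<bar>fourier_cos f 0 / 2\<bar> + ?R" for x
    unfolding real_norm_def by (rule order_trans[OF abs_triangle_ineq add_left_mono])
  then have "bounded (range ?T)"
    unfolding bounded_iff by blast
  moreover have "continuous_on UNIV ?T"
    by (intro continuous_intros)
  ultimately have "?T \<in> bcontfun"
    by (simp add: bcontfun_def)
  then show ?thesis
    by (simp add: fourier_sum_def Bcontfun_inverse)
qed

section \<open>The classes of convolutions\<close>

text \<open>
  \<open>\<Psi>\<close> has the Fourier series \<open>\<Sum>k\<ge>1. \<psi> k * cos (k * t - \<beta> k * pi / 2)\<close>: the coefficients are read
  off from the addition formula for the cosine.  Such a \<open>\<Psi>\<close> is unique up to null sets, which do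
  not affect convolutions.  The values \<open>\<psi> 0\<close> and \<open>\<beta> 0\<close> are never used.
\<close>

definition is_kernel :: "(nat \<Rightarrow> real) \<Rightarrow> (nat \<Rightarrow> real) \<Rightarrow> (real \<Rightarrow> real) \<Rightarrow> bool" where
  "is_kernel \<psi> \<beta> \<Psi> \<longleftrightarrow> \<Psi> \<in> L2_per \<and> fourier_cos \<Psi> 0 = 0 \<and>
     (\<forall>k\<ge>1. fourier_cos \<Psi> k = \<psi> k * cos (\<beta> k * pi / 2) \<and>
            fourier_sin \<Psi> k = \<psi> k * sin (\<beta> k * pi / 2))"

definition convolution_class :: "(real \<Rightarrow> real) \<Rightarrow> (real \<Rightarrow> real) set" where
  "convolution_class \<Psi> =
     {f. \<exists>a\<^sub>0 \<phi>. \<phi> \<in> L2_per \<and> L2_per_norm \<phi> \<le> 1 \<and> (LINT t:{-pi..pi}|lebesgue. \<phi> t) = 0 \<and>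
          (\<forall>x. f x = a\<^sub>0 / 2 + 1 / pi * (LINT t:{-pi..pi}|lebesgue. \<phi> (x - t) * \<Psi> t))}"

text \<open>
  The same class as a subset of \<^const>\<open>C_per\<close>.  Nothing is lost: the convolution of two periodic
  square-integrable functions is continuous and periodic.
\<close>

definition convolution_class_C :: "(real \<Rightarrow> real) \<Rightarrow> (real \<Rightarrow>\<^sub>C real) set" where
  "convolution_class_C \<Psi> = {f \<in> C_per. apply_bcontfun f \<in> convolution_class \<Psi>}"

definition fourier_sum_error :: "nat \<Rightarrow> (real \<Rightarrow>\<^sub>C real) set \<Rightarrow> ennreal" where
  "fourier_sum_error m K = (SUP f\<in>K. ennreal (norm (f - fourier_sum m (apply_bcontfun f))))"

definition remainder :: "(nat \<Rightarrow> real) \<Rightarrow> nat \<Rightarrow> real" where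
  "remainder \<psi> n =
     max (\<psi> n * sqrt (\<Sum>k=1..<n. 1 / (\<psi> k)\<^sup>2)) (1 / \<psi> n * sqrt (\<Sum>k. (\<psi> (n + 1 + k))\<^sup>2))"

end

theory Submission
  imports Defs "Jordan_Normal_Form.Determinant"
begin

text \<open>
  Write \<open>K\<close> for the class.  A function of \<open>K\<close> is, up to a constant, the convolution of some
  \<open>\<phi>\<close> in the unit ball of \<open>L\<^sub>2\<close> with \<open>\<Psi>\<close>, and \<open>S\<^bsub>m\<^esub>\<close> acts on it by cutting
  off the Fourier series of \<open>\<Psi>\<close>.  By the Cauchy-Schwarz inequality the error is at most
  \<open>1 / pi\<close> times the \<open>L\<^sub>2\<close> norm of the rest of that series, which Parseval's identity
  expresses by the tail of \<open>\<Sum>k. (\<psi> k)\<^sup>2\<close> (\<open>kernel_remainder_le\<close>,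
  \<open>convolution_class_fourier_sum\<close>).  Since \<open>S\<^bsub>n-1\<^esub>\<close> is a projection onto a space of dimension
  \<open>2 * n - 1\<close>, this is the upper bound for the projection width, hence for the linear and the
  Kolmogorov width.  For the Bernstein width, every subspace of dimension \<open>2 * n\<close> contains
  some \<open>f \<noteq> 0\<close> with \<open>S\<^bsub>n-1\<^esub> f = 0\<close>, so a ball of that subspace inside \<open>K\<close> has a radius of at
  most the same error (\<open>bernstein_width_le\<close>).

  The lower bound rests on \<open>2 * n\<close> equidistant nodes in a period.  Let \<open>T\<close> be a trigonometric
  polynomial of order \<open>n\<close>, and let the nodes be the extrema of its top harmonic.  The harmonics of
  \<open>T\<close> are then orthogonal on the nodes, so that a bound \<open>\<epsilon>\<close> for \<open>\<bar>T\<bar>\<close> at the nodes alone bounds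
  the squared amplitudes by \<open>2 * \<epsilon>\<^sup>2\<close>, and the top one by \<open>\<epsilon>\<^sup>2\<close> (\<open>cos_poly_coefficient_le\<close>).
  The stated lower bound is the value of \<open>\<epsilon>\<close> for which these inequalities put \<open>T\<close> into \<open>K\<close>
  (\<open>in_class_if_small_at_nodes\<close>).  For the Bernstein width this is the whole proof.  For the
  Kolmogorov width let \<open>F\<close> have dimension \<open>2 * n\<close>.  The determinant of the values at the nodes of a
  basis of \<open>F\<close> changes its sign when the nodes are shifted by one step, because this permutes the
  rows by a cycle of even length; so it vanishes for some shift, and there are weights
  \<open>\<mu> \<noteq> 0\<close> on these nodes which annihilate \<open>F\<close> (\<open>annihilating_weights_at_nodes\<close>).  The
  polynomial \<open>T\<close> which takes the value \<open>\<epsilon> * sgn (\<mu> j)\<close> at the \<open>j\<close>-th node lies in \<open>K\<close> and has distance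
  at least \<open>\<epsilon>\<close> from \<open>F\<close> (\<open>kolmogorov_width_ge\<close>); the linear and the projection width are not smaller.

  The widths decrease in the dimension because any \<open>F\<close> can be enlarged by a function \<open>g\<close>
  outside \<open>span (K \<union> F)\<close>: a projection onto \<open>F\<close> then extends to the larger space without
  changing on \<open>K\<close> (\<open>projection_extension\<close>).  Such a \<open>g\<close> is a lacunary cosine series whose
  frequencies are so sparse that its coefficients decay more slowly than \<open>\<psi>\<close> along them
  (\<open>continuous_function_outside\<close>).  Finally, both bounds differ from \<open>\<psi> n / sqrt pi\<close> by at most
  \<open>\<psi> n * remainder \<psi> n\<close>, so the absolute constant can be taken to be \<open>1\<close>.
\<close>

section \<open>Linear dependence\<close>

lemma nontrivial_relation_in_span:
  fixes f :: "nat \<Rightarrow> 'a::real_vector"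
  assumes B: "finite B" "card B \<le> N" and f: "\<And>i. i \<le> N \<Longrightarrow> f i \<in> span B"
  shows "\<exists>a. (\<exists>i\<le>N. a i \<noteq> 0) \<and> (\<Sum>i\<le>N. a i *\<^sub>R f i) = 0"
proof (cases "inj_on f {..N}")
  case True
  have "dependent (f ` {..N})"
  proof (rule ccontr)
    assume "\<not> dependent (f ` {..N})"
    then have "card (f ` {..N}) \<le> card B"
      using independent_span_bound[OF B(1)] f by blast
    then show False using True B by (simp add: card_image)
  qed
  then obtain u v where u: "v \<in> f ` {..N}" "u v \<noteq> 0" "(\<Sum>v\<in>f ` {..N}. u v *\<^sub>R v) = 0"
    by (auto simp: dependent_finite)
  then show ?thesis using True
    by (intro exI[of _ "u \<circ> f"]) (auto simp: sum.reindex)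
next
  case False
  then obtain i j where ij: "i \<le> N" "j \<le> N" "i \<noteq> j" "f i = f j"
    by (auto simp: inj_on_def)
  have "(\<Sum>l\<le>N. (of_bool (l = i) - of_bool (l = j)) *\<^sub>R f l)
      = (\<Sum>l\<le>N. if l = i then f l else 0) - (\<Sum>l\<le>N. if l = j then f l else 0)"
    unfolding sum_subtractf[symmetric] by (rule sum.cong) auto
  also have "\<dots> = 0" using ij by simp
  finally show ?thesis using ij
    by (intro exI[of _ "\<lambda>l. of_bool (l = i) - of_bool (l = j)"]) auto
qed

lemma linear_kernel_in_span:
  fixes L :: "'a::real_vector \<Rightarrow> 'b::real_vector"
  assumes L: "linear L" and B: "finite B" "independent B"
    and C: "finite C" "card C < card B" "L ` span B \<subseteq> span C"
  shows "\<exists>f\<in>span B. f \<noteq> 0 \<and> L f = 0"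
proof (rule ccontr)
  assume "\<not> ?thesis"
  then have "inj_on L (span B)"
    using L linear_injective_on_subspace_0[OF L subspace_span[of B]] by blast
  then have "independent (L ` B)" "inj_on L B"
    using linear_independent_injective_image[OF L B(2)] span_superset
    by (auto intro: inj_on_subset)
  moreover have "L ` B \<subseteq> span C" using C span_superset by blast
  ultimately have "card (L ` B) \<le> card C" using independent_span_bound[OF C(1)] by blast
  then show False using C \<open>inj_on L B\<close> by (simp add: card_image)
qed

text \<open>
  If all of the \<open>N + 1\<close> vectors were in the span, their components in \<open>span B\<close> would satisfy a
  nontrivial relation, which puts a nontrivial combination of the \<open>g i\<close> into \<open>S\<close>.
\<close>

lemma vector_outside_finite_extension:
  fixes g :: "nat \<Rightarrow> 'a::real_vector"
  assumes S: "subspace S" and B: "finite B" "card B \<le> N"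
    and g: "\<And>a. (\<Sum>i\<le>N. a i *\<^sub>R g i) \<in> S \<Longrightarrow> \<forall>i\<le>N. a i = 0"
  shows "\<exists>i\<le>N. g i \<notin> span (S \<union> B)"
proof (rule ccontr)
  assume "\<not> ?thesis"
  then have "\<forall>i. \<exists>s f. i \<le> N \<longrightarrow> s \<in> S \<and> f \<in> span B \<and> g i = s + f"
    unfolding span_Un using S by (auto simp: span_eq_iff[THEN iffD2]) blast+
  then obtain s f where sf: "\<And>i. i \<le> N \<Longrightarrow> s i \<in> S \<and> f i \<in> span B \<and> g i = s i + f i"
    by metis
  obtain a where a: "\<exists>i\<le>N. a i \<noteq> 0" "(\<Sum>i\<le>N. a i *\<^sub>R f i) = 0"
    using nontrivial_relation_in_span[OF B, of f] sf by blast
  have "(\<Sum>i\<le>N. a i *\<^sub>R g i) = (\<Sum>i\<le>N. a i *\<^sub>R s i) + (\<Sum>i\<le>N. a i *\<^sub>R f i)"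
    unfolding sum.distrib[symmetric] by (rule sum.cong) (auto simp: sf scaleR_add_right)
  also have "\<dots> = (\<Sum>i\<le>N. a i *\<^sub>R s i)" using a by simp
  also have "\<dots> \<in> S" using S sf by (auto intro!: subspace_sum subspace_scale)
  finally show False using g a by blast
qed

lemma linear_functional_separating_subspace:
  fixes S :: "'a::real_vector set"
  assumes "subspace S" "g \<notin> S"
  shows "\<exists>\<phi>::'a \<Rightarrow> real. linear \<phi> \<and> (\<forall>x\<in>S. \<phi> x = 0) \<and> \<phi> g = 1"
proof -
  obtain B where B: "B \<subseteq> S" "independent B" "S \<subseteq> span B"
    using maximal_independent_subset by blast
  have SB: "span B = S" using B assms by (simp add: span_subspace)
  then have "g \<notin> B" using assms span_superset by blast
  have "independent (insert g B)" using B SB assms by (simp add: independent_insert)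
  then obtain \<phi> :: "'a \<Rightarrow> real" where \<phi>: "linear \<phi>" "\<forall>x\<in>insert g B. \<phi> x = of_bool (x = g)"
    using linear_independent_extend[where f = "\<lambda>x. of_bool (x = g)"] by metis
  have "\<phi> x = 0" if "x \<in> S" for x
  proof (rule linear_eq_0_on_span[OF \<phi>(1)])
    show "x \<in> span B" using that SB by simp
    show "\<And>x. x \<in> B \<Longrightarrow> \<phi> x = 0" using \<phi>(2) \<open>g \<notin> B\<close> by auto
  qed
  then show ?thesis using \<phi> by auto
qed

lemma independent_if_dual:
  assumes "\<And>v. v \<in> B \<Longrightarrow> \<exists>L :: 'a::real_vector \<Rightarrow> real. linear L \<and> L v \<noteq> 0 \<and> (\<forall>w\<in>B - {v}. L w = 0)"
  shows "independent B"
proof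
  assume "dependent B"
  then obtain v where v: "v \<in> B" "v \<in> span (B - {v})" by (auto simp: dependent_def)
  then obtain L :: "'a \<Rightarrow> real" where "linear L" "L v \<noteq> 0" "\<forall>w\<in>B - {v}. L w = 0" using assms by blast
  then show False using linear_eq_0_on_span[of L "B - {v}" v] v by blast
qed

section \<open>Equidistant nodes\<close>

text \<open>
  The zeros of \<open>sin (n * x - \<theta>)\<close>, that is, the extrema of \<open>cos (n * x - \<theta>)\<close>.  The indices
  \<open>j < 2 * n\<close> give one period.
\<close>

definition node :: "nat \<Rightarrow> real \<Rightarrow> nat \<Rightarrow> real" where
  "node n \<theta> j = (\<theta> + real j * pi) / real n"

lemma n_times_node: "n \<ge> 1 \<Longrightarrow> real n * node n \<theta> j = \<theta> + real j * pi"
  by (simp add: node_def)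

lemma cos_top_node: "n \<ge> 1 \<Longrightarrow> cos (real n * node n \<theta> j - \<theta>) = (- 1) ^ j"
  by (simp add: n_times_node cos_npi mult.commute)

text \<open>
  The values of \<open>exp (\<i> * k * x)\<close> at the nodes form a geometric progression whose ratio is a
  \<open>2 * n\<close>-th root of unity different from \<open>1\<close>.
\<close>

lemma sum_cos_node:
  assumes "0 < k" "k < 2 * n"
  shows "(\<Sum>j<2*n. cos (real k * node n \<theta> j + \<alpha>)) = 0"
proof -
  define w where "w = cis (real k * pi / real n)"
  have n: "n > 0" using assms by simp
  have "w \<noteq> 1"
  proof
    assume "w = 1"
    then have "cos (real k * pi / real n) = 1" by (simp add: w_def complex_eq_iff)
    then obtain i :: int where i: "real k * pi / real n = real_of_int i * (2 * pi)"
      by (auto simp: cos_one_2pi_int)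
    then have "real k = real_of_int i * 2 * real n" using n by (simp add: field_simps)
    then have ik: "int k = i * (2 * int n)" 
      by (metis (mono_tags, opaque_lifting) mult.assoc of_int_eq_iff of_int_mult of_int_numeral
          of_int_of_nat_eq)
    have "0 < i * (2 * int n)" "i * (2 * int n) < 1 * (2 * int n)"
      unfolding ik[symmetric] using assms by auto
    then have "0 < i" "i < 1" unfolding mult_less_cancel_right zero_less_mult_iff using n by (simp_all only:) auto
    then show False by simp
  qed
  moreover have "w ^ (2 * n) = 1"
  proof -
    have "real (2 * n) * (real k * pi / real n) = 2 * pi * real k" using n by simp
    then have "w ^ (2 * n) = cis (2 * pi * real k)"
      by (simp only: w_def Complex.DeMoivre)
    then show ?thesis by (simp add: complex_eq_iff cos_int_2pin[of "int k", simplified] sin_int_2pin[of "int k", simplified])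
  qed
  ultimately have "(\<Sum>j<2*n. w ^ j) = 0" by (simp add: geometric_sum)
  then have "Re (cis (real k * \<theta> / real n + \<alpha>) * (\<Sum>j<2*n. w ^ j)) = 0" by simp
  also have "Re (cis (real k * \<theta> / real n + \<alpha>) * (\<Sum>j<2*n. w ^ j))
      = (\<Sum>j<2*n. Re (cis (real k * \<theta> / real n + \<alpha>) * w ^ j))"
    by (simp add: sum_distrib_left)
  also have "\<dots> = (\<Sum>j<2*n. cos (real k * node n \<theta> j + \<alpha>))"
  proof (intro sum.cong refl)
    fix j assume "j \<in> {..<2*n}"
    have "real k * \<theta> / real n + \<alpha> + real j * (real k * pi / real n) = real k * node n \<theta> j + \<alpha>"
      using n by (simp add: node_def field_simps)
    then show "Re (cis (real k * \<theta> / real n + \<alpha>) * w ^ j) = cos (real k * node n \<theta> j + \<alpha>)"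
      by (simp only: w_def Complex.DeMoivre cis_mult cis.simps)
  qed
  finally show ?thesis by simp
qed

lemma sum_cos_cos_node:
  assumes "l \<le> n" "k \<le> n" "l \<noteq> k"
  shows "(\<Sum>j<2*n. cos (real l * node n \<theta> j - a) * cos (real k * node n \<theta> j - b)) = 0"
proof -
  have *: "(\<Sum>j<2*n. cos (real l * node n \<theta> j - a) * cos (real k * node n \<theta> j - b)) = 0"
    if "l < k" "k \<le> n" for l k a b
  proof -
    have "(\<Sum>j<2*n. cos (real l * node n \<theta> j - a) * cos (real k * node n \<theta> j - b)) =
      (\<Sum>j<2*n. cos (real (k - l) * node n \<theta> j + (a - b))) / 2
      + (\<Sum>j<2*n. cos (real (k + l) * node n \<theta> j + (- a - b))) / 2"
      unfolding sum_divide_distrib sum.distrib[symmetric] using that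
      by (intro sum.cong refl) (subst mult.commute, subst cos_times_cos, simp add: of_nat_diff algebra_simps add_divide_distrib)
    also have "\<dots> = 0" using that by (subst (1 2) sum_cos_node) auto
    finally show ?thesis .
  qed
  show ?thesis
    using *[of l k a b] *[of k l b a] assms by (cases "l < k") (auto simp: mult.commute)
qed

lemma sum_cos_square_node:
  assumes "0 < k" "k < n"
  shows "(\<Sum>j<2*n. (cos (real k * node n \<theta> j - a))\<^sup>2) = real n"
proof -
  have "(\<Sum>j<2*n. (cos (real k * node n \<theta> j - a))\<^sup>2)
     = (\<Sum>j<2*n. 1/2 + cos (real (2 * k) * node n \<theta> j + (- 2 * a)) / 2)"
    by (intro sum.cong refl) (simp add: power2_eq_square cos_times_cos algebra_simps add_divide_distrib)
  also have "\<dots> = real n + (\<Sum>j<2*n. cos (real (2 * k) * node n \<theta> j + (- 2 * a))) / 2"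
    by (simp add: sum.distrib sum_divide_distrib)
  also have "\<dots> = real n" using assms by (subst sum_cos_node) auto
  finally show ?thesis .
qed

text \<open>
  Amplitudes and phases are used instead of cosine and sine coefficients because the nodes have to be
  adapted to the phase of the top harmonic, and because membership in the class depends on the
  amplitudes only.
\<close>

definition cos_poly :: "nat \<Rightarrow> real \<Rightarrow> (nat \<Rightarrow> real) \<Rightarrow> (nat \<Rightarrow> real) \<Rightarrow> real \<Rightarrow> real" where
  "cos_poly n c \<rho> \<alpha> x = c + (\<Sum>k=1..n. \<rho> k * cos (real k * x - \<alpha> k))"

lemma cos_poly_coefficient_node:
  assumes "1 \<le> k" "k \<le> n"
  shows "(\<Sum>j<2*n. cos_poly n c \<rho> \<alpha> (node n \<theta> j) * cos (real k * node n \<theta> j - \<alpha> k))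
     = \<rho> k * (\<Sum>j<2*n. (cos (real k * node n \<theta> j - \<alpha> k))\<^sup>2)"
proof -
  let ?c = "\<lambda>k j. cos (real k * node n \<theta> j - \<alpha> k)"
  have "(\<Sum>j<2*n. ?c k j) = 0"
    using sum_cos_cos_node[of 0 n k \<theta> 0 "\<alpha> k"] assms by simp
  then have c: "(\<Sum>j<2*n. c * ?c k j) = 0" by (simp flip: sum_distrib_left)
  have "(\<Sum>j<2*n. cos_poly n c \<rho> \<alpha> (node n \<theta> j) * ?c k j)
     = (\<Sum>j<2*n. c * ?c k j) + (\<Sum>j<2*n. \<Sum>l=1..n. \<rho> l * (?c l j * ?c k j))"
    by (simp add: cos_poly_def distrib_right sum_distrib_right sum.distrib mult.assoc)
  also have "\<dots> = (\<Sum>l=1..n. \<rho> l * (\<Sum>j<2*n. ?c l j * ?c k j))"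
    by (subst sum.swap) (simp add: c sum_distrib_left)
  also have "\<dots> = (\<Sum>l=1..n. if l = k then \<rho> k * (\<Sum>j<2*n. (?c k j)\<^sup>2) else 0)"
    using assms by (intro sum.cong refl) (auto simp: sum_cos_cos_node power2_eq_square)
  finally show ?thesis using assms by simp
qed

text \<open>
  Bessel's inequality for a single harmonic on the nodes.  The sum of its squares over the nodes is
  \<open>n\<close> for \<open>k < n\<close>, but \<open>2 * n\<close> for the top harmonic, whose values at the nodes are \<open>1\<close> and \<open>-1\<close>;
  this is the source of the different factors.
\<close>

lemma cos_poly_coefficient_le:
  assumes n: "n \<ge> 1" and \<theta>: "\<theta> = \<alpha> n"
    and le: "\<And>j. j < 2 * n \<Longrightarrow> \<bar>cos_poly n c \<rho> \<alpha> (node n \<theta> j)\<bar> \<le> \<epsilon>"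
    and k: "1 \<le> k" "k \<le> n"
  shows "(\<rho> k)\<^sup>2 \<le> (if k = n then \<epsilon>\<^sup>2 else 2 * \<epsilon>\<^sup>2)"
proof -
  let ?T = "\<lambda>j. cos_poly n c \<rho> \<alpha> (node n \<theta> j)"
  let ?c = "\<lambda>j. cos (real k * node n \<theta> j - \<alpha> k)"
  define q where "q = (\<Sum>j<2*n. (?c j)\<^sup>2)"
  have q: "q = (if k = n then 2 * real n else real n)"
  proof (cases "k = n")
    case True
    then have "(?c j)\<^sup>2 = 1" for j
      using cos_top_node[OF n, of "\<alpha> n" j] \<theta> by (simp flip: power_mult add: mult.commute)
    then show ?thesis using True by (simp add: q_def)
  next
    case False
    then show ?thesis using k by (simp add: q_def sum_cos_square_node)
  qed
  have "0 \<le> (\<Sum>j<2*n. (?T j - \<rho> k * ?c j)\<^sup>2)" by (simp add: sum_nonneg)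
  also have "\<dots> = (\<Sum>j<2*n. (?T j)\<^sup>2 - 2 * \<rho> k * (?T j * ?c j) + (\<rho> k)\<^sup>2 * (?c j)\<^sup>2)"
    by (intro sum.cong refl) (simp add: power2_eq_square algebra_simps)
  also have "\<dots> = (\<Sum>j<2*n. (?T j)\<^sup>2) - 2 * \<rho> k * (\<Sum>j<2*n. ?T j * ?c j) + (\<rho> k)\<^sup>2 * q"
    by (simp add: sum.distrib sum_subtractf sum_distrib_left q_def)
  also have "\<dots> = (\<Sum>j<2*n. (?T j)\<^sup>2) - (\<rho> k)\<^sup>2 * q"
    unfolding cos_poly_coefficient_node[OF k] q_def by (simp add: power2_eq_square algebra_simps)
  finally have "(\<rho> k)\<^sup>2 * q \<le> (\<Sum>j<2*n. (?T j)\<^sup>2)" by simp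
  also have "\<dots> \<le> (\<Sum>j<2*n. \<epsilon>\<^sup>2)"
    using le by (intro sum_mono) (metis abs_le_square_iff abs_of_nonneg abs_ge_zero lessThan_iff order_trans)
  finally have "(\<rho> k)\<^sup>2 * q \<le> 2 * real n * \<epsilon>\<^sup>2" by simp
  then show ?thesis using n
    by (cases "k = n") (auto simp: q mult.commute[of _ "real n"] mult.left_commute[of _ "real n"] mult.assoc)
qed

lemma combine_cosines:
  fixes y \<gamma> :: "nat \<Rightarrow> real"
  shows "\<exists>\<rho> \<alpha>. \<forall>x. (\<Sum>j\<in>J. y j * cos (x - \<gamma> j)) = \<rho> * cos (x - \<alpha>)"
proof -
  define z where "z = Complex (\<Sum>j\<in>J. y j * cos (\<gamma> j)) (\<Sum>j\<in>J. y j * sin (\<gamma> j))"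
  have z: "(\<Sum>j\<in>J. y j * cos (\<gamma> j)) = cmod z * cos (Arg z)" "(\<Sum>j\<in>J. y j * sin (\<gamma> j)) = cmod z * sin (Arg z)"
    using rcis_cmod_Arg[of z] by (auto simp: z_def rcis_def complex_eq_iff)
  have "(\<Sum>j\<in>J. y j * cos (x - \<gamma> j)) = cmod z * cos (x - Arg z)" for x
  proof -
    have "(\<Sum>j\<in>J. y j * cos (x - \<gamma> j)) = cos x * (\<Sum>j\<in>J. y j * cos (\<gamma> j)) + sin x * (\<Sum>j\<in>J. y j * sin (\<gamma> j))"
      by (simp add: cos_diff sum_distrib_left sum.distrib algebra_simps)
    then show ?thesis unfolding z by (simp add: cos_diff algebra_simps)
  qed
  then show ?thesis by blast
qed

text \<open>
  Modulo the symmetry \<open>k \<mapsto> 2 * n - k\<close> at differences of nodes, the left-hand side is the sum of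
  \<open>cos (k * s)\<close> over \<open>k < 2 * n\<close>.
\<close>

lemma interpolation_kernel_at_nodes:
  fixes \<theta> :: real
  assumes "i < 2 * n" "j < 2 * n"
  defines "s \<equiv> node n \<theta> i - node n \<theta> j"
  shows "1 + 2 * (\<Sum>k=1..<n. cos (real k * s)) + cos (real n * s) = (if i = j then 2 * real n else 0)"
proof (cases "i = j")
  case True
  then show ?thesis using assms by (simp add: of_nat_diff)
next
  case False
  have n: "n > 0" using assms by simp
  define m where "m = nat \<bar>int i - int j\<bar>"
  have m: "0 < m" "m < 2 * n" using False assms by (auto simp: m_def)
  have s: "\<bar>s\<bar> = real m * pi / real n"
  proof -
    have "s = (real i - real j) * pi / real n" using n by (simp add: s_def node_def field_simps)
    then have "\<bar>s\<bar> = \<bar>real i - real j\<bar> * pi / real n" by (simp add: abs_mult)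
    also have "\<bar>real i - real j\<bar> = real m" by (simp add: m_def)
    finally show ?thesis .
  qed
  have cs: "cos (real k * s) = cos (real k * \<bar>s\<bar>)" for k
    by (cases "s \<ge> 0") auto
  \<comment> \<open>\<open>2 * n * s\<close> is a multiple of \<open>2 * pi\<close>, so frequencies may be reflected in \<open>n\<close>\<close>
  have refl_cos: "cos (real (2 * n - k) * \<bar>s\<bar>) = cos (real k * \<bar>s\<bar>)" if "k \<le> 2 * n" for k
  proof -
    have "real (2 * n - k) * \<bar>s\<bar> = 2 * pi * real m - real k * \<bar>s\<bar>"
      using that n unfolding s by (simp add: of_nat_diff field_simps)
    also have "cos \<dots> = cos (real k * \<bar>s\<bar>)"
      by (simp add: cos_diff cos_int_2pin[of "int m", simplified] sin_int_2pin[of "int m", simplified])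
    finally show ?thesis .
  qed
  have "0 = (\<Sum>k<2*n. cos (real m * node n 0 k + 0))"
    using sum_cos_node[OF m, of 0 0] by simp
  also have "\<dots> = (\<Sum>k<2*n. cos (real k * \<bar>s\<bar>))"
    unfolding s by (intro sum.cong refl arg_cong[where f = cos]) (simp add: node_def field_simps)
  also have "{..<2*n} = insert 0 {1..<n} \<union> insert n {n+1..<2*n}" using n by auto
  also have "(\<Sum>k\<in>insert 0 {1..<n} \<union> insert n {n+1..<2*n}. cos (real k * \<bar>s\<bar>))
     = 1 + (\<Sum>k\<in>{1..<n}. cos (real k * \<bar>s\<bar>)) + cos (real n * \<bar>s\<bar>) + (\<Sum>k\<in>{n+1..<2*n}. cos (real k * \<bar>s\<bar>))"
    using n by (subst sum.union_disjoint) auto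
  also have "(\<Sum>k\<in>{n+1..<2*n}. cos (real k * \<bar>s\<bar>)) = (\<Sum>k\<in>{1..<n}. cos (real k * \<bar>s\<bar>))"
    by (rule sum.reindex_bij_witness[of _ "\<lambda>k. 2 * n - k" "\<lambda>k. 2 * n - k"])
      (use n refl_cos in \<open>auto simp: simp del: of_nat_diff\<close>)
  finally show ?thesis using False by (simp add: cs)
qed

text \<open>
  The interpolant is the sum of \<open>y j\<close> times the translate to the \<open>j\<close>-th node of the kernel above,
  divided by \<open>2 * n\<close>.  The top harmonics of all these translates agree up to sign, which is why
  the phase \<open>\<theta>\<close> can be prescribed.
\<close>

lemma cos_poly_interpolation:
  fixes y :: "nat \<Rightarrow> real"
  assumes n: "n \<ge> 1"
  shows "\<exists>c \<rho> \<alpha>. \<alpha> n = \<theta> \<and> (\<forall>i<2*n. cos_poly n c \<rho> \<alpha> (node n \<theta> i) = y i)"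
proof -
  have "\<forall>k. \<exists>\<rho> \<alpha>. \<forall>x. (\<Sum>j<2*n. y j * cos (x - real k * node n \<theta> j)) = \<rho> * cos (x - \<alpha>)"
    by (intro allI combine_cosines)
  then obtain r a where ra:
    "\<And>k x. (\<Sum>j<2*n. y j * cos (x - real k * node n \<theta> j)) = r k * cos (x - a k)" by metis
  have top: "(\<Sum>j<2*n. y j * cos (x - real n * node n \<theta> j)) = (\<Sum>j<2*n. y j * (-1)^j) * cos (x - \<theta>)" for x
  proof -
    have "cos (x - real n * node n \<theta> j) = (-1)^j * cos (x - \<theta>)" for j
    proof -
      have "x - real n * node n \<theta> j = (x - \<theta>) - real j * pi" using n_times_node[OF n] by simp
      then have "cos (x - real n * node n \<theta> j) = cos ((x - \<theta>) - real j * pi)" by (simp only:)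
      also have "\<dots> = (-1)^j * cos (x - \<theta>)" by (subst cos_diff) (simp add: cos_npi)
      finally show ?thesis .
    qed
    then show ?thesis by (simp add: sum_distrib_right mult.assoc)
  qed
  define c where "c = (\<Sum>j<2*n. y j) / (2 * n)"
  define \<rho> where "\<rho> k = (if k = n then (\<Sum>j<2*n. y j * (-1)^j) / (2 * n) else r k / n)" for k
  define \<alpha> where "\<alpha> k = (if k = n then \<theta> else a k)" for k
  have "cos_poly n c \<rho> \<alpha> (node n \<theta> i) = y i" if i: "i < 2 * n" for i
  proof -
    let ?s = "\<lambda>j. node n \<theta> i - node n \<theta> j"
    have "2 * n * cos_poly n c \<rho> \<alpha> (node n \<theta> i) = (\<Sum>j<2*n. y j)
       + 2 * (\<Sum>k=1..<n. r k * cos (real k * node n \<theta> i - a k))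
       + (\<Sum>j<2*n. y j * (-1)^j) * cos (real n * node n \<theta> i - \<theta>)"
    proof -
      have "{1..n} = insert n {1..<n}" using n by auto
      moreover have "(\<Sum>k=1..<n. \<rho> k * cos (real k * node n \<theta> i - \<alpha> k))
        = (\<Sum>k=1..<n. r k * cos (real k * node n \<theta> i - a k)) / n"
        unfolding sum_divide_distrib by (intro sum.cong) (auto simp: \<rho>_def \<alpha>_def)
      ultimately have "cos_poly n c \<rho> \<alpha> (node n \<theta> i) = (\<Sum>j<2*n. y j) / (2 * n)
         + ((\<Sum>j<2*n. y j * (-1)^j) / (2 * n) * cos (real n * node n \<theta> i - \<theta>)
         + (\<Sum>k=1..<n. r k * cos (real k * node n \<theta> i - a k)) / n)"
        by (simp add: cos_poly_def c_def) (simp add: \<rho>_def \<alpha>_def)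
      then have "2 * n * cos_poly n c \<rho> \<alpha> (node n \<theta> i) = 2 * n * \<dots>" by (simp only:)
      then show ?thesis using n
        by (simp only: distrib_left) simp
    qed
    also have "\<dots> = (\<Sum>j<2*n. y j)
       + 2 * (\<Sum>k=1..<n. \<Sum>j<2*n. y j * cos (real k * ?s j))
       + (\<Sum>j<2*n. y j * cos (real n * ?s j))"
      unfolding ra[symmetric] top[symmetric] by (simp add: right_diff_distrib)
    also have "\<dots> = (\<Sum>j<2*n. y j * (1 + 2 * (\<Sum>k=1..<n. cos (real k * ?s j)) + cos (real n * ?s j)))"
      by (subst sum.swap) (simp add: sum.distrib distrib_left sum_distrib_left mult.left_commute)
    also have "\<dots> = (\<Sum>j<2*n. y j * (if i = j then 2 * real n else 0))"
      using i by (intro sum.cong refl) (simp only: interpolation_kernel_at_nodes lessThan_iff)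
    also have "\<dots> = 2 * n * y i" using i by (simp add: if_distrib cong: if_cong)
    finally show ?thesis using n by simp
  qed
  moreover have "\<alpha> n = \<theta>" by (simp add: \<alpha>_def)
  ultimately show ?thesis by blast
qed

text \<open>
  Increasing \<open>\<theta>\<close> by \<open>pi\<close> moves every node to the next one.  This permutes the rows of the matrix of the
  values \<open>g i (node n \<theta> j)\<close> by a cycle of the even length \<open>2 * n\<close>, so the determinant changes its
  sign and by continuity has a zero.
\<close>

lemma annihilating_weights_at_nodes:
  fixes g :: "nat \<Rightarrow> real \<Rightarrow> real"
  assumes n: "n \<ge> 1"
    and cont: "\<And>i. i < 2 * n \<Longrightarrow> continuous_on UNIV (g i)"
    and per: "\<And>i x. i < 2 * n \<Longrightarrow> g i (x + 2 * pi) = g i x"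
  shows "\<exists>\<theta> \<mu>. (\<exists>j<2*n. \<mu> j \<noteq> 0) \<and> (\<forall>i<2*n. (\<Sum>j<2*n. \<mu> j * g i (node n \<theta> j)) = 0)"
proof -
  define N where "N = 2 * n"
  define M where "M \<theta> = mat N N (\<lambda>(j, i). g i (node n \<theta> j))" for \<theta>
  have M: "M \<theta> \<in> carrier_mat N N" for \<theta> by (simp add: M_def)
  define D where "D \<theta> = Determinant.det (M \<theta>)" for \<theta>
  have D_sum: "D \<theta> = (\<Sum>p | p permutes {0..<N}. signof p * (\<Prod>i=0..<N. g (p i) (node n \<theta> i)))" for \<theta>
    unfolding D_def det_def'[OF M]
    by (intro sum.cong refl arg_cong2[where f = "(*)"] prod.cong)
      (auto simp: M_def dest: permutes_in_image)
  have "continuous_on UNIV D"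
    unfolding D_sum
  proof (intro continuous_intros)
    fix p i assume "p \<in> {p. p permutes {0..<N}}" "i \<in> {0..<N}"
    then have "p i < 2 * n" by (auto simp: N_def dest: permutes_in_image)
    then show "continuous_on UNIV (\<lambda>\<theta>. g (p i) (node n \<theta> i))"
      unfolding node_def using n
      by (intro continuous_on_compose2[OF cont]) (auto intro!: continuous_intros)
  qed
  then have D_cont: "continuous_on {0..pi} D" using continuous_on_subset by blast
  have D_pi: "D pi = - D 0"
  proof -
    have step: "node n pi j = node n 0 (j + 1)" for j by (simp add: node_def algebra_simps)
    have last: "g i (node n pi (N - 1)) = g i (node n 0 0)" if "i < 2 * n" for i
    proof -
      have "node n pi (N - 1) = node n 0 0 + 2 * pi" using n by (simp add: step N_def node_def) (simp add: field_simps)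
      then show ?thesis using per that by simp
    qed
    have "D pi = (-1) ^ ((N - 1) * 1) * Determinant.det (mat N N (\<lambda>(i, j). M pi $$
       (if i < 1 then i + (N - 1) else if i < N - 1 + 1 then i - 1 else i, j)))"
      unfolding D_def by (rule det_swap_initial_rows[OF M]) (use n in \<open>auto simp: N_def\<close>)
    also have "mat N N (\<lambda>(i, j). M pi $$
       (if i < 1 then i + (N - 1) else if i < N - 1 + 1 then i - 1 else i, j)) = M 0"
      unfolding M_def by (rule eq_matI) (use n last in \<open>auto simp: N_def step\<close>)
    also have "(-1::real) ^ ((N - 1) * 1) = -1" using n by (simp add: N_def)
    finally show ?thesis by (simp add: D_def)
  qed
  have "\<exists>\<theta>. D \<theta> = 0"
  proof (cases "D 0 \<le> 0")
    case True
    then show ?thesis using IVT'[of D 0 0 pi] D_cont D_pi by auto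
  next
    case False
    then show ?thesis using IVT2'[of D pi 0 0] D_cont D_pi by auto
  qed
  then obtain \<theta> where "D \<theta> = 0" ..
  then have "Determinant.det (transpose_mat (M \<theta>)) = 0"
    using det_transpose[OF M] by (simp add: D_def)
  then obtain v where v: "v \<in> carrier_vec N" "v \<noteq> 0\<^sub>v N" "transpose_mat (M \<theta>) *\<^sub>v v = 0\<^sub>v N"
    using det_0_iff_vec_prod_zero[of "transpose_mat (M \<theta>)" N] M by auto
  have "\<exists>j<2*n. vec_index v j \<noteq> 0"
  proof (rule ccontr)
    assume "\<not> ?thesis"
    then have "v = 0\<^sub>v N" using v(1) by (intro eq_vecI) (auto simp: N_def)
    then show False using v by simp
  qed
  moreover have "(\<Sum>j<2*n. vec_index v j * g i (node n \<theta> j)) = 0" if i: "i < 2 * n" for i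
  proof -
    have "0 = vec_index (transpose_mat (M \<theta>) *\<^sub>v v) i" using v i by (simp add: N_def)
    also have "\<dots> = (\<Sum>j<2*n. vec_index v j * g i (node n \<theta> j))"
      using i v(1) by (simp add: M_def scalar_prod_def N_def lessThan_atLeast0 mult.commute)
    finally show ?thesis by simp
  qed
  ultimately show ?thesis by blast
qed

section \<open>Square-integrable functions on a period\<close>

abbreviation period :: "real measure" where
  "period \<equiv> lebesgue_on {- pi..pi}"

lemma finite_measure_period: "finite_measure period"
  by (rule finite_measureI) (simp add: emeasure_restrict_space space_restrict_space)

lemma set_integral_period: "(LINT t:{- pi..pi}|lebesgue. f t) = integral\<^sup>L period f"
  for f :: "real \<Rightarrow> real"
  by (simp add: set_lebesgue_integral_def integral_restrict_space)

lemma set_integrable_period: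
  "set_integrable lebesgue {- pi..pi} f \<longleftrightarrow> integrable period f" for f :: "real \<Rightarrow> real"
  by (simp add: set_integrable_def integrable_restrict_space)

lemma continuous_integrable_period:
  "continuous_on UNIV f \<Longrightarrow> integrable period f" for f :: "real \<Rightarrow> real"
  by (rule continuous_imp_integrable_real) (auto intro: continuous_on_subset)

definition square_integrable :: "(real \<Rightarrow> real) \<Rightarrow> bool" where
  "square_integrable f \<longleftrightarrow> f \<in> borel_measurable period \<and> integrable period (\<lambda>t. (f t)\<^sup>2)"

lemma square_integrable_continuous: "continuous_on UNIV f \<Longrightarrow> square_integrable f"
  unfolding square_integrable_def
  by (auto intro!: continuous_integrable_period continuous_intros borel_measurable_integrable)

lemma square_integrable_cos [simp, intro]: "square_integrable (\<lambda>t. cos (a * t - b))"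
  by (intro square_integrable_continuous continuous_intros)

lemma integrable_mult_square_integrable:
  assumes "square_integrable f" "square_integrable g"
  shows "integrable period (\<lambda>t. f t * g t)"
proof (rule Bochner_Integration.integrable_bound)
  show "integrable period (\<lambda>t. (f t)\<^sup>2 + (g t)\<^sup>2)"
    using assms by (simp add: square_integrable_def)
  show "(\<lambda>t. f t * g t) \<in> borel_measurable period"
    using assms by (auto simp: square_integrable_def intro: borel_measurable_times)
  have "\<bar>x * y\<bar> \<le> x\<^sup>2 + y\<^sup>2" for x y :: real
  proof -
    have "\<bar>2 * x * y\<bar> \<le> x\<^sup>2 + y\<^sup>2"
      using zero_le_power2[of "x - y"] zero_le_power2[of "x + y"]
      by (simp add: power2_diff power2_sum abs_le_iff)
    moreover have "\<bar>2 * x * y\<bar> = 2 * \<bar>x * y\<bar>" by (simp add: abs_mult)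
    ultimately show ?thesis by linarith
  qed
  then show "AE t in period. norm (f t * g t) \<le> norm ((f t)\<^sup>2 + (g t)\<^sup>2)"
    by (simp add: abs_mult)
qed

lemma square_integrable_add:
  assumes "square_integrable f" "square_integrable g"
  shows "square_integrable (\<lambda>t. f t + g t)"
proof -
  have "integrable period (\<lambda>t. (f t)\<^sup>2 + (g t)\<^sup>2 + 2 * (f t * g t))"
    using assms integrable_mult_square_integrable[OF assms] by (simp add: square_integrable_def)
  then show ?thesis using assms
    by (auto simp: square_integrable_def power2_sum mult.assoc intro: borel_measurable_add)
qed

lemma square_integrable_scale:
  "square_integrable f \<Longrightarrow> square_integrable (\<lambda>t. c * f t)"
  by (auto simp: square_integrable_def power_mult_distrib)

lemma square_integrable_diff:
  assumes "square_integrable f" "square_integrable g"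
  shows "square_integrable (\<lambda>t. f t - g t)"
  using square_integrable_add[OF assms(1) square_integrable_scale[OF assms(2), of "-1"]] by simp

lemma square_integrable_integrable:
  assumes "square_integrable f" shows "integrable period f"
  using integrable_mult_square_integrable[OF assms square_integrable_cos[of 0 0]] by simp

lemma Cauchy_Schwarz_period:
  assumes f: "square_integrable f" and g: "square_integrable g"
  shows "\<bar>integral\<^sup>L period (\<lambda>t. f t * g t)\<bar>
    \<le> sqrt (integral\<^sup>L period (\<lambda>t. (f t)\<^sup>2)) * sqrt (integral\<^sup>L period (\<lambda>t. (g t)\<^sup>2))"
proof -
  define a b c where "a = integral\<^sup>L period (\<lambda>t. (f t)\<^sup>2)"
    and "b = integral\<^sup>L period (\<lambda>t. f t * g t)" and "c = integral\<^sup>L period (\<lambda>t. (g t)\<^sup>2)"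
  have quad: "0 \<le> a - 2 * s * b + s\<^sup>2 * c" for s
  proof -
    have "0 \<le> integral\<^sup>L period (\<lambda>t. (f t - s * g t)\<^sup>2)" by simp
    also have "\<dots> = integral\<^sup>L period (\<lambda>t. (f t)\<^sup>2 - 2 * s * (f t * g t) + s\<^sup>2 * (g t)\<^sup>2)"
      by (intro arg_cong[where f = "integral\<^sup>L period"] ext) (simp add: power2_eq_square algebra_simps)
    also have "\<dots> = a - 2 * s * b + s\<^sup>2 * c"
      using f g integrable_mult_square_integrable[OF f g]
      by (simp add: a_def b_def c_def square_integrable_def)
    finally show ?thesis .
  qed
  have ac: "a \<ge> 0" "c \<ge> 0" by (simp_all add: a_def c_def)
  have "b\<^sup>2 \<le> a * c"
  proof (cases "c = 0")
    case True
    have "b = 0"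
    proof (rule ccontr)
      assume "b \<noteq> 0"
      then show False using quad[of "(a + 1) / (2 * b)"] True by (simp add: field_simps)
    qed
    then show ?thesis using ac by simp
  next
    case False
    then have "0 \<le> c * (a - 2 * (b / c) * b + (b / c)\<^sup>2 * c)"
      using quad[of "b / c"] ac by (simp only: mult_nonneg_nonneg)
    also have "\<dots> = a * c - b\<^sup>2" using False by (simp add: power2_eq_square field_simps)
    finally show ?thesis by simp
  qed
  then have "sqrt (b\<^sup>2) \<le> sqrt (a * c)" by (rule real_sqrt_le_mono)
  then show ?thesis by (simp add: real_sqrt_mult a_def b_def c_def)
qed

lemma integral_square_diff_le:
  assumes f: "square_integrable f" and g: "square_integrable g" and h: "square_integrable h"
  shows "integral\<^sup>L period (\<lambda>t. (f t - h t)\<^sup>2)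
    \<le> 2 * integral\<^sup>L period (\<lambda>t. (f t - g t)\<^sup>2) + 2 * integral\<^sup>L period (\<lambda>t. (g t - h t)\<^sup>2)"
proof -
  have i: "integrable period (\<lambda>t. (f t - g t)\<^sup>2)" "integrable period (\<lambda>t. (g t - h t)\<^sup>2)"
    "integrable period (\<lambda>t. (f t - h t)\<^sup>2)"
    using square_integrable_diff[OF f g] square_integrable_diff[OF g h] square_integrable_diff[OF f h]
    by (auto simp: square_integrable_def)
  have ineq: "(x - z)\<^sup>2 \<le> 2 * (x - y)\<^sup>2 + 2 * (y - z)\<^sup>2" for x y z :: real
    using zero_le_power2[of "(x - y) - (y - z)"] by (simp add: power2_eq_square algebra_simps)
  have "integral\<^sup>L period (\<lambda>t. (f t - h t)\<^sup>2)
    \<le> integral\<^sup>L period (\<lambda>t. 2 * (f t - g t)\<^sup>2 + 2 * (g t - h t)\<^sup>2)"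
    by (rule integral_mono) (use i ineq in auto)
  also have "\<dots> = 2 * integral\<^sup>L period (\<lambda>t. (f t - g t)\<^sup>2) + 2 * integral\<^sup>L period (\<lambda>t. (g t - h t)\<^sup>2)"
    using i by simp
  finally show ?thesis .
qed

lemma dominated_square_error_small:
  assumes m: "f \<in> borel_measurable period" "\<And>n. u n \<in> borel_measurable period"
    and w: "integrable period w" "\<And>n t. t \<in> {-pi..pi} \<Longrightarrow> (f t - u n t)\<^sup>2 \<le> w t"
    and lim: "AE t in period. (\<lambda>n. u n t) \<longlonglongrightarrow> f t" and \<epsilon>: "\<epsilon> > (0::real)"
  shows "\<exists>n. integral\<^sup>L period (\<lambda>t. (f t - u n t)\<^sup>2) < \<epsilon>"
proof -
  have "(\<lambda>n. integral\<^sup>L period (\<lambda>t. (f t - u n t)\<^sup>2)) \<longlonglongrightarrow> integral\<^sup>L period (\<lambda>t. 0)"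
  proof (rule integral_dominated_convergence[where w = w])
    show "AE t in period. (\<lambda>n. (f t - u n t)\<^sup>2) \<longlonglongrightarrow> 0"
      using lim
    proof eventually_elim
      case (elim t)
      then have "(\<lambda>n. (f t - u n t)\<^sup>2) \<longlonglongrightarrow> (f t - f t)\<^sup>2" by (intro tendsto_intros)
      then show ?case by simp
    qed
    show "AE t in period. norm ((f t - u n t)\<^sup>2) \<le> w t" for n
      by (rule AE_I2) (use w(2) in \<open>auto simp: space_restrict_space\<close>)
  qed (use m w in auto)
  then have "\<forall>\<^sub>F n in sequentially. integral\<^sup>L period (\<lambda>t. (f t - u n t)\<^sup>2) < \<epsilon>"
    by (rule order_tendstoD) (use \<epsilon> in simp)
  then show ?thesis using eventually_happens by force
qed

section \<open>Density of trigonometric polynomials\<close>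

text \<open>
  The linear span of the cosines is generated inductively, so that linear properties are proved on
  single cosines.  No bound for the degree is recorded: the only use of the degree is
  that a given function is orthogonal to all sufficiently late remainders of a Fourier series.
\<close>

inductive trig :: "(real \<Rightarrow> real) \<Rightarrow> bool" where
  cosine: "trig (\<lambda>x. cos (real k * x - \<alpha>))"
| add: "trig f \<Longrightarrow> trig g \<Longrightarrow> trig (\<lambda>x. f x + g x)"
| scale: "trig f \<Longrightarrow> trig (\<lambda>x. c * f x)"

lemma trig_const: "trig (\<lambda>x. c)"
  using trig.scale[OF trig.cosine[of 0 0], of c] by simp

lemma trig_mult_cosine:
  assumes "trig f" shows "trig (\<lambda>x. cos (real k * x - \<alpha>) * f x)"
  using assms
proof induction
  case (cosine l \<beta>)
  have *: "trig (\<lambda>x. cos (real k * x - a) * cos (real l * x - b))" if "l \<le> k" for k l a b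
  proof -
    have eq: "(\<lambda>x. cos (real k * x - a) * cos (real l * x - b)) =
      (\<lambda>x. 1/2 * cos (real (k - l) * x - (a - b)) + 1/2 * cos (real (k + l) * x - (a + b)))"
      using that by (auto simp: cos_times_cos of_nat_diff algebra_simps)
    show ?thesis unfolding eq by (intro trig.intros)
  qed
  show ?case using *[of l k \<alpha> \<beta>] *[of k l \<beta> \<alpha>] by (cases "l \<le> k") (auto simp: mult.commute)
next
  case (add f g)
  then show ?case using trig.add[OF add.IH] by (simp add: distrib_left)
next
  case (scale f c)
  then show ?case using trig.scale[OF scale.IH] by (simp add: mult.left_commute)
qed

lemma trig_mult:
  assumes "trig f" "trig g" shows "trig (\<lambda>x. f x * g x)"
  using assms(1)
proof induction
  case (cosine k \<alpha>)
  show ?case by (rule trig_mult_cosine[OF assms(2)])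
next
  case (add f h)
  then show ?case using trig.add[OF add.IH] by (simp add: distrib_right)
next
  case (scale f c)
  then show ?case using trig.scale[OF scale.IH] by (simp add: mult.assoc)
qed

lemma trig_continuous: "trig f \<Longrightarrow> continuous_on UNIV f"
  by (induction rule: trig.induct) (auto intro!: continuous_intros)

lemma trig_real_polynomial_cis:
  assumes "real_polynomial_function p" shows "trig (\<lambda>t. p (cis t))"
  using assms
proof induction
  case (linear h)
  interpret bounded_linear h by fact
  have "h (cis t) = h 1 * cos (real 1 * t - 0) + h \<i> * cos (real 1 * t - pi / 2)" for t
  proof -
    have "cis t = cos t *\<^sub>R 1 + sin t *\<^sub>R \<i>" by (simp add: complex_eq_iff)
    then have "h (cis t) = cos t * h 1 + sin t * h \<i>" by (simp only: add scaleR real_scaleR_def)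
    then show ?thesis by (simp add: cos_diff)
  qed
  moreover have "trig (\<lambda>t. h 1 * cos (real 1 * t - 0) + h \<i> * cos (real 1 * t - pi / 2))"
    by (intro trig.intros)
  ultimately show ?case by simp
qed (auto intro: trig_const trig.add trig_mult)

text \<open>
  A continuous function with equal values at both ends of the period is a continuous function on the
  unit circle, where the Stone-Weierstrass theorem applies; a polynomial in \<open>cis t\<close> is a
  trigonometric polynomial.
\<close>

lemma trig_uniformly_dense:
  assumes h: "continuous_on {-pi..pi} h" "h (-pi) = h pi" and \<epsilon>: "\<epsilon> > (0::real)"
  shows "\<exists>T. trig T \<and> (\<forall>t\<in>{-pi..pi}. \<bar>h t - T t\<bar> < \<epsilon>)"
proof -
  let ?G = "\<lambda>z. h (Arg z)"
  have G: "?G (cis t) = h t" if "t \<in> {-pi..pi}" for t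
  proof (cases "t = - pi")
    case True
    have "cis (-pi) = -1" by (simp add: complex_eq_iff)
    moreover have "Arg (-1) = pi" using Arg_cis[of pi] by simp
    ultimately show ?thesis using True h by simp
  next
    case False
    then show ?thesis using that by (simp add: Arg_cis)
  qed
  \<comment> \<open>\<open>Arg\<close> jumps at \<open>-1\<close>; but \<open>cis\<close> maps the compact preimages under \<open>h\<close> onto the preimages under \<open>?G\<close>\<close>
  have "continuous_on (sphere 0 1) ?G"
    unfolding continuous_on_closed_vimage[OF closed_sphere]
  proof (intro allI impI)
    fix B :: "real set" assume B: "closed B"
    have "?G -` B \<inter> sphere 0 1 = cis ` (h -` B \<inter> {-pi..pi})"
    proof (intro equalityI subsetI)
      fix z assume z: "z \<in> ?G -` B \<inter> sphere 0 1"
      then have "z = cis (Arg z)" by (subst cis_Arg) (auto simp: sgn_div_norm)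
      moreover have "Arg z \<in> h -` B \<inter> {-pi..pi}" using z Arg_bounded[of z] by auto
      ultimately show "z \<in> cis ` (h -` B \<inter> {-pi..pi})" by blast
    next
      fix z assume "z \<in> cis ` (h -` B \<inter> {-pi..pi})"
      then obtain t where "z = cis t" "h t \<in> B" "t \<in> {-pi..pi}" by auto
      then show "z \<in> ?G -` B \<inter> sphere 0 1" using G[of t] by simp
    qed
    moreover have "compact (h -` B \<inter> {-pi..pi})"
    proof -
      have "closed ({-pi..pi} \<inter> h -` B)"
        by (rule continuous_closed_preimage[OF h(1) _ B]) simp
      then show ?thesis
        using compact_Int_closed[OF compact_Icc, of _ "-pi" pi] by (metis Int_commute Int_left_absorb)
    qed
    moreover have "continuous_on X cis" for X
      unfolding cis_conv_exp by (intro continuous_intros)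
    ultimately show "closed (?G -` B \<inter> sphere 0 1)"
      by (simp add: compact_continuous_image compact_imp_closed)
  qed
  then obtain p where p: "real_polynomial_function p" "\<And>z. z \<in> sphere 0 1 \<Longrightarrow> \<bar>?G z - p z\<bar> < \<epsilon>"
    using Stone_Weierstrass_real_polynomial_function[OF compact_sphere, of 0 1 ?G \<epsilon>] \<epsilon> by blast
  have "\<bar>h t - p (cis t)\<bar> < \<epsilon>" if "t \<in> {-pi..pi}" for t
    using p(2)[of "cis t"] G[OF that] by simp
  then show ?thesis using trig_real_polynomial_cis[OF p(1)] by blast
qed

lemma square_integrable_approx_bounded:
  assumes f: "square_integrable f" and \<epsilon>: "\<epsilon> > (0::real)"
  shows "\<exists>n::nat. integral\<^sup>L period (\<lambda>t. (f t - max (- real n) (min (real n) (f t)))\<^sup>2) < \<epsilon>"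
proof (rule dominated_square_error_small[where w = "\<lambda>t. (f t)\<^sup>2", OF _ _ _ _ _ \<epsilon>])
  show "AE t in period. (\<lambda>n. max (- real n) (min (real n) (f t))) \<longlonglongrightarrow> f t"
  proof (rule AE_I2)
    fix t
    obtain N :: nat where N: "\<bar>f t\<bar> \<le> real N" using real_arch_simple by blast
    have "\<forall>\<^sub>F n in sequentially. max (- real n) (min (real n) (f t)) = f t"
      using eventually_ge_at_top[of N] by eventually_elim (use N in auto)
    then show "(\<lambda>n. max (- real n) (min (real n) (f t))) \<longlonglongrightarrow> f t"
      by (rule tendsto_eventually)
  qed
  show "(f t - max (- real n) (min (real n) (f t)))\<^sup>2 \<le> (f t)\<^sup>2" for n t
    unfolding abs_le_square_iff[symmetric] by (auto simp: max_def min_def)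
qed (use f in \<open>auto simp: square_integrable_def intro!: borel_measurable_max borel_measurable_min\<close>)

text \<open>
  A measurable function is almost everywhere a limit of continuous functions.  Clipping them
  to \<open>[-B, B]\<close> and multiplying them by cut-off functions that vanish at \<open>-pi\<close> and \<open>pi\<close> preserves this
  and permits dominated convergence.
\<close>

lemma bounded_approx_continuous:
  assumes f: "f \<in> borel_measurable period" and B: "\<And>t. \<bar>f t\<bar> \<le> B" and \<epsilon>: "\<epsilon> > (0::real)"
  shows "\<exists>h. continuous_on UNIV h \<and> h (-pi) = 0 \<and> h pi = 0 \<and> integral\<^sup>L period (\<lambda>t. (f t - h t)\<^sup>2) < \<epsilon>"
proof -
  have "(\<lambda>t. if t \<in> {-pi..pi} then f t else 0) \<in> borel_measurable lebesgue"
    using f by (subst borel_measurable_if) auto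
  then have "(\<lambda>t. if t \<in> {-pi..pi} then f t else 0) measurable_on UNIV"
    by (rule lebesgue_measurable_imp_measurable_on) simp
  then obtain N g where N: "negligible N" and g: "\<And>n. continuous_on UNIV (g n)"
    and lim: "\<And>t. t \<notin> N \<Longrightarrow> (\<lambda>n. g n t) \<longlonglongrightarrow> (if t \<in> {-pi..pi} then f t else 0)"
    unfolding measurable_on_def by auto
  define h where "h n t = max (- B) (min B (g n t)) * max 0 (min 1 (real n * (pi - \<bar>t\<bar>)))" for n :: nat and t
  have B0: "B \<ge> 0" using B[of 0] by simp
  have h_cont: "continuous_on UNIV (h n)" for n
    unfolding h_def by (intro continuous_intros g)
  have h_le: "\<bar>h n t\<bar> \<le> B" for n t
  proof -
    have "\<bar>max (- B) (min B (g n t))\<bar> \<le> B" "\<bar>max 0 (min 1 (real n * (pi - \<bar>t\<bar>)))\<bar> \<le> 1"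
      using B0 by (auto simp: max_def min_def)
    then show ?thesis unfolding h_def abs_mult using mult_mono[of _ B _ 1] B0 by fastforce
  qed
  have "AE t in period. t \<notin> N \<union> {-pi, pi}"
  proof -
    have "negligible (N \<union> {-pi, pi})" using N by (simp add: negligible_Un)
    then have "AE t in lebesgue. t \<notin> N \<union> {-pi, pi}"
      by (intro AE_not_in) (simp add: negligible_iff_null_sets)
    then show ?thesis by (subst AE_restrict_space_iff) auto
  qed
  then have "AE t in period. (\<lambda>n. h n t) \<longlonglongrightarrow> f t"
    using AE_space
  proof eventually_elim
    case (elim t)
    then have t: "t \<in> {-pi..pi}" "t \<noteq> -pi" "t \<noteq> pi" "t \<notin> N" by (auto simp: space_restrict_space)
    then have "pi - \<bar>t\<bar> > 0" by auto
    then obtain n0 :: nat where "1 / (pi - \<bar>t\<bar>) \<le> real n0" using real_arch_simple by blast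
    then have n0: "1 \<le> real n0 * (pi - \<bar>t\<bar>)" using \<open>pi - \<bar>t\<bar> > 0\<close> by (simp add: field_simps)
    have "\<forall>\<^sub>F n in sequentially. max 0 (min 1 (real n * (pi - \<bar>t\<bar>))) = 1"
      using eventually_ge_at_top[of n0]
    proof eventually_elim
      case (elim n)
      then have "real n0 * (pi - \<bar>t\<bar>) \<le> real n * (pi - \<bar>t\<bar>)"
        using \<open>pi - \<bar>t\<bar> > 0\<close> by (intro mult_right_mono) auto
      then show ?case using n0 by simp
    qed
    then have "(\<lambda>n. max 0 (min 1 (real n * (pi - \<bar>t\<bar>)))) \<longlonglongrightarrow> 1" by (rule tendsto_eventually)
    moreover have "(\<lambda>n. g n t) \<longlonglongrightarrow> f t" using lim[of t] t by simp
    ultimately have "(\<lambda>n. h n t) \<longlonglongrightarrow> max (- B) (min B (f t)) * 1"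
      unfolding h_def by (intro tendsto_intros)
    moreover have "max (- B) (min B (f t)) = f t" using B[of t] by linarith
    ultimately show ?case by simp
  qed
  moreover have "(f t - h n t)\<^sup>2 \<le> (2 * B)\<^sup>2" for n t
  proof -
    have "\<bar>f t - h n t\<bar> \<le> 2 * B" using B[of t] h_le[of n t] by linarith
    then show ?thesis using B0 abs_le_square_iff[of "f t - h n t" "2 * B"] by simp
  qed
  ultimately have "\<exists>n. integral\<^sup>L period (\<lambda>t. (f t - h n t)\<^sup>2) < \<epsilon>"
    by (intro dominated_square_error_small[where w = "\<lambda>_. (2 * B)\<^sup>2", OF f _ _ _ _ \<epsilon>])
      (auto intro: borel_measurable_integrable continuous_integrable_period h_cont
        finite_measure.integrable_const finite_measure_period)
  then obtain n where "integral\<^sup>L period (\<lambda>t. (f t - h n t)\<^sup>2) < \<epsilon>" ..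
  moreover have "h n (-pi) = 0" "h n pi = 0" by (simp_all add: h_def)
  ultimately show ?thesis using h_cont[of n] by blast
qed

lemma trig_dense_L2:
  assumes f: "square_integrable f" and \<epsilon>: "\<epsilon> > (0::real)"
  shows "\<exists>T. trig T \<and> integral\<^sup>L period (\<lambda>t. (f t - T t)\<^sup>2) < \<epsilon>"
proof -
  obtain n :: nat where n: "integral\<^sup>L period (\<lambda>t. (f t - max (- real n) (min (real n) (f t)))\<^sup>2) < \<epsilon> / 16"
    using square_integrable_approx_bounded[OF f, of "\<epsilon> / 16"] \<epsilon> by auto
  define g where "g t = max (- real n) (min (real n) (f t))" for t
  have gm: "g \<in> borel_measurable period" using f by (auto simp: g_def[abs_def] square_integrable_def
      intro!: borel_measurable_max borel_measurable_min)
  have gB: "\<bar>g t\<bar> \<le> real n" for t by (auto simp: g_def max_def min_def)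
  have "integrable period (\<lambda>t. (g t)\<^sup>2)"
    by (rule finite_measure.integrable_const_bound[OF finite_measure_period, where B = "(real n)\<^sup>2"])
      (use gm gB in \<open>auto simp: abs_le_square_iff[symmetric]\<close>)
  then have gs: "square_integrable g" using gm by (simp add: square_integrable_def)
  obtain h where h: "continuous_on UNIV h" "h (-pi) = 0" "h pi = 0"
    "integral\<^sup>L period (\<lambda>t. (g t - h t)\<^sup>2) < \<epsilon> / 16"
    using bounded_approx_continuous[OF gm gB, of "\<epsilon> / 16"] \<epsilon> by auto
  have hs: "square_integrable h" by (rule square_integrable_continuous[OF h(1)])
  define \<delta> where "\<delta> = sqrt (\<epsilon> / (32 * pi))"
  have \<delta>: "\<delta> > 0" "\<delta>\<^sup>2 = \<epsilon> / (32 * pi)" using \<epsilon> by (auto simp: \<delta>_def)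
  have "\<exists>T. trig T \<and> (\<forall>t\<in>{-pi..pi}. \<bar>h t - T t\<bar> < \<delta>)"
    by (rule trig_uniformly_dense) (use h \<delta> in \<open>auto intro: continuous_on_subset\<close>)
  then obtain T where T: "trig T" "\<And>t. t \<in> {-pi..pi} \<Longrightarrow> \<bar>h t - T t\<bar> < \<delta>" by blast
  have Ts: "square_integrable T" by (rule square_integrable_continuous[OF trig_continuous[OF T(1)]])
  have "integral\<^sup>L period (\<lambda>t. (h t - T t)\<^sup>2) \<le> integral\<^sup>L period (\<lambda>t. \<delta>\<^sup>2)"
  proof (rule integral_mono)
    show "integrable period (\<lambda>t. (h t - T t)\<^sup>2)"
      using square_integrable_diff[OF hs Ts] by (simp add: square_integrable_def)
    show "integrable period (\<lambda>t. \<delta>\<^sup>2)"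
      by (simp add: finite_measure.integrable_const finite_measure_period)
    show "(h t - T t)\<^sup>2 \<le> \<delta>\<^sup>2" if "t \<in> space period" for t
      using T(2)[of t] that \<delta>(1) by (simp add: space_restrict_space flip: abs_le_square_iff)
  qed
  also have "\<dots> = \<epsilon> / 16"
    using \<delta>(2) by (simp add: measure_restrict_space space_restrict_space)
  finally have hT: "integral\<^sup>L period (\<lambda>t. (h t - T t)\<^sup>2) \<le> \<epsilon> / 16" .
  have "integral\<^sup>L period (\<lambda>t. (f t - h t)\<^sup>2) < \<epsilon> / 4"
    using integral_square_diff_le[OF f gs hs] n h(4) unfolding g_def[symmetric] by simp
  then have "integral\<^sup>L period (\<lambda>t. (f t - T t)\<^sup>2) < \<epsilon>"
    using integral_square_diff_le[OF f hs Ts] hT \<epsilon> by linarith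
  then show ?thesis using T(1) by blast
qed

section \<open>Orthogonality and the remainder of the kernel\<close>

lemma integral_cos_period:
  assumes "k \<ge> 1"
  shows "integral\<^sup>L period (\<lambda>t. cos (real k * t - a)) = 0"
proof -
  have "((\<lambda>t. cos (real k * t - a)) has_integral
      sin (real k * pi - a) / real k - sin (real k * - pi - a) / real k) {-pi..pi}"
    by (rule fundamental_theorem_of_calculus)
      (use assms in \<open>auto intro!: derivative_eq_intros simp flip: has_real_derivative_iff_has_vector_derivative\<close>)
  moreover have "sin (real k * - pi - a) = sin (real k * pi - a)"
    by (simp add: sin_diff)
  ultimately have "((\<lambda>t. cos (real k * t - a)) has_integral 0) {-pi..pi}" by simp
  then show ?thesis
    by (subst lebesgue_integral_eq_integral)
      (auto intro!: continuous_integrable_period continuous_intros dest: integral_unique)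
qed

lemma integral_cos_cos_period:
  "integral\<^sup>L period (\<lambda>t. cos (real l * t - a) * cos (real k * t - b))
    = (if l \<noteq> k then 0 else if k = 0 then 2 * pi * cos a * cos b else pi * cos (b - a))"
proof -
  have i: "integrable period (\<lambda>t. cos (c * t - d))" for c d
    by (intro continuous_integrable_period continuous_intros)
  have m: "measure lebesgue {-pi..pi} = 2 * pi" by simp
  have *: "integral\<^sup>L period (\<lambda>t. cos (real l * t - a) * cos (real k * t - b))
    = (if l \<noteq> k then 0 else if k = 0 then 2 * pi * cos a * cos b else pi * cos (b - a))"
    if lk: "l \<le> k" for l k a b
  proof -
    have "(\<lambda>t. cos (real l * t - a) * cos (real k * t - b)) =
      (\<lambda>t. cos (real (k - l) * t - (b - a)) / 2 + cos (real (k + l) * t - (a + b)) / 2)"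
    proof
      fix t
      have "cos (real l * t - a) * cos (real k * t - b) = cos (real k * t - b) * cos (real l * t - a)"
        by simp
      also have "\<dots> = (cos (real (k - l) * t - (b - a)) + cos (real (k + l) * t - (a + b))) / 2"
        using that by (simp add: cos_times_cos of_nat_diff algebra_simps)
      finally show "cos (real l * t - a) * cos (real k * t - b) =
        cos (real (k - l) * t - (b - a)) / 2 + cos (real (k + l) * t - (a + b)) / 2"
        by (simp add: add_divide_distrib)
    qed
    then have e: "integral\<^sup>L period (\<lambda>t. cos (real l * t - a) * cos (real k * t - b)) =
        integral\<^sup>L period (\<lambda>t. cos (real (k - l) * t - (b - a))) / 2
        + integral\<^sup>L period (\<lambda>t. cos (real (k + l) * t - (a + b))) / 2"
      using i by simp
    consider "l < k" | "l = k" "k = 0" | "l = k" "k \<ge> 1"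
      using lk by linarith
    then show ?thesis
    proof cases
      case 1
      then show ?thesis unfolding e by (subst (1 2) integral_cos_period) auto
    next
      case 2
      have "integral\<^sup>L period (\<lambda>t. cos (- a) * cos (- b)) = cos (- a) * cos (- b) * (2 * pi)"
        by (simp add: measure_restrict_space space_restrict_space)
      then show ?thesis using 2 by (simp add: mult_ac)
    next
      case 3
      have "integral\<^sup>L period (\<lambda>t. cos (real (k + l) * t - (a + b))) = 0"
        using 3 by (intro integral_cos_period) simp
      then show ?thesis unfolding e using 3
        by (simp add: measure_restrict_space space_restrict_space cos_diff)
    qed
  qed
  show ?thesis
    using *[of l k a b] *[of k l b a] by (cases "l \<le> k") (auto simp: mult.commute)
qed

lemma L2_per_square_integrable: "f \<in> L2_per \<Longrightarrow> square_integrable f"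
  by (auto simp: L2_per_def square_integrable_def set_integrable_period intro: measurable_restrict_space1)

lemma square_integrable_sum:
  assumes "finite A" "\<And>k. k \<in> A \<Longrightarrow> square_integrable (f k)"
  shows "square_integrable (\<lambda>t. \<Sum>k\<in>A. f k t)"
  using assms
proof induction
  case empty
  show ?case using square_integrable_scale[OF square_integrable_cos[of 0 0], of 0] by simp
next
  case (insert k A)
  then show ?case by (simp add: square_integrable_add)
qed

lemma integral_square_sum_orthogonal:
  assumes f: "square_integrable f" and g: "square_integrable g"
    and 0: "integral\<^sup>L period (\<lambda>t. f t * g t) = 0"
  shows "integral\<^sup>L period (\<lambda>t. (f t + g t)\<^sup>2)
     = integral\<^sup>L period (\<lambda>t. (f t)\<^sup>2) + integral\<^sup>L period (\<lambda>t. (g t)\<^sup>2)"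
proof -
  have "integral\<^sup>L period (\<lambda>t. (f t + g t)\<^sup>2)
     = integral\<^sup>L period (\<lambda>t. (f t)\<^sup>2 + (g t)\<^sup>2 + 2 * (f t * g t))"
    by (simp add: power2_sum mult.assoc)
  also have "\<dots> = integral\<^sup>L period (\<lambda>t. (f t)\<^sup>2) + integral\<^sup>L period (\<lambda>t. (g t)\<^sup>2)"
    using f g integrable_mult_square_integrable[OF f g] 0 by (simp add: square_integrable_def)
  finally show ?thesis .
qed

locale convolution_kernel =
  fixes \<psi> \<beta> :: "nat \<Rightarrow> real" and \<Psi> :: "real \<Rightarrow> real"
  assumes pos: "\<And>k. k \<ge> 1 \<Longrightarrow> \<psi> k > 0"
    and summable: "summable (\<lambda>k. (\<psi> (k + 1))\<^sup>2)"
    and kernel: "is_kernel \<psi> \<beta> \<Psi>"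
begin

definition \<gamma> :: "nat \<Rightarrow> real" where "\<gamma> k = \<beta> k * pi / 2"

definition partial :: "nat \<Rightarrow> real \<Rightarrow> real" where
  "partial m t = (\<Sum>k=1..m. \<psi> k * cos (real k * t - \<gamma> k))"

lemma kernel_square_integrable: "square_integrable \<Psi>"
  using kernel by (simp add: is_kernel_def L2_per_square_integrable)

lemma partial_square_integrable: "square_integrable (partial m)"
  unfolding partial_def[abs_def]
  by (intro square_integrable_sum square_integrable_scale square_integrable_cos) simp

lemma rest_square_integrable: "square_integrable (\<lambda>t. \<Psi> t - partial m t)"
  by (intro square_integrable_diff kernel_square_integrable partial_square_integrable)

lemma summable_shift: "summable (\<lambda>k. (\<psi> (m + 1 + k))\<^sup>2)"
  using summable_ignore_initial_segment[OF summable, of m] by (simp add: add_ac)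

lemma integral_kernel_cos:
  "integral\<^sup>L period (\<lambda>t. \<Psi> t * cos (real k * t - \<alpha>)) = (if k = 0 then 0 else pi * \<psi> k * cos (\<alpha> - \<gamma> k))"
proof -
  have "integral\<^sup>L period (\<lambda>t. \<Psi> t * cos (real k * t)) = pi * fourier_cos \<Psi> k"
    and "integral\<^sup>L period (\<lambda>t. \<Psi> t * sin (real k * t)) = pi * fourier_sin \<Psi> k"
    by (simp_all add: fourier_cos_def fourier_sin_def set_integral_period)
  moreover have "integrable period (\<lambda>t. \<Psi> t * cos (real k * t))"
    and "integrable period (\<lambda>t. \<Psi> t * sin (real k * t))"
    using kernel_square_integrable
    by (auto intro!: integrable_mult_square_integrable square_integrable_continuous continuous_intros)
  moreover have "(\<lambda>t. \<Psi> t * cos (real k * t - \<alpha>)) =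
     (\<lambda>t. cos \<alpha> * (\<Psi> t * cos (real k * t)) + sin \<alpha> * (\<Psi> t * sin (real k * t)))"
    by (simp add: cos_diff algebra_simps fun_eq_iff)
  ultimately have "integral\<^sup>L period (\<lambda>t. \<Psi> t * cos (real k * t - \<alpha>))
     = pi * (cos \<alpha> * fourier_cos \<Psi> k + sin \<alpha> * fourier_sin \<Psi> k)"
    by (simp add: algebra_simps)
  also have "\<dots> = (if k = 0 then 0 else pi * \<psi> k * cos (\<alpha> - \<gamma> k))"
  proof (cases "k = 0")
    case True
    then show ?thesis using kernel by (simp add: is_kernel_def fourier_sin_def set_lebesgue_integral_def)
  next
    case False
    then show ?thesis using kernel by (simp add: is_kernel_def \<gamma>_def cos_diff algebra_simps)
  qed
  finally show ?thesis .
qed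

lemma integral_partial_cos:
  "integral\<^sup>L period (\<lambda>t. partial m t * cos (real k * t - \<alpha>))
    = (if 1 \<le> k \<and> k \<le> m then pi * \<psi> k * cos (\<alpha> - \<gamma> k) else 0)"
proof -
  have "integral\<^sup>L period (\<lambda>t. partial m t * cos (real k * t - \<alpha>))
     = integral\<^sup>L period (\<lambda>t. \<Sum>l=1..m. \<psi> l * (cos (real l * t - \<gamma> l) * cos (real k * t - \<alpha>)))"
    by (simp add: partial_def sum_distrib_right mult.assoc)
  also have "\<dots> = (\<Sum>l=1..m. \<psi> l * integral\<^sup>L period (\<lambda>t. cos (real l * t - \<gamma> l) * cos (real k * t - \<alpha>)))"
    by (subst Bochner_Integration.integral_sum) (auto intro!: integrable_mult_square_integrable)
  also have "\<dots> = (\<Sum>l=1..m. if l = k then pi * \<psi> k * cos (\<alpha> - \<gamma> k) else 0)"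
    by (intro sum.cong refl) (auto simp: integral_cos_cos_period)
  finally show ?thesis by auto
qed

lemma rest_orthogonal_cos:
  assumes "k \<le> m"
  shows "integral\<^sup>L period (\<lambda>t. (\<Psi> t - partial m t) * cos (real k * t - \<alpha>)) = 0"
proof -
  have "integral\<^sup>L period (\<lambda>t. (\<Psi> t - partial m t) * cos (real k * t - \<alpha>))
    = integral\<^sup>L period (\<lambda>t. \<Psi> t * cos (real k * t - \<alpha>)) - integral\<^sup>L period (\<lambda>t. partial m t * cos (real k * t - \<alpha>))"
    unfolding left_diff_distrib
    by (intro Bochner_Integration.integral_diff integrable_mult_square_integrable
        kernel_square_integrable partial_square_integrable square_integrable_cos)
  then show ?thesis using assms by (simp add: integral_kernel_cos integral_partial_cos)
qed

lemma rest_orthogonal_trig: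
  assumes "trig T"
  shows "\<exists>N. \<forall>M\<ge>N. integral\<^sup>L period (\<lambda>t. (\<Psi> t - partial M t) * T t) = 0"
  using assms
proof induction
  case (cosine k \<alpha>)
  then show ?case using rest_orthogonal_cos by blast
next
  case (add f g)
  then obtain N1 N2 where N: "\<forall>M\<ge>N1. integral\<^sup>L period (\<lambda>t. (\<Psi> t - partial M t) * f t) = 0"
    "\<forall>M\<ge>N2. integral\<^sup>L period (\<lambda>t. (\<Psi> t - partial M t) * g t) = 0" by blast
  have "integrable period (\<lambda>t. (\<Psi> t - partial M t) * h t)" if "trig h" for M h
    by (intro integrable_mult_square_integrable rest_square_integrable square_integrable_continuous
        trig_continuous that)
  then have "integral\<^sup>L period (\<lambda>t. (\<Psi> t - partial M t) * (f t + g t)) = 0" if "M \<ge> max N1 N2" for M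
    using N that add.hyps by (simp add: distrib_left)
  then show ?case by blast
next
  case (scale f c)
  then obtain N where "\<forall>M\<ge>N. integral\<^sup>L period (\<lambda>t. (\<Psi> t - partial M t) * f t) = 0" by blast
  then have "\<forall>M\<ge>N. integral\<^sup>L period (\<lambda>t. (\<Psi> t - partial M t) * (c * f t)) = 0"
    by (simp add: mult.left_commute)
  then show ?case by blast
qed

lemma rest_orthogonal_partial:
  assumes "m \<le> M"
  shows "integral\<^sup>L period (\<lambda>t. (\<Psi> t - partial M t) * partial m t) = 0"
proof -
  have "integral\<^sup>L period (\<lambda>t. (\<Psi> t - partial M t) * partial m t)
     = integral\<^sup>L period (\<lambda>t. \<Sum>l=1..m. \<psi> l * ((\<Psi> t - partial M t) * cos (real l * t - \<gamma> l)))"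
    by (simp add: partial_def[of m] sum_distrib_left mult.left_commute)
  also have "\<dots> = (\<Sum>l=1..m. \<psi> l * integral\<^sup>L period (\<lambda>t. (\<Psi> t - partial M t) * cos (real l * t - \<gamma> l)))"
    by (subst Bochner_Integration.integral_sum)
      (auto intro!: integrable_mult_square_integrable rest_square_integrable)
  also have "\<dots> = 0" using assms by (intro sum.neutral) (auto simp: rest_orthogonal_cos)
  finally show ?thesis .
qed

lemma integral_square_partial_diff:
  assumes "m \<le> M"
  shows "integral\<^sup>L period (\<lambda>t. (partial M t - partial m t)\<^sup>2) = pi * (\<Sum>k=m+1..M. (\<psi> k)\<^sup>2)"
proof -
  let ?d = "\<lambda>t. partial M t - partial m t"
  have d: "?d t = (\<Sum>k=m+1..M. \<psi> k * cos (real k * t - \<gamma> k))" for t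
  proof -
    have "{1..M} = {1..m} \<union> {m+1..M}" using assms by auto
    then have "partial M t = partial m t + (\<Sum>k=m+1..M. \<psi> k * cos (real k * t - \<gamma> k))"
      unfolding partial_def by (simp only:) (rule sum.union_disjoint, auto)
    then show ?thesis by simp
  qed
  have s: "square_integrable ?d"
    by (intro square_integrable_diff partial_square_integrable)
  have c: "integral\<^sup>L period (\<lambda>t. ?d t * cos (real k * t - \<gamma> k)) = pi * \<psi> k" if "k \<in> {m+1..M}" for k
  proof -
    have "integral\<^sup>L period (\<lambda>t. ?d t * cos (real k * t - \<gamma> k))
      = integral\<^sup>L period (\<lambda>t. partial M t * cos (real k * t - \<gamma> k))
        - integral\<^sup>L period (\<lambda>t. partial m t * cos (real k * t - \<gamma> k))"
      unfolding left_diff_distrib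
      by (intro Bochner_Integration.integral_diff integrable_mult_square_integrable
          partial_square_integrable square_integrable_cos)
    then show ?thesis using that by (simp add: integral_partial_cos)
  qed
  have "integral\<^sup>L period (\<lambda>t. (?d t)\<^sup>2)
     = integral\<^sup>L period (\<lambda>t. \<Sum>k=m+1..M. \<psi> k * (?d t * cos (real k * t - \<gamma> k)))"
  proof (rule arg_cong[where f = "integral\<^sup>L period"], rule ext)
    fix t
    have "(?d t)\<^sup>2 = ?d t * (\<Sum>k=m+1..M. \<psi> k * cos (real k * t - \<gamma> k))"
      unfolding d[symmetric] by (rule power2_eq_square)
    then show "(?d t)\<^sup>2 = (\<Sum>k=m+1..M. \<psi> k * (?d t * cos (real k * t - \<gamma> k)))"
      by (simp add: sum_distrib_left mult.left_commute)
  qed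
  also have "\<dots> = (\<Sum>k=m+1..M. \<psi> k * integral\<^sup>L period (\<lambda>t. ?d t * cos (real k * t - \<gamma> k)))"
    by (subst Bochner_Integration.integral_sum)
      (auto intro!: integrable_mult_square_integrable[OF s])
  also have "\<dots> = (\<Sum>k=m+1..M. \<psi> k * (pi * \<psi> k))" by (intro sum.cong refl arg_cong2[where f = "(*)"] c)
  finally show ?thesis by (simp add: sum_distrib_left power2_eq_square mult.left_commute)
qed

text \<open>
  Half of Parseval's identity.  Choose a trigonometric polynomial \<open>T\<close> near \<open>\<Psi>\<close>.  For large \<open>M\<close> the
  remainder \<open>\<Psi> - partial M\<close> is orthogonal to \<open>T\<close> and to all partial sums up to \<open>M\<close>, so it is
  not longer than \<open>\<Psi> - T\<close>, and \<open>\<Psi> - partial m\<close> exceeds it only by the terms between \<open>m\<close> and \<open>M\<close>.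
\<close>

lemma kernel_remainder_le:
  "integral\<^sup>L period (\<lambda>t. (\<Psi> t - partial m t)\<^sup>2) \<le> pi * (\<Sum>k. (\<psi> (m + 1 + k))\<^sup>2)"
proof (rule field_le_epsilon)
  fix \<epsilon> :: real assume "\<epsilon> > 0"
  then obtain T where T: "trig T" "integral\<^sup>L period (\<lambda>t. (\<Psi> t - T t)\<^sup>2) < \<epsilon>"
    using trig_dense_L2[OF kernel_square_integrable] by blast
  have Ts: "square_integrable T" by (intro square_integrable_continuous trig_continuous T)
  obtain N where N: "\<And>M. M \<ge> N \<Longrightarrow> integral\<^sup>L period (\<lambda>t. (\<Psi> t - partial M t) * T t) = 0"
    using rest_orthogonal_trig[OF T(1)] by blast
  define M where "M = max N m"
  have M: "M \<ge> N" "m \<le> M" by (auto simp: M_def)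
  note R = rest_square_integrable[of M] and P = partial_square_integrable
  have "integral\<^sup>L period (\<lambda>t. (\<Psi> t - partial M t) * (partial M t - T t)) =
     integral\<^sup>L period (\<lambda>t. (\<Psi> t - partial M t) * partial M t) - integral\<^sup>L period (\<lambda>t. (\<Psi> t - partial M t) * T t)"
    unfolding right_diff_distrib
    by (intro Bochner_Integration.integral_diff integrable_mult_square_integrable R P Ts)
  then have "integral\<^sup>L period (\<lambda>t. (\<Psi> t - partial M t) * (partial M t - T t)) = 0"
    using N M rest_orthogonal_partial[of M M] by simp
  from integral_square_sum_orthogonal[OF R square_integrable_diff[OF P Ts] this]
  have "integral\<^sup>L period (\<lambda>t. (\<Psi> t - T t)\<^sup>2) = integral\<^sup>L period (\<lambda>t. (\<Psi> t - partial M t)\<^sup>2)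
     + integral\<^sup>L period (\<lambda>t. (partial M t - T t)\<^sup>2)" by simp
  moreover have "integral\<^sup>L period (\<lambda>t. (partial M t - T t)\<^sup>2) \<ge> 0" by simp
  ultimately have tail: "integral\<^sup>L period (\<lambda>t. (\<Psi> t - partial M t)\<^sup>2) < \<epsilon>" using T(2) by linarith
  have "integral\<^sup>L period (\<lambda>t. (\<Psi> t - partial M t) * (partial M t - partial m t)) =
     integral\<^sup>L period (\<lambda>t. (\<Psi> t - partial M t) * partial M t) - integral\<^sup>L period (\<lambda>t. (\<Psi> t - partial M t) * partial m t)"
    unfolding right_diff_distrib
    by (intro Bochner_Integration.integral_diff integrable_mult_square_integrable R P)
  then have "integral\<^sup>L period (\<lambda>t. (\<Psi> t - partial M t) * (partial M t - partial m t)) = 0"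
    using M rest_orthogonal_partial[of M M] rest_orthogonal_partial[of m M] by simp
  from integral_square_sum_orthogonal[OF R square_integrable_diff[OF P P] this]
  have "integral\<^sup>L period (\<lambda>t. (\<Psi> t - partial m t)\<^sup>2) =
     integral\<^sup>L period (\<lambda>t. (\<Psi> t - partial M t)\<^sup>2) + pi * (\<Sum>k=m+1..M. (\<psi> k)\<^sup>2)"
    using integral_square_partial_diff[OF M(2)] by simp
  moreover have "pi * (\<Sum>k=m+1..M. (\<psi> k)\<^sup>2) \<le> pi * (\<Sum>k. (\<psi> (m + 1 + k))\<^sup>2)"
  proof -
    have "(\<Sum>k=m+1..M. (\<psi> k)\<^sup>2) = (\<Sum>k<M-m. (\<psi> (m + 1 + k))\<^sup>2)"
      by (rule sum.reindex_bij_witness[of _ "\<lambda>k. m + 1 + k" "\<lambda>k. k - (m + 1)"]) auto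
    also have "\<dots> \<le> (\<Sum>k. (\<psi> (m + 1 + k))\<^sup>2)" by (rule sum_le_suminf[OF summable_shift]) auto
    finally show ?thesis by simp
  qed
  ultimately show "integral\<^sup>L period (\<lambda>t. (\<Psi> t - partial m t)\<^sup>2) \<le> pi * (\<Sum>k. (\<psi> (m + 1 + k))\<^sup>2) + \<epsilon>"
    using tail by linarith
qed

end

section \<open>Reflected translates of periodic functions\<close>

lemma set_integral_affine:
  fixes F :: "real \<Rightarrow> real"
  assumes "c = 1 \<or> c = -1"
  shows "set_integrable lebesgue ((\<lambda>s. t + c * s) -` A) (\<lambda>s. F (t + c * s)) \<longleftrightarrow> set_integrable lebesgue A F"
    and "(LINT s:((\<lambda>s. t + c * s) -` A)|lebesgue. F (t + c * s)) = (LINT s:A|lebesgue. F s)"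
  using assms lebesgue_integrable_real_affine_iff[of c "\<lambda>s. indicator A s *\<^sub>R F s" t]
    lebesgue_integral_real_affine[of c "\<lambda>s. indicator A s *\<^sub>R F s" t]
  by (auto simp: set_integrable_def set_lebesgue_integral_def indicator_vimage)

lemma periodic_int_multiple:
  assumes "periodic_2pi F" shows "F (x + 2 * pi * of_int k) = F x"
proof -
  have n: "F (x + 2 * pi * real n) = F x" for x n
  proof (induction n)
    case (Suc n)
    have "F (x + 2 * pi * real (Suc n)) = F ((x + 2 * pi * real n) + 2 * pi)" by (simp add: algebra_simps)
    also have "\<dots> = F x" using assms Suc unfolding periodic_2pi_def by metis
    finally show ?case .
  qed simp
  show ?thesis
  proof (cases "k \<ge> 0")
    case True
    then show ?thesis using n[of x "nat k"] by simp
  next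
    case False
    then show ?thesis using n[of "x + 2 * pi * of_int k" "nat (- k)"] by simp
  qed
qed

lemma set_integral_split:
  fixes F :: "real \<Rightarrow> real"
  assumes "a \<le> c" "c \<le> b" "set_integrable lebesgue {a..c} F" "set_integrable lebesgue {c..b} F"
  shows "set_integrable lebesgue {a..b} F"
    and "(LINT s:{a..b}|lebesgue. F s) = (LINT s:{a..c}|lebesgue. F s) + (LINT s:{c..b}|lebesgue. F s)"
proof -
  have u: "{a..b} = {a..c} \<union> {c..b}" using assms by auto
  show "set_integrable lebesgue {a..b} F"
    unfolding u by (rule set_integrable_Un) (use assms in auto)
  have "AE s in lebesgue. s \<notin> {c}"
    by (rule AE_not_in) (simp flip: negligible_iff_null_sets)
  then have "AE s in lebesgue. \<not> (s \<in> {a..c} \<and> s \<in> {c..b})"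
    by eventually_elim auto
  then show "(LINT s:{a..b}|lebesgue. F s) = (LINT s:{a..c}|lebesgue. F s) + (LINT s:{c..b}|lebesgue. F s)"
    unfolding u by (intro set_integral_Un_AE) (use assms in auto)
qed

text \<open>
  Up to a multiple of \<open>2 * pi\<close>, the translated period is \<open>[a, a + 2 * pi]\<close> with \<open>-pi \<le> a \<le> pi\<close>.  Its
  part to the right of \<open>pi\<close> is a translate of \<open>[-pi, a]\<close>.
\<close>

lemma period_reflected_translate:
  assumes per: "periodic_2pi F" and int: "integrable period F"
  shows "integrable period (\<lambda>t. F (x - t))"
    and "integral\<^sup>L period (\<lambda>t. F (x - t)) = integral\<^sup>L period F"
proof -
  define k where "k = \<lfloor>x / (2 * pi)\<rfloor>"
  define a where "a = x - 2 * pi * of_int k - pi"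
  have "of_int k \<le> x / (2 * pi)" "x / (2 * pi) < of_int k + 1" unfolding k_def by linarith+
  then have a: "-pi \<le> a" "a \<le> pi" by (simp_all add: a_def field_simps)
  have I: "set_integrable lebesgue {-pi..pi} F" using int by (simp add: set_integrable_period)
  have Il: "set_integrable lebesgue {-pi..a} F" and Ir: "set_integrable lebesgue {a..pi} F"
    using a by (auto intro: set_integrable_subset[OF I])
  have split: "(LINT s:{-pi..pi}|lebesgue. F s) = (LINT s:{-pi..a}|lebesgue. F s) + (LINT s:{a..pi}|lebesgue. F s)"
    by (rule set_integral_split(2)[OF a Il Ir])
  have v: "(\<lambda>s. - (2 * pi) + 1 * s) -` {-pi..a} = {pi..a + 2 * pi}" by auto
  have p: "F (- (2 * pi) + 1 * s) = F s" for s
    using periodic_int_multiple[OF per, of s "-1"] by (simp add: add.commute)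
  have sh: "set_integrable lebesgue {pi..a + 2 * pi} F"
    "(LINT s:{pi..a + 2 * pi}|lebesgue. F s) = (LINT s:{-pi..a}|lebesgue. F s)"
    using set_integral_affine[of 1 "- (2 * pi)" "{-pi..a}" F] Il unfolding v p by simp_all
  have tr: "set_integrable lebesgue {a..a + 2 * pi} F"
    "(LINT s:{a..a + 2 * pi}|lebesgue. F s) = integral\<^sup>L period F"
    using set_integral_split[of a pi "a + 2 * pi" F] a Ir sh split by (auto simp: set_integral_period)
  have v': "(\<lambda>s. (x - 2 * pi * of_int k) + -1 * s) -` {a..a + 2 * pi} = {-pi..pi}"
    by (auto simp: a_def)
  have p': "F ((x - 2 * pi * of_int k) + -1 * s) = F (x - s)" for s
    using periodic_int_multiple[OF per, of "x - s" "- k"] by (simp add: algebra_simps)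
  show "integrable period (\<lambda>t. F (x - t))" "integral\<^sup>L period (\<lambda>t. F (x - t)) = integral\<^sup>L period F"
    using set_integral_affine[of "-1" "x - 2 * pi * of_int k" "{a..a + 2 * pi}" F] tr
    unfolding v' p' by (simp_all add: set_integrable_period set_integral_period)
qed

section \<open>Fourier sums on bounded continuous functions\<close>

text \<open>
  The phases \<open>0\<close> and \<open>pi / 2\<close> give \<open>pi\<close> times the cosine and the sine coefficient.
\<close>

definition fourier_coefficient :: "nat \<Rightarrow> real \<Rightarrow> (real \<Rightarrow>\<^sub>C real) \<Rightarrow> real" where
  "fourier_coefficient k a f = integral\<^sup>L period (\<lambda>t. apply_bcontfun f t * cos (real k * t - a))"

lemma bcontfun_continuous: "continuous_on UNIV (apply_bcontfun f)"
  using apply_bcontfun[of f] by (simp add: bcontfun_def)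

lemma bcontfun_le_norm: "\<bar>apply_bcontfun f x\<bar> \<le> norm f" for f :: "real \<Rightarrow>\<^sub>C real"
  using norm_bounded[of f x] by simp

lemma integrable_fourier_coefficient:
  "integrable period (\<lambda>t. apply_bcontfun f t * cos (real k * t - a))"
  by (intro continuous_integrable_period continuous_intros bcontfun_continuous)

lemma integral_period_abs_le:
  assumes f: "integrable period f" and "\<And>t. \<bar>f t\<bar> \<le> c"
  shows "\<bar>integral\<^sup>L period f\<bar> \<le> 2 * pi * c"
proof -
  have "norm (integral\<^sup>L period f) \<le> integral\<^sup>L period (\<lambda>t. norm (f t))"
    by (rule integral_norm_bound)
  also have "\<dots> \<le> integral\<^sup>L period (\<lambda>t. c)"
    by (rule integral_mono)
      (use assms in \<open>auto intro: finite_measure.integrable_const finite_measure_period\<close>)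
  also have "\<dots> = 2 * pi * c" by (simp add: measure_restrict_space space_restrict_space)
  finally show ?thesis by simp
qed

lemma bounded_linear_fourier_coefficient: "bounded_linear (fourier_coefficient k a)"
proof (rule bounded_linear_intro[where K = "2 * pi"])
  fix f g :: "real \<Rightarrow>\<^sub>C real" and r :: real
  show "fourier_coefficient k a (f + g) = fourier_coefficient k a f + fourier_coefficient k a g"
    using integrable_fourier_coefficient[of f k a] integrable_fourier_coefficient[of g k a]
    by (simp add: fourier_coefficient_def distrib_right)
  show "fourier_coefficient k a (r *\<^sub>R f) = r *\<^sub>R fourier_coefficient k a f"
    by (simp add: fourier_coefficient_def mult.assoc)
  have "\<bar>apply_bcontfun f t * cos (real k * t - a)\<bar> \<le> norm f" for t
    using mult_mono[OF bcontfun_le_norm[of f t] abs_cos_le_one] by (simp add: abs_mult)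
  then show "norm (fourier_coefficient k a f) \<le> norm f * (2 * pi)"
    unfolding fourier_coefficient_def
    using integral_period_abs_le[OF integrable_fourier_coefficient] by (simp add: mult.commute)
qed

lemma fourier_cos_eq: "fourier_cos (apply_bcontfun f) k = fourier_coefficient k 0 f / pi"
  by (simp add: fourier_cos_def fourier_coefficient_def set_integral_period)

lemma fourier_sin_eq: "fourier_sin (apply_bcontfun f) k = fourier_coefficient k (pi / 2) f / pi"
  by (simp add: fourier_sin_def fourier_coefficient_def set_integral_period cos_diff)

lemma apply_bcontfun_sum: "apply_bcontfun (\<Sum>i\<in>A. f i) x = (\<Sum>i\<in>A. apply_bcontfun (f i) x)"
  for f :: "'i \<Rightarrow> (real \<Rightarrow>\<^sub>C real)"
  by (induction A rule: infinite_finite_induct) auto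

lemma bounded_linear_apply_bcontfun: "bounded_linear (\<lambda>f :: real \<Rightarrow>\<^sub>C real. apply_bcontfun f x)"
  by (rule bounded_linear_intro[where K = 1]) (auto simp: bcontfun_le_norm)

definition harmonic :: "nat \<Rightarrow> real \<Rightarrow> (real \<Rightarrow>\<^sub>C real)" where
  "harmonic k a = Bcontfun (\<lambda>x. cos (real k * x - a))"

lemma apply_harmonic [simp]: "apply_bcontfun (harmonic k a) x = cos (real k * x - a)"
proof -
  have "(\<lambda>x. cos (real k * x - a)) \<in> bcontfun"
    by (auto simp: bcontfun_def bounded_iff intro!: continuous_intros exI[of _ 1])
  then show ?thesis by (simp add: harmonic_def Bcontfun_inverse)
qed

lemma periodic_cos: "cos (real k * (x + 2 * pi) - a) = cos (real k * x - a)"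
proof -
  have "real k * (x + 2 * pi) - a = (real k * x - a) + 2 * pi * real k" by (simp add: algebra_simps)
  then show ?thesis
    by (simp only: cos_add) (simp add: cos_int_2pin[of "int k", simplified] sin_int_2pin[of "int k", simplified])
qed

lemma harmonic_in_C_per: "harmonic k a \<in> C_per"
  by (simp add: C_per_def periodic_2pi_def periodic_cos)

lemma norm_harmonic_le: "norm (harmonic k a) \<le> 1"
  by (rule norm_bound) simp

lemma subspace_C_per: "subspace C_per"
  by (rule subspaceI) (auto simp: C_per_def periodic_2pi_def)

lemma fourier_coefficient_harmonic:
  "fourier_coefficient k a (harmonic l b)
    = (if l \<noteq> k then 0 else if k = 0 then 2 * pi * cos b * cos a else pi * cos (a - b))"
  by (simp add: fourier_coefficient_def integral_cos_cos_period)

lemma fourier_sum_eq: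
  "fourier_sum m (apply_bcontfun f) = (fourier_coefficient 0 0 f / (2 * pi)) *\<^sub>R harmonic 0 0
     + (\<Sum>k=1..m. (fourier_coefficient k 0 f / pi) *\<^sub>R harmonic k 0
        + (fourier_coefficient k (pi / 2) f / pi) *\<^sub>R harmonic k (pi / 2))"
  by (rule bcontfun_eqI)
    (simp add: apply_fourier_sum apply_bcontfun_sum fourier_cos_eq fourier_sin_eq cos_diff)

lemma linear_fourier_sum: "linear (\<lambda>f. fourier_sum m (apply_bcontfun f))"
proof -
  have l: "linear (fourier_coefficient k a)" for k a
    by (rule bounded_linear.linear[OF bounded_linear_fourier_coefficient])
  show ?thesis
    unfolding fourier_sum_eq
    by (rule linearI)
      (simp_all add: linear_add[OF l] linear_scale[OF l] scaleR_add_left sum.distrib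
        scaleR_sum_right scaleR_add_right add_divide_distrib add_ac)
qed

text \<open>
  The phase \<open>pi / 2\<close> turns a cosine into a sine; the sine of frequency \<open>0\<close> vanishes and is left out.
\<close>

definition harmonics :: "nat \<Rightarrow> (real \<Rightarrow>\<^sub>C real) set" where
  "harmonics m = (\<lambda>(k, a). harmonic k a) ` ({..m} \<times> {0, pi / 2} - {(0, pi / 2)})"

lemma harmonicsE:
  assumes "f \<in> harmonics m"
  obtains k a where "(k, a) \<in> {..m} \<times> {0, pi / 2} - {(0, pi / 2)}" "f = harmonic k a"
proof -
  obtain p where p: "p \<in> {..m} \<times> {0, pi / 2} - {(0, pi / 2)}" "f = (\<lambda>(k, a). harmonic k a) p"
    using assms unfolding harmonics_def by blast
  obtain k a where "p = (k, a)" by (cases p)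
  then show thesis using that[of k a] p by (simp only: case_prod_conv)
qed

lemma fourier_sum_in_span_harmonics: "fourier_sum m (apply_bcontfun f) \<in> span (harmonics m)"
proof -
  have h: "harmonic k a \<in> span (harmonics m)" if "k \<le> m" "a = 0 \<or> a = pi / 2 \<and> k \<noteq> 0" for k a
  proof (rule span_base)
    have "(k, a) \<in> {..m} \<times> {0, pi / 2} - {(0, pi / 2)}" using that by auto
    then show "harmonic k a \<in> harmonics m" unfolding harmonics_def by (rule rev_image_eqI) simp
  qed
  show ?thesis
    unfolding fourier_sum_eq by (intro span_add span_sum span_scale h) auto
qed

lemma fourier_sum_harmonic:
  assumes "l \<le> m"
  shows "fourier_sum m (apply_bcontfun (harmonic l b)) = harmonic l b"
proof (rule bcontfun_eqI)
  fix x
  let ?s = "\<lambda>k. fourier_coefficient k 0 (harmonic l b) / pi * cos (real k * x)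
      + fourier_coefficient k (pi / 2) (harmonic l b) / pi * sin (real k * x)"
  have "?s k = (if k = l then cos (real l * x - b) else 0)" if "k \<in> {1..m}" for k
    using that by (auto simp: fourier_coefficient_harmonic cos_diff)
  then have "(\<Sum>k=1..m. ?s k) = (\<Sum>k=1..m. if k = l then cos (real l * x - b) else 0)"
    by (intro sum.cong) auto
  also have "\<dots> = (if l = 0 then 0 else cos (real l * x - b))" using assms by auto
  finally show "apply_bcontfun (fourier_sum m (apply_bcontfun (harmonic l b))) x = apply_bcontfun (harmonic l b) x"
    by (simp add: apply_fourier_sum fourier_cos_eq fourier_sin_eq fourier_coefficient_harmonic)
qed

lemma fourier_sum_id_on_span_harmonics:
  assumes "f \<in> span (harmonics m)" shows "fourier_sum m (apply_bcontfun f) = f"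
proof (rule linear_eq_on_span[OF linear_fourier_sum linear_ident _ assms])
  fix f assume "f \<in> harmonics m"
  then show "fourier_sum m (apply_bcontfun f) = f"
    by (elim harmonicsE) (auto simp: fourier_sum_harmonic)
qed

lemma harmonics_basis: "finite (harmonics m)" "card (harmonics m) = 2 * m + 1" "independent (harmonics m)"
proof -
  let ?J = "{..m} \<times> {0, pi / 2} - {(0::nat, pi / 2)}"
  have dual: "fourier_coefficient k a (harmonic l b) \<noteq> 0 \<longleftrightarrow> (l, b) = (k, a)"
    if J: "(k, a) \<in> ?J" "(l, b) \<in> ?J" for k a l b
  proof -
    have "a = 0 \<or> a = pi / 2 \<and> k \<noteq> 0" "b = 0 \<or> b = pi / 2 \<and> l \<noteq> 0" using J by auto
    then show ?thesis
      unfolding fourier_coefficient_harmonic by (elim disjE conjE; simp only:; auto)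
  qed
  have inj: "inj_on (\<lambda>(k, a). harmonic k a) ?J"
  proof (rule inj_onI)
    fix p q assume pq: "p \<in> ?J" "q \<in> ?J" "(\<lambda>(k, a). harmonic k a) p = (\<lambda>(k, a). harmonic k a) q"
    obtain k a l b where e: "p = (k, a)" "q = (l, b)" by (cases p, cases q)
    have "harmonic k a = harmonic l b" using pq(3) unfolding e by (simp only: case_prod_conv)
    then have "(l, b) = (k, a)" using dual[of k a l b] dual[of k a k a] pq(1,2) unfolding e by metis
    then show "p = q" unfolding e by (rule sym)
  qed
  show "finite (harmonics m)" by (simp add: harmonics_def)
  have "card (harmonics m) = card ?J" unfolding harmonics_def by (rule card_image[OF inj])
  also have "\<dots> = 2 * m + 1" by (subst card_Diff_subset) (auto simp: card_cartesian_product)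
  finally show "card (harmonics m) = 2 * m + 1" .
  show "independent (harmonics m)"
  proof (rule independent_if_dual)
    fix v assume "v \<in> harmonics m"
    then obtain k a where ka: "(k, a) \<in> ?J" "v = harmonic k a" by (elim harmonicsE)
    have "fourier_coefficient k a w = 0" if w: "w \<in> harmonics m - {v}" for w
    proof -
      obtain l b where lb: "(l, b) \<in> ?J" "w = harmonic l b" by (rule harmonicsE[OF DiffD1[OF w]])
      have "(l, b) \<noteq> (k, a)" using w ka(2) lb(2) by blast
      then show ?thesis using dual[OF ka(1) lb(1)] lb(2) by blast
    qed
    moreover have "fourier_coefficient k a v \<noteq> 0" using dual[OF ka(1) ka(1)] ka(2) by blast
    ultimately show "\<exists>L :: _ \<Rightarrow> real. linear L \<and> L v \<noteq> 0 \<and> (\<forall>w\<in>harmonics m - {v}. L w = 0)"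
      using bounded_linear.linear[OF bounded_linear_fourier_coefficient] by blast
  qed
qed

lemma span_harmonics_in_C_per: "span (harmonics m) \<subseteq> C_per"
  by (rule span_minimal[OF _ subspace_C_per]) (auto elim!: harmonicsE intro: harmonic_in_C_per)

lemma span_harmonics_dim: "span (harmonics m) \<in> subspaces_of_dim C_per (2 * m + 1)"
  unfolding subspaces_of_dim_def using harmonics_basis span_harmonics_in_C_per by blast

lemma span_harmonics_cos_poly:
  assumes "f \<in> span (harmonics m)"
  shows "\<exists>c \<rho> \<alpha>. \<forall>x. apply_bcontfun f x = cos_poly m c \<rho> \<alpha> x"
proof -
  define A where "A k = fourier_cos (apply_bcontfun f) k" for k
  define B where "B k = fourier_sin (apply_bcontfun f) k" for k
  have "\<exists>\<rho> \<alpha>. \<forall>x. A k * cos x + B k * sin x = \<rho> * cos (x - \<alpha>)" for k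
    using combine_cosines[of "\<lambda>j. if j = 0 then A k else B k" "\<lambda>j. if j = 0 then 0 else pi / 2" "{0, 1}"]
    by (simp add: cos_diff)
  then obtain \<rho> \<alpha> where "\<And>k x. A k * cos x + B k * sin x = \<rho> k * cos (x - \<alpha> k)" by metis
  then have "apply_bcontfun f x = cos_poly m (fourier_cos (apply_bcontfun f) 0 / 2) \<rho> \<alpha> x" for x
    using apply_fourier_sum[of m "apply_bcontfun f" x] fourier_sum_id_on_span_harmonics[OF assms]
    by (simp add: cos_poly_def A_def B_def)
  then show ?thesis by blast
qed

lemma cos_poly_in_C_per:
  "\<exists>f\<in>C_per. \<forall>x. apply_bcontfun f x = cos_poly m c \<rho> \<alpha> x"
proof
  let ?f = "c *\<^sub>R harmonic 0 0 + (\<Sum>k=1..m. \<rho> k *\<^sub>R harmonic k (\<alpha> k))"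
  show "?f \<in> C_per"
    by (intro subspace_add subspace_sum subspace_scale subspace_C_per harmonic_in_C_per)
  show "\<forall>x. apply_bcontfun ?f x = cos_poly m c \<rho> \<alpha> x"
    by (simp add: apply_bcontfun_sum cos_poly_def)
qed

section \<open>The class of convolutions\<close>

lemma L2_per_reflected_translate:
  assumes "\<phi> \<in> L2_per"
  shows "square_integrable (\<lambda>t. \<phi> (x - t))"
    and "integral\<^sup>L period (\<lambda>t. (\<phi> (x - t))\<^sup>2) = (L2_per_norm \<phi>)\<^sup>2"
proof -
  have p: "periodic_2pi (\<lambda>s. (\<phi> s)\<^sup>2)" using assms by (simp add: L2_per_def periodic_2pi_def)
  have i: "integrable period (\<lambda>s. (\<phi> s)\<^sup>2)" using assms by (simp add: L2_per_def set_integrable_period)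
  have "(\<lambda>t. \<phi> (x + (-1) *\<^sub>R t)) \<in> borel_measurable lebesgue"
    by (rule borel_measurable_affine) (use assms in \<open>auto simp: L2_per_def\<close>)
  then have "(\<lambda>t. \<phi> (x - t)) \<in> borel_measurable period"
    by (intro measurable_restrict_space1) simp
  then show "square_integrable (\<lambda>t. \<phi> (x - t))"
    using period_reflected_translate(1)[OF p i] by (simp add: square_integrable_def)
  show "integral\<^sup>L period (\<lambda>t. (\<phi> (x - t))\<^sup>2) = (L2_per_norm \<phi>)\<^sup>2"
    using period_reflected_translate(2)[OF p i] by (simp add: L2_per_norm_def set_integral_period)
qed

text \<open>
  The bound \<open>pi\<close> is a rough form of the estimate \<open>sqrt (2 * pi)\<close> from the Cauchy-Schwarz
  inequality; it only matters that it does not depend on \<open>k\<close> and \<open>\<phi>\<close>.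
\<close>

lemma convolution_with_cosine:
  assumes \<phi>: "\<phi> \<in> L2_per" "L2_per_norm \<phi> \<le> 1"
  shows "\<exists>A B. \<bar>A\<bar> \<le> pi \<and> \<bar>B\<bar> \<le> pi \<and>
    (\<forall>x. integral\<^sup>L period (\<lambda>t. \<phi> (x - t) * cos (real k * t - a)) = A * cos (real k * x) + B * sin (real k * x))"
proof -
  have s: "square_integrable \<phi>" by (rule L2_per_square_integrable[OF \<phi>(1)])
  have bound: "\<bar>integral\<^sup>L period (\<lambda>s. \<phi> s * cos (real k * s - b))\<bar> \<le> pi" for b
  proof -
    have "\<bar>integral\<^sup>L period (\<lambda>s. \<phi> s * cos (real k * s - b))\<bar>
      \<le> sqrt (integral\<^sup>L period (\<lambda>s. (\<phi> s)\<^sup>2)) * sqrt (integral\<^sup>L period (\<lambda>s. (cos (real k * s - b))\<^sup>2))"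
      by (rule Cauchy_Schwarz_period[OF s]) simp
    also have "\<dots> \<le> 1 * sqrt (2 * pi)"
    proof (rule mult_mono)
      show "sqrt (integral\<^sup>L period (\<lambda>s. (\<phi> s)\<^sup>2)) \<le> 1"
        using \<phi>(2) by (simp add: L2_per_norm_def set_integral_period)
      have "\<bar>integral\<^sup>L period (\<lambda>s. (cos (real k * s - b))\<^sup>2)\<bar> \<le> 2 * pi * 1"
        by (rule integral_period_abs_le)
          (auto intro!: continuous_integrable_period continuous_intros simp: abs_square_le_1)
      then show "sqrt (integral\<^sup>L period (\<lambda>s. (cos (real k * s - b))\<^sup>2)) \<le> sqrt (2 * pi)" by simp
    qed auto
    also have "1 * sqrt (2 * pi) \<le> sqrt (pi * pi)"
      unfolding mult_1 using pi_ge_two by (intro real_sqrt_le_mono mult_right_mono) auto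
    finally show ?thesis by simp
  qed
  let ?A = "integral\<^sup>L period (\<lambda>s. \<phi> s * cos (real k * s - (- a)))"
  let ?B = "integral\<^sup>L period (\<lambda>s. \<phi> s * cos (real k * s - (pi / 2 - a)))"
  have "integral\<^sup>L period (\<lambda>t. \<phi> (x - t) * cos (real k * t - a)) = ?A * cos (real k * x) + ?B * sin (real k * x)" for x
  proof -
    let ?F = "\<lambda>s. \<phi> s * cos (real k * s - (real k * x - a))"
    have "periodic_2pi ?F" using \<phi>(1) by (simp add: L2_per_def periodic_2pi_def periodic_cos)
    moreover have "integrable period ?F" by (intro integrable_mult_square_integrable s) simp
    moreover have "?F (x - t) = \<phi> (x - t) * cos (real k * t - a)" for t
    proof -
      have "real k * (x - t) - (real k * x - a) = - (real k * t - a)" by (simp add: algebra_simps)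
      then show ?thesis by (simp only: cos_minus)
    qed
    ultimately have "integral\<^sup>L period (\<lambda>t. \<phi> (x - t) * cos (real k * t - a)) = integral\<^sup>L period ?F"
      using period_reflected_translate(2)[of ?F x] by (simp only:)
    also have "?F = (\<lambda>s. (\<phi> s * cos (real k * s - (- a))) * cos (real k * x)
        + (\<phi> s * cos (real k * s - (pi / 2 - a))) * sin (real k * x))"
    proof
      fix s
      have "cos (real k * s - (pi / 2 - a)) = cos ((real k * s + a) - pi / 2)" by (simp add: algebra_simps)
      also have "\<dots> = sin (real k * s + a)" by (simp add: cos_diff)
      finally have 1: "cos (real k * s - (pi / 2 - a)) = sin (real k * s + a)" .
      have "cos (real k * s - (real k * x - a)) = cos ((real k * s + a) - real k * x)" by (simp add: algebra_simps)
      also have "\<dots> = cos (real k * s + a) * cos (real k * x) + sin (real k * s + a) * sin (real k * x)"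
        by (rule cos_diff)
      finally show "?F s = (\<phi> s * cos (real k * s - (- a))) * cos (real k * x)
        + (\<phi> s * cos (real k * s - (pi / 2 - a))) * sin (real k * x)"
        unfolding 1 by (simp add: algebra_simps)
    qed
    also have "integral\<^sup>L period \<dots> = ?A * cos (real k * x) + ?B * sin (real k * x)"
      by (subst Bochner_Integration.integral_add)
        (intro integrable_mult_left integrable_mult_square_integrable s square_integrable_cos
          | simp only: integral_mult_left_zero)+
    finally show ?thesis .
  qed
  then show ?thesis using bound[of "- a"] bound[of "pi / 2 - a"] by blast
qed

lemma integral_square_cosine_sum:
  "integral\<^sup>L period (\<lambda>t. (\<Sum>k=1..n. r k * cos (real k * t - \<delta> k))\<^sup>2) = pi * (\<Sum>k=1..n. (r k)\<^sup>2)"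
proof -
  have "(\<lambda>t. (\<Sum>k=1..n. r k * cos (real k * t - \<delta> k))\<^sup>2) =
    (\<lambda>t. \<Sum>k=1..n. \<Sum>l=1..n. r k * r l * (cos (real k * t - \<delta> k) * cos (real l * t - \<delta> l)))"
    by (simp add: power2_eq_square sum_product algebra_simps)
  then have "integral\<^sup>L period (\<lambda>t. (\<Sum>k=1..n. r k * cos (real k * t - \<delta> k))\<^sup>2)
    = (\<Sum>k=1..n. \<Sum>l=1..n. r k * r l * integral\<^sup>L period (\<lambda>t. cos (real k * t - \<delta> k) * cos (real l * t - \<delta> l)))"
    by (simp add: Bochner_Integration.integral_sum integrable_mult_square_integrable)
  also have "\<dots> = (\<Sum>k=1..n. \<Sum>l=1..n. if l = k then pi * (r k)\<^sup>2 else 0)"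
    by (intro sum.cong refl) (auto simp: integral_cos_cos_period power2_eq_square)
  finally show ?thesis by (simp add: sum_distrib_left)
qed

context convolution_kernel
begin

definition tail :: "nat \<Rightarrow> real" where "tail m = sqrt (\<Sum>k. (\<psi> (m + 1 + k))\<^sup>2)"

lemma tail_tendsto_0: "tail \<longlonglongrightarrow> 0"
proof -
  have "(\<lambda>m. suminf (\<lambda>k. (\<psi> (k + 1))\<^sup>2) - (\<Sum>k<m. (\<psi> (k + 1))\<^sup>2))
     \<longlonglongrightarrow> suminf (\<lambda>k. (\<psi> (k + 1))\<^sup>2) - suminf (\<lambda>k. (\<psi> (k + 1))\<^sup>2)"
    by (intro tendsto_intros summable_LIMSEQ summable)
  moreover have "suminf (\<lambda>k. (\<psi> (k + 1))\<^sup>2) - (\<Sum>k<m. (\<psi> (k + 1))\<^sup>2) = (\<Sum>k. (\<psi> (m + 1 + k))\<^sup>2)" for m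
    using suminf_minus_initial_segment[OF summable, of m] by (simp add: add_ac)
  ultimately have "(\<lambda>m. \<Sum>k. (\<psi> (m + 1 + k))\<^sup>2) \<longlonglongrightarrow> 0" by simp
  then have "(\<lambda>m. sqrt (\<Sum>k. (\<psi> (m + 1 + k))\<^sup>2)) \<longlonglongrightarrow> sqrt 0" by (intro tendsto_intros)
  then show ?thesis by (simp add: tail_def[abs_def])
qed

text \<open>
  Replacing \<open>\<Psi>\<close> by its partial sum turns the convolution into a trigonometric polynomial, and the
  error is a convolution with the remainder of \<open>\<Psi>\<close>, to which the Cauchy-Schwarz inequality applies.
\<close>

lemma convolution_class_expansion:
  assumes "f \<in> convolution_class \<Psi>"
  shows "\<exists>c A B. (\<forall>k\<ge>1. \<bar>A k\<bar> \<le> \<psi> k) \<and>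
    (\<forall>m x. \<bar>f x - (c + (\<Sum>k=1..m. A k * cos (real k * x) + B k * sin (real k * x)))\<bar> \<le> 1 / sqrt pi * tail m)"
proof -
  obtain a0 \<phi> where \<phi>: "\<phi> \<in> L2_per" "L2_per_norm \<phi> \<le> 1"
    and f: "\<And>x. f x = a0 / 2 + 1 / pi * integral\<^sup>L period (\<lambda>t. \<phi> (x - t) * \<Psi> t)"
    using assms by (auto simp: convolution_class_def set_integral_period)
  have "\<forall>k. \<exists>p. \<bar>fst p\<bar> \<le> pi \<and> (\<forall>x. integral\<^sup>L period (\<lambda>t. \<phi> (x - t) * cos (real k * t - \<gamma> k))
       = fst p * cos (real k * x) + snd p * sin (real k * x))"
  proof
    fix k
    obtain a b where "\<bar>a\<bar> \<le> pi" "\<forall>x. integral\<^sup>L period (\<lambda>t. \<phi> (x - t) * cos (real k * t - \<gamma> k))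
       = a * cos (real k * x) + b * sin (real k * x)"
      using convolution_with_cosine[OF \<phi>, of k "\<gamma> k"] by blast
    then show "\<exists>p. \<bar>fst p\<bar> \<le> pi \<and> (\<forall>x. integral\<^sup>L period (\<lambda>t. \<phi> (x - t) * cos (real k * t - \<gamma> k))
       = fst p * cos (real k * x) + snd p * sin (real k * x))"
      by (intro exI[of _ "(a, b)"]) simp
  qed
  from choice[OF this] obtain p where p: "\<forall>k. \<bar>fst (p k)\<bar> \<le> pi \<and>
    (\<forall>x. integral\<^sup>L period (\<lambda>t. \<phi> (x - t) * cos (real k * t - \<gamma> k))
       = fst (p k) * cos (real k * x) + snd (p k) * sin (real k * x))" ..
  define A B where "A = fst \<circ> p" and "B = snd \<circ> p"
  have A: "\<And>k. \<bar>A k\<bar> \<le> pi"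
    and AB: "\<And>k x. integral\<^sup>L period (\<lambda>t. \<phi> (x - t) * cos (real k * t - \<gamma> k))
       = A k * cos (real k * x) + B k * sin (real k * x)"
    using p by (simp_all add: A_def B_def)
  have "\<bar>f x - (a0 / 2 + (\<Sum>k=1..m. (\<psi> k * A k / pi) * cos (real k * x) + (\<psi> k * B k / pi) * sin (real k * x)))\<bar>
     \<le> 1 / sqrt pi * tail m" for m x
  proof -
    note s = L2_per_reflected_translate(1)[OF \<phi>(1), of x]
    have "integral\<^sup>L period (\<lambda>t. \<phi> (x - t) * partial m t)
       = integral\<^sup>L period (\<lambda>t. \<Sum>k=1..m. \<psi> k * (\<phi> (x - t) * cos (real k * t - \<gamma> k)))"
      by (simp add: partial_def sum_distrib_left mult.left_commute)
    also have "\<dots> = (\<Sum>k=1..m. \<psi> k * integral\<^sup>L period (\<lambda>t. \<phi> (x - t) * cos (real k * t - \<gamma> k)))"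
      by (subst Bochner_Integration.integral_sum) (auto intro!: integrable_mult_square_integrable[OF s])
    finally have p: "1 / pi * integral\<^sup>L period (\<lambda>t. \<phi> (x - t) * partial m t)
       = (\<Sum>k=1..m. (\<psi> k * A k / pi) * cos (real k * x) + (\<psi> k * B k / pi) * sin (real k * x))"
      unfolding AB by (simp add: sum_distrib_left sum_divide_distrib algebra_simps add_divide_distrib)
    have "f x - (a0 / 2 + 1 / pi * integral\<^sup>L period (\<lambda>t. \<phi> (x - t) * partial m t))
      = 1 / pi * (integral\<^sup>L period (\<lambda>t. \<phi> (x - t) * \<Psi> t) - integral\<^sup>L period (\<lambda>t. \<phi> (x - t) * partial m t))"
      unfolding f by (simp add: right_diff_distrib diff_divide_distrib)
    also have "integral\<^sup>L period (\<lambda>t. \<phi> (x - t) * \<Psi> t) - integral\<^sup>L period (\<lambda>t. \<phi> (x - t) * partial m t)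
      = integral\<^sup>L period (\<lambda>t. \<phi> (x - t) * (\<Psi> t - partial m t))"
      unfolding right_diff_distrib
      by (intro Bochner_Integration.integral_diff[symmetric] integrable_mult_square_integrable s
          kernel_square_integrable partial_square_integrable)
    finally have "\<bar>f x - (a0 / 2 + 1 / pi * integral\<^sup>L period (\<lambda>t. \<phi> (x - t) * partial m t))\<bar>
      = 1 / pi * \<bar>integral\<^sup>L period (\<lambda>t. \<phi> (x - t) * (\<Psi> t - partial m t))\<bar>"
      by (simp add: abs_mult)
    also have "\<dots> \<le> 1 / pi * (1 * sqrt (pi * (\<Sum>k. (\<psi> (m + 1 + k))\<^sup>2)))"
    proof (rule mult_left_mono)
      have "\<bar>integral\<^sup>L period (\<lambda>t. \<phi> (x - t) * (\<Psi> t - partial m t))\<bar>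
        \<le> sqrt (integral\<^sup>L period (\<lambda>t. (\<phi> (x - t))\<^sup>2)) * sqrt (integral\<^sup>L period (\<lambda>t. (\<Psi> t - partial m t)\<^sup>2))"
        by (rule Cauchy_Schwarz_period[OF s rest_square_integrable])
      also have "\<dots> \<le> 1 * sqrt (pi * (\<Sum>k. (\<psi> (m + 1 + k))\<^sup>2))"
      proof (rule mult_mono)
        have "0 \<le> L2_per_norm \<phi>" by (simp add: L2_per_norm_def set_integral_period)
        then show "sqrt (integral\<^sup>L period (\<lambda>t. (\<phi> (x - t))\<^sup>2)) \<le> 1"
          unfolding L2_per_reflected_translate(2)[OF \<phi>(1)] using \<phi>(2) by simp
        show "sqrt (integral\<^sup>L period (\<lambda>t. (\<Psi> t - partial m t)\<^sup>2)) \<le> sqrt (pi * (\<Sum>k. (\<psi> (m + 1 + k))\<^sup>2))"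
          by (rule real_sqrt_le_mono[OF kernel_remainder_le])
      qed auto
      finally show "\<bar>integral\<^sup>L period (\<lambda>t. \<phi> (x - t) * (\<Psi> t - partial m t))\<bar>
        \<le> 1 * sqrt (pi * (\<Sum>k. (\<psi> (m + 1 + k))\<^sup>2))" .
    qed simp
    also have "\<dots> = 1 / sqrt pi * tail m"
    proof -
      have "sqrt pi / pi = 1 / sqrt pi" by (simp add: real_div_sqrt field_simps)
      then show ?thesis unfolding tail_def mult_1 real_sqrt_mult by (metis mult.assoc mult_1 times_divide_eq_left)
    qed
    finally show ?thesis unfolding p .
  qed
  moreover have "\<bar>\<psi> k * A k / pi\<bar> \<le> \<psi> k" if "k \<ge> 1" for k
  proof -
    have "\<psi> k * (\<bar>A k\<bar> / pi) \<le> \<psi> k * 1" using A[of k] pos[OF that] by (intro mult_left_mono) auto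
    then show ?thesis using pos[OF that] by (simp add: abs_mult)
  qed
  ultimately show ?thesis
    by (intro exI[of _ "a0 / 2"] exI[of _ "\<lambda>k. \<psi> k * A k / pi"] exI[of _ "\<lambda>k. \<psi> k * B k / pi"]
        conjI allI impI)
qed

text \<open>
  The polynomials of the expansion converge to \<open>f\<close> uniformly, so their coefficients are the Fourier
  coefficients of \<open>f\<close>.  This identifies them with the Fourier sums of \<open>f\<close> without interchanging
  the order of integration.
\<close>

lemma convolution_class_fourier_sum:
  assumes "f \<in> convolution_class_C \<Psi>"
  shows "norm (f - fourier_sum m (apply_bcontfun f)) \<le> 1 / sqrt pi * tail m"
    and "k \<ge> 1 \<Longrightarrow> \<bar>fourier_coefficient k 0 f\<bar> \<le> pi * \<psi> k"
proof -
  obtain c A B where A: "\<And>k. k \<ge> 1 \<Longrightarrow> \<bar>A k\<bar> \<le> \<psi> k"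
    and e: "\<And>m x. \<bar>apply_bcontfun f x - (c + (\<Sum>k=1..m. A k * cos (real k * x) + B k * sin (real k * x)))\<bar>
       \<le> 1 / sqrt pi * tail m"
    using convolution_class_expansion assms unfolding convolution_class_C_def by blast
  define T where "T m = c *\<^sub>R harmonic 0 0 + (\<Sum>k=1..m. A k *\<^sub>R harmonic k 0 + B k *\<^sub>R harmonic k (pi / 2))" for m
  have T: "apply_bcontfun (T m) x = c + (\<Sum>k=1..m. A k * cos (real k * x) + B k * sin (real k * x))" for m x
    by (simp add: T_def apply_bcontfun_sum cos_diff)
  have nT: "norm (f - T m) \<le> 1 / sqrt pi * tail m" for m
    by (rule norm_bound) (use e[of _ m] in \<open>simp add: T\<close>)
  have "(\<lambda>m. 1 / sqrt pi * tail m) \<longlonglongrightarrow> 1 / sqrt pi * 0" by (intro tendsto_intros tail_tendsto_0)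
  then have "(\<lambda>m. norm (f - T m)) \<longlonglongrightarrow> 0"
    using nT by (intro tendsto_sandwich[OF _ _ tendsto_const[of 0], of "\<lambda>m. norm (f - T m)" _ "\<lambda>m. 1 / sqrt pi * tail m"]) auto
  then have "(\<lambda>m. f - T m) \<longlonglongrightarrow> 0" by (rule tendsto_norm_zero_cancel)
  then have "(\<lambda>m. f - (f - T m)) \<longlonglongrightarrow> f - 0" by (intro tendsto_diff tendsto_const)
  then have lim: "T \<longlonglongrightarrow> f" by simp
  have coef: "fourier_coefficient k a f = v" if "\<And>m. m \<ge> k \<Longrightarrow> fourier_coefficient k a (T m) = v" for k a v
  proof -
    have "(\<lambda>m. fourier_coefficient k a (T m)) \<longlonglongrightarrow> fourier_coefficient k a f"
      by (rule bounded_linear.tendsto[OF bounded_linear_fourier_coefficient lim])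
    moreover have "(\<lambda>m. fourier_coefficient k a (T m)) \<longlonglongrightarrow> v"
      by (rule tendsto_eventually, rule eventually_sequentiallyI[of k], rule that)
    ultimately show ?thesis by (rule LIMSEQ_unique)
  qed
  have lin: "linear (fourier_coefficient k a)" for k a
    by (rule bounded_linear.linear[OF bounded_linear_fourier_coefficient])
  have coefT: "fourier_coefficient k a (T m) = (if k = 0 then 2 * pi * c * cos a else pi * (A k * cos a + B k * sin a))"
    if "m \<ge> k" for k a m
  proof -
    have "fourier_coefficient k a (T m) = c * fourier_coefficient k a (harmonic 0 0)
      + (\<Sum>l=1..m. A l * fourier_coefficient k a (harmonic l 0) + B l * fourier_coefficient k a (harmonic l (pi / 2)))"
      unfolding T_def by (simp add: linear_add[OF lin] linear_scale[OF lin] linear_sum[OF lin])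
    also have "(\<Sum>l=1..m. A l * fourier_coefficient k a (harmonic l 0) + B l * fourier_coefficient k a (harmonic l (pi / 2)))
      = (\<Sum>l=1..m. if l = k then pi * (A k * cos a + B k * sin a) else 0)"
      by (intro sum.cong refl) (auto simp: fourier_coefficient_harmonic cos_diff algebra_simps)
    finally show ?thesis using that by (auto simp: fourier_coefficient_harmonic)
  qed
  have c: "fourier_coefficient k a f = (if k = 0 then 2 * pi * c * cos a else pi * (A k * cos a + B k * sin a))" for k a
    by (rule coef) (rule coefT)
  have "fourier_sum m (apply_bcontfun f) = T m"
    unfolding fourier_sum_eq T_def by (simp add: c)
  then show "norm (f - fourier_sum m (apply_bcontfun f)) \<le> 1 / sqrt pi * tail m"
    using nT by simp
  show "\<bar>fourier_coefficient k 0 f\<bar> \<le> pi * \<psi> k" if "k \<ge> 1"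
    using that A[OF that] by (simp add: c abs_mult)
qed

text \<open>
  Dividing the amplitudes by \<open>\<psi> k\<close> and shifting the phases by \<open>\<gamma> k\<close> gives a function \<open>\<phi>\<close> whose
  convolution with \<open>\<Psi>\<close> is the given polynomial; the hypothesis says that its norm is at most \<open>1\<close>.
\<close>

lemma cos_poly_in_convolution_class:
  assumes f: "f \<in> C_per" "\<And>x. apply_bcontfun f x = cos_poly n c \<rho> \<alpha> x"
    and le: "pi * (\<Sum>k=1..n. (\<rho> k / \<psi> k)\<^sup>2) \<le> 1"
  shows "f \<in> convolution_class_C \<Psi>"
proof -
  define r where "r k = \<rho> k / \<psi> k" for k
  define \<phi> where "\<phi> t = (\<Sum>k=1..n. r k * cos (real k * t - (\<alpha> k - \<gamma> k)))" for t
  have cont: "continuous_on UNIV \<phi>" unfolding \<phi>_def[abs_def] by (intro continuous_intros)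
  have s: "square_integrable \<phi>" by (rule square_integrable_continuous[OF cont])
  have "periodic_2pi \<phi>" by (simp add: periodic_2pi_def \<phi>_def periodic_cos)
  moreover have "\<phi> \<in> borel_measurable lebesgue"
    using cont by (intro measurable_completion) (simp add: borel_measurable_continuous_onI)
  ultimately have L2: "\<phi> \<in> L2_per"
    using s by (simp add: L2_per_def set_integrable_period square_integrable_def)
  have "integral\<^sup>L period (\<lambda>t. (\<phi> t)\<^sup>2) \<le> 1"
    using le unfolding \<phi>_def integral_square_cosine_sum r_def .
  then have norm: "L2_per_norm \<phi> \<le> 1" by (simp add: L2_per_norm_def set_integral_period)
  have mean: "integral\<^sup>L period \<phi> = 0"
    unfolding \<phi>_def[abs_def]
    by (subst Bochner_Integration.integral_sum)
      (auto intro!: square_integrable_integrable simp: integral_cos_period)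
  have "apply_bcontfun f x = 2 * c / 2 + 1 / pi * integral\<^sup>L period (\<lambda>t. \<phi> (x - t) * \<Psi> t)" for x
  proof -
    have "\<phi> (x - t) * \<Psi> t = (\<Sum>k=1..n. r k * (\<Psi> t * cos (real k * t - (real k * x - (\<alpha> k - \<gamma> k)))))" for t
    proof -
      have "cos (real k * (x - t) - (\<alpha> k - \<gamma> k)) = cos (real k * t - (real k * x - (\<alpha> k - \<gamma> k)))" for k
      proof -
        have "real k * (x - t) - (\<alpha> k - \<gamma> k) = - (real k * t - (real k * x - (\<alpha> k - \<gamma> k)))"
          by (simp add: algebra_simps)
        then show ?thesis by (simp only: cos_minus)
      qed
      then show ?thesis unfolding \<phi>_def sum_distrib_right by (intro sum.cong refl) (simp only: mult_ac)
    qed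
    then have "integral\<^sup>L period (\<lambda>t. \<phi> (x - t) * \<Psi> t)
      = (\<Sum>k=1..n. r k * integral\<^sup>L period (\<lambda>t. \<Psi> t * cos (real k * t - (real k * x - (\<alpha> k - \<gamma> k)))))"
      by (simp add: Bochner_Integration.integral_sum integrable_mult_square_integrable kernel_square_integrable)
    also have "\<dots> = (\<Sum>k=1..n. pi * (\<rho> k * cos (real k * x - \<alpha> k)))"
    proof (intro sum.cong refl)
      fix k assume k: "k \<in> {1..n}"
      then have "\<psi> k \<noteq> 0" using pos[of k] by simp
      then show "r k * integral\<^sup>L period (\<lambda>t. \<Psi> t * cos (real k * t - (real k * x - (\<alpha> k - \<gamma> k))))
         = pi * (\<rho> k * cos (real k * x - \<alpha> k))"
        using k by (simp add: integral_kernel_cos r_def)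
    qed
    finally show ?thesis by (simp add: f(2) cos_poly_def flip: sum_distrib_left)
  qed
  then have "apply_bcontfun f \<in> convolution_class \<Psi>"
    unfolding convolution_class_def set_integral_period using L2 norm mean by blast
  then show ?thesis using f(1) by (simp add: convolution_class_C_def)
qed

end

section \<open>Comparison and monotonicity of the widths\<close>

lemma kolmogorov_le_linear_width:
  assumes "K \<subseteq> X" shows "kolmogorov_width K X N \<le> linear_width K X N"
  unfolding kolmogorov_width_def linear_width_def
proof (intro INF_mono' INF_greatest SUP_mono)
  fix F A f assume "A \<in> linear_operators X F" "f \<in> K"
  then have "A f \<in> F" using assms by (auto simp: linear_operators_def)
  then show "\<exists>g\<in>K. (INF u\<in>F. ennreal (norm (f - u))) \<le> ennreal (norm (g - A g))"
    using \<open>f \<in> K\<close> by (intro bexI[of _ f] INF_lower)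
qed

lemma linear_le_projection_width: "linear_width K X N \<le> projection_width K X N"
  unfolding linear_width_def projection_width_def
  by (intro INF_mono' INF_superset_mono) (auto simp: projections_def)

lemma bernstein_width_mono: "bernstein_width K X (N + 1) \<le> bernstein_width K X N"
  unfolding bernstein_width_def
proof (intro SUP_mono)
  fix F assume "F \<in> subspaces_of_dim X (N + 1 + 1)"
  then obtain B where B: "finite B" "card B = N + 2" "independent B" "F = span B" "F \<subseteq> X"
    by (auto simp: subspaces_of_dim_def)
  then obtain b where b: "b \<in> B" by fastforce
  have sub: "span (B - {b}) \<subseteq> F" using B by (auto intro: span_mono[THEN subsetD])
  have "span (B - {b}) \<in> subspaces_of_dim X (N + 1)"
    unfolding subspaces_of_dim_def using B b sub independent_mono[of B "B - {b}"]
    by (auto intro!: exI[of _ "B - {b}"])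
  moreover have "(SUP \<epsilon>\<in>{\<epsilon>. \<epsilon> > 0 \<and> cball 0 \<epsilon> \<inter> F \<subseteq> K}. ennreal \<epsilon>)
      \<le> (SUP \<epsilon>\<in>{\<epsilon>. \<epsilon> > 0 \<and> cball 0 \<epsilon> \<inter> span (B - {b}) \<subseteq> K}. ennreal \<epsilon>)"
    using sub by (intro SUP_subset_mono) auto
  ultimately show "\<exists>G\<in>subspaces_of_dim X (N + 1).
      (SUP \<epsilon>\<in>{\<epsilon>. \<epsilon> > 0 \<and> cball 0 \<epsilon> \<inter> F \<subseteq> K}. ennreal \<epsilon>)
      \<le> (SUP \<epsilon>\<in>{\<epsilon>. \<epsilon> > 0 \<and> cball 0 \<epsilon> \<inter> G \<subseteq> K}. ennreal \<epsilon>)"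
    by blast
qed

text \<open>
  A vector outside \<open>span (K \<union> F)\<close> can be mapped freely by an operator that is prescribed on
  \<open>K\<close> and \<open>F\<close>; this is how projections onto \<open>F\<close> are extended.
\<close>

locale extensible_class =
  fixes K X :: "'a::real_normed_vector set" and N :: nat
  assumes sub: "K \<subseteq> X" and X: "subspace X"
    and outside: "\<And>F. F \<in> subspaces_of_dim X N \<Longrightarrow> \<exists>g\<in>X. g \<notin> span (K \<union> F)"
begin

lemma extension:
  assumes "F \<in> subspaces_of_dim X N"
  obtains g B where "g \<in> X" "g \<notin> span (K \<union> F)" "F = span B" "F \<subseteq> span (insert g B)"
    "span (insert g B) \<in> subspaces_of_dim X (N + 1)"
proof -
  obtain B where B: "finite B" "card B = N" "independent B" "F = span B" "F \<subseteq> X"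
    using assms by (auto simp: subspaces_of_dim_def)
  obtain g where g: "g \<in> X" "g \<notin> span (K \<union> F)" using outside[OF assms] by blast
  have "F \<subseteq> span (K \<union> F)" using span_superset by blast
  then have gF: "g \<notin> span B" using g B by blast
  then have "g \<notin> B" using span_superset by blast
  have "B \<subseteq> X" using B span_superset by blast
  have "span (insert g B) \<subseteq> X" by (rule span_minimal[OF _ X]) (use g \<open>B \<subseteq> X\<close> in auto)
  moreover have "card (insert g B) = N + 1" using B \<open>g \<notin> B\<close> by simp
  moreover have "independent (insert g B)" using B gF by (simp add: independent_insert)
  ultimately have "span (insert g B) \<in> subspaces_of_dim X (N + 1)"
    unfolding subspaces_of_dim_def using B(1) by blast
  moreover have "F \<subseteq> span (insert g B)" unfolding B by (intro span_mono) auto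
  ultimately show thesis using that g B(4) by blast
qed

lemma kolmogorov_width_mono: "kolmogorov_width K X (N + 1) \<le> kolmogorov_width K X N"
  unfolding kolmogorov_width_def
proof (rule INF_mono)
  fix F assume "F \<in> subspaces_of_dim X N"
  then obtain g B where F: "F \<subseteq> span (insert g B)" "span (insert g B) \<in> subspaces_of_dim X (N + 1)"
    by (rule extension)
  have "(SUP f\<in>K. INF u\<in>span (insert g B). ennreal (norm (f - u))) \<le> (SUP f\<in>K. INF u\<in>F. ennreal (norm (f - u)))"
    by (intro SUP_mono' INF_superset_mono F order_refl)
  then show "\<exists>G\<in>subspaces_of_dim X (N + 1).
      (SUP f\<in>K. INF u\<in>G. ennreal (norm (f - u))) \<le> (SUP f\<in>K. INF u\<in>F. ennreal (norm (f - u)))"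
    using F(2) by blast
qed

lemma linear_width_mono: "linear_width K X (N + 1) \<le> linear_width K X N"
  unfolding linear_width_def
proof (rule INF_mono)
  fix F assume "F \<in> subspaces_of_dim X N"
  then obtain g B where F: "F \<subseteq> span (insert g B)" "span (insert g B) \<in> subspaces_of_dim X (N + 1)"
    by (rule extension)
  have "linear_operators X F \<subseteq> linear_operators X (span (insert g B))"
    using F(1) by (auto simp: linear_operators_def)
  then have "(INF A\<in>linear_operators X (span (insert g B)). SUP f\<in>K. ennreal (norm (f - A f)))
      \<le> (INF A\<in>linear_operators X F. SUP f\<in>K. ennreal (norm (f - A f)))"
    by (intro INF_superset_mono order_refl)
  then show "\<exists>G\<in>subspaces_of_dim X (N + 1).
      (INF A\<in>linear_operators X G. SUP f\<in>K. ennreal (norm (f - A f)))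
      \<le> (INF A\<in>linear_operators X F. SUP f\<in>K. ennreal (norm (f - A f)))"
    using F(2) by blast
qed

text \<open>
  A correction \<open>\<phi> f *\<^sub>R (g - A g)\<close> with a linear functional \<open>\<phi>\<close> such that \<open>\<phi> g = 1\<close> makes \<open>g\<close> a fixed
  vector.  It vanishes on \<open>K\<close> and \<open>F\<close> if \<open>\<phi>\<close> does, which is possible as \<open>g\<close> is outside their span.
\<close>

lemma projection_extension:
  assumes A: "A \<in> projections X (span B)" and g: "g \<in> X" "g \<notin> span (K \<union> span B)"
    and B: "span B \<subseteq> X"
  shows "\<exists>A'\<in>projections X (span (insert g B)). \<forall>f\<in>K. A' f = A f"
proof -
  obtain \<phi> :: "'a \<Rightarrow> real" where \<phi>: "linear \<phi>" "\<forall>f\<in>span (K \<union> span B). \<phi> f = 0" "\<phi> g = 1"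
    using linear_functional_separating_subspace[OF subspace_span g(2)] by blast
  have A_in: "A f \<in> span B" if "f \<in> X" for f using A that by (auto simp: projections_def linear_operators_def)
  have A_add: "A (f + h) = A f + A h" if "f \<in> X" "h \<in> X" for f h
    using A that by (auto simp: projections_def linear_operators_def)
  have A_scale: "A (c *\<^sub>R f) = c *\<^sub>R A f" if "f \<in> X" for c f
    using A that by (auto simp: projections_def linear_operators_def)
  have A_id: "A f = f" if "f \<in> span B" for f using A that by (auto simp: projections_def)
  define A' where "A' f = A f + \<phi> f *\<^sub>R (g - A g)" for f
  have sub': "span B \<subseteq> span (insert g B)" by (intro span_mono) auto
  have gs: "g \<in> span (insert g B)" by (intro span_base) auto
  have "A' f \<in> span (insert g B)" if "f \<in> X" for f
    unfolding A'_def using A_in[OF that] A_in[OF g(1)] sub' gs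
    by (intro span_add span_scale span_diff) auto
  moreover have "A' (f + h) = A' f + A' h" if "f \<in> X" "h \<in> X" for f h
    by (simp add: A'_def A_add[OF that] linear_add[OF \<phi>(1)] scaleR_add_left)
  moreover have "A' (c *\<^sub>R f) = c *\<^sub>R A' f" if "f \<in> X" for c f
    by (simp add: A'_def A_scale[OF that] linear_scale[OF \<phi>(1)] scaleR_add_right)
  moreover have "A' f = f" if f: "f \<in> span (insert g B)" for f
  proof -
    obtain k where k: "f - k *\<^sub>R g \<in> span B" using f by (auto simp: span_breakdown_eq)
    define u where "u = f - k *\<^sub>R g"
    have fu: "f = u + k *\<^sub>R g" and u: "u \<in> span B" using k by (simp_all add: u_def)
    have "u \<in> span (K \<union> span B)" using u by (intro span_base) auto
    then have "\<phi> f = k" using \<phi> by (simp add: fu linear_add[OF \<phi>(1)] linear_scale[OF \<phi>(1)])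
    moreover have "A f = u + k *\<^sub>R A g"
      unfolding fu using u B g X A_id by (subst A_add) (auto simp: A_scale subspace_scale)
    ultimately show ?thesis by (simp add: A'_def fu scaleR_diff_right)
  qed
  ultimately have "A' \<in> projections X (span (insert g B))"
    by (simp add: projections_def linear_operators_def)
  moreover have "A' f = A f" if "f \<in> K" for f
    using \<phi>(2) that span_superset[of "K \<union> span B"] by (simp add: A'_def subset_iff)
  ultimately show ?thesis by blast
qed

lemma projection_width_mono: "projection_width K X (N + 1) \<le> projection_width K X N"
  unfolding projection_width_def
proof (rule INF_mono)
  fix F assume F: "F \<in> subspaces_of_dim X N"
  then obtain g B where g: "g \<in> X" "g \<notin> span (K \<union> F)" "F = span B"
    "span (insert g B) \<in> subspaces_of_dim X (N + 1)"
    by (rule extension)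
  have FX: "span B \<subseteq> X" using F g(3) by (simp add: subspaces_of_dim_def)
  have "(INF A\<in>projections X (span (insert g B)). SUP f\<in>K. ennreal (norm (f - A f)))
      \<le> (INF A\<in>projections X F. SUP f\<in>K. ennreal (norm (f - A f)))"
  proof (rule INF_mono)
    fix A assume "A \<in> projections X F"
    then obtain A' where A': "A' \<in> projections X (span (insert g B))" "\<forall>f\<in>K. A' f = A f"
      using projection_extension[of A B g] g FX by auto
    then have "(SUP f\<in>K. ennreal (norm (f - A' f))) = (SUP f\<in>K. ennreal (norm (f - A f)))"
      by (intro SUP_cong) auto
    then show "\<exists>A'\<in>projections X (span (insert g B)).
        (SUP f\<in>K. ennreal (norm (f - A' f))) \<le> (SUP f\<in>K. ennreal (norm (f - A f)))"
      using A'(1) by (intro bexI[of _ A']) simp_all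
  qed
  then show "\<exists>G\<in>subspaces_of_dim X (N + 1).
      (INF A\<in>projections X G. SUP f\<in>K. ennreal (norm (f - A f)))
      \<le> (INF A\<in>projections X F. SUP f\<in>K. ennreal (norm (f - A f)))"
    using g(4) by blast
qed

end

section \<open>Continuous functions far from the class\<close>

instance bcontfun :: (metric_space, banach) banach ..

context convolution_kernel
begin

lemma psi_tendsto_0: "\<psi> \<longlonglongrightarrow> 0"
proof -
  have "(\<lambda>k. sqrt ((\<psi> (k + 1))\<^sup>2)) \<longlonglongrightarrow> sqrt 0"
    by (intro tendsto_intros summable_LIMSEQ_zero summable)
  then have "(\<lambda>k. \<psi> (k + 1)) \<longlonglongrightarrow> 0" using pos by (simp add: less_imp_le)
  then show ?thesis by (rule LIMSEQ_offset)
qed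

text \<open>
  The frequencies are chosen so sparse that \<open>\<psi>\<close> along them is far below the coefficients of order
  \<open>(1/2) ^ p\<close> which will be placed there.
\<close>

lemma lacunary_frequencies:
  "\<exists>K :: nat \<Rightarrow> nat. strict_mono K \<and> (\<forall>p. K p \<ge> 1 \<and> \<psi> (K p) \<le> (1/4) ^ p)"
proof -
  have ex: "\<exists>k>n. k \<ge> 1 \<and> \<psi> k \<le> (1/4) ^ p" for n p
  proof -
    have "\<forall>\<^sub>F k in sequentially. \<psi> k < (1/4) ^ p" by (rule order_tendstoD[OF psi_tendsto_0]) simp
    then obtain k0 where k0: "\<And>k. k \<ge> k0 \<Longrightarrow> \<psi> k < (1/4) ^ p" unfolding eventually_sequentially by blast
    show ?thesis
      using k0[of "max k0 (n + 1)"] by (intro exI[of _ "max k0 (n + 1)"]) (auto simp: less_imp_le)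
  qed
  have "\<exists>K. \<forall>p. (K p \<ge> 1 \<and> \<psi> (K p) \<le> (1/4) ^ p) \<and> K p < K (Suc p)"
    by (rule dependent_nat_choice) (use ex in blast)+
  then show ?thesis by (auto simp: strict_mono_Suc_iff)
qed

lemma convolution_class_coefficient_subspace:
  "subspace {f. \<exists>C. \<forall>k\<ge>1. \<bar>fourier_coefficient k 0 f\<bar> \<le> C * \<psi> k}"
proof (rule subspaceI, safe)
  have lin: "linear (fourier_coefficient k a)" for k a
    by (rule bounded_linear.linear[OF bounded_linear_fourier_coefficient])
  show "\<exists>C. \<forall>k\<ge>1. \<bar>fourier_coefficient k 0 0\<bar> \<le> C * \<psi> k"
    by (rule exI[of _ 0]) (simp add: linear_0[OF lin])
  fix f C assume f: "\<forall>k\<ge>1. \<bar>fourier_coefficient k 0 f\<bar> \<le> C * \<psi> k"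
  show "\<exists>C. \<forall>k\<ge>1. \<bar>fourier_coefficient k 0 (c *\<^sub>R f)\<bar> \<le> C * \<psi> k" for c
    using f by (intro exI[of _ "\<bar>c\<bar> * C"]) (auto simp: linear_scale[OF lin] abs_mult mult.assoc intro: mult_left_mono)
  fix g D assume g: "\<forall>k\<ge>1. \<bar>fourier_coefficient k 0 g\<bar> \<le> D * \<psi> k"
  show "\<exists>C. \<forall>k\<ge>1. \<bar>fourier_coefficient k 0 (f + g)\<bar> \<le> C * \<psi> k"
  proof (intro exI[of _ "C + D"] allI impI)
    fix k :: nat assume "k \<ge> 1"
    then have "\<bar>fourier_coefficient k 0 f\<bar> \<le> C * \<psi> k" "\<bar>fourier_coefficient k 0 g\<bar> \<le> D * \<psi> k" using f g by auto
    then show "\<bar>fourier_coefficient k 0 (f + g)\<bar> \<le> (C + D) * \<psi> k"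
      by (simp add: linear_add[OF lin] distrib_right)
  qed
qed

lemma lacunary_series:
  fixes \<kappa> :: "nat \<Rightarrow> nat" and e :: "nat \<Rightarrow> real"
  assumes \<kappa>: "strict_mono \<kappa>" "\<And>p. \<kappa> p \<ge> 1" and e: "\<And>p. \<bar>e p\<bar> \<le> (1/2) ^ p"
  shows "\<exists>g\<in>C_per. \<forall>q. fourier_coefficient (\<kappa> q) 0 g = pi * e q"
proof
  let ?u = "\<lambda>p. e p *\<^sub>R harmonic (\<kappa> p) 0"
  have s: "summable ?u"
  proof (rule summable_comparison_test'[where g = "\<lambda>p. (1/2) ^ p" and N = 0])
    show "summable (\<lambda>p. (1/2 :: real) ^ p)" by (rule summable_geometric) simp
    fix p :: nat
    have "norm (?u p) \<le> (1/2) ^ p * 1"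
      using e[of p] norm_harmonic_le[of "\<kappa> p" 0] by (simp only: norm_scaleR real_norm_def) (rule mult_mono, auto)
    then show "norm (?u p) \<le> (1/2) ^ p" by simp
  qed
  have "apply_bcontfun (suminf ?u) x = (\<Sum>p. e p * cos (real (\<kappa> p) * x))" for x
    using bounded_linear.suminf[OF bounded_linear_apply_bcontfun s, of x] by simp
  then show "suminf ?u \<in> C_per"
    using periodic_cos[of _ _ 0] by (simp add: C_per_def periodic_2pi_def)
  show "\<forall>q. fourier_coefficient (\<kappa> q) 0 (suminf ?u) = pi * e q"
  proof
    fix q
    have lin: "linear (fourier_coefficient k a)" for k a
      by (rule bounded_linear.linear[OF bounded_linear_fourier_coefficient])
    have "fourier_coefficient (\<kappa> q) 0 (suminf ?u) = (\<Sum>p. fourier_coefficient (\<kappa> q) 0 (?u p))"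
      using bounded_linear.suminf[OF bounded_linear_fourier_coefficient s] by simp
    also have "\<dots> = (\<Sum>p. if p = q then pi * e p else 0)"
    proof (rule suminf_cong)
      fix p
      have "\<kappa> p = \<kappa> q \<longleftrightarrow> p = q" using \<kappa>(1) by (simp add: strict_mono_eq)
      then show "fourier_coefficient (\<kappa> q) 0 (?u p) = (if p = q then pi * e p else 0)"
        using \<kappa>(2)[of q] by (simp add: linear_scale[OF lin] fourier_coefficient_harmonic)
    qed
    also have "\<dots> = pi * e q" using sums_unique[OF sums_single[of q "\<lambda>p. pi * e p"]] by simp
    finally show "fourier_coefficient (\<kappa> q) 0 (suminf ?u) = pi * e q" .
  qed
qed

text \<open>
  Distribute the lacunary frequencies over the residue classes of their indices modulo \<open>N + 1\<close>, one
  cosine series for each class.  The coefficients of functions in the span of the class are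
  \<open>O(\<psi> k)\<close>, hence \<open>O((1/4) ^ p)\<close> at the frequency of index \<open>p\<close>, whereas those of a combination of the
  \<open>N + 1\<close> series with a nonzero factor are of order \<open>(1/2) ^ p\<close> in some residue class.  So the series
  are independent modulo that span, and \<open>F\<close> cannot absorb all of them.
\<close>

lemma continuous_function_outside:
  assumes F: "F \<in> subspaces_of_dim C_per N"
  shows "\<exists>g\<in>C_per. g \<notin> span (convolution_class_C \<Psi> \<union> F)"
proof -
  obtain B where B: "finite B" "card B = N" "F = span B" using F by (auto simp: subspaces_of_dim_def)
  define W where "W = {f. \<exists>C. \<forall>k\<ge>1. \<bar>fourier_coefficient k 0 f\<bar> \<le> C * \<psi> k}"
  have W: "subspace W" unfolding W_def by (rule convolution_class_coefficient_subspace)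
  have KW: "convolution_class_C \<Psi> \<subseteq> W"
    unfolding W_def using convolution_class_fourier_sum(2) by blast
  obtain \<kappa> where \<kappa>: "strict_mono \<kappa>" "\<And>p. \<kappa> p \<ge> 1" "\<And>p. \<psi> (\<kappa> p) \<le> (1/4) ^ p"
    using lacunary_frequencies by blast
  have "\<exists>g\<in>C_per. \<forall>q. fourier_coefficient (\<kappa> q) 0 g = pi * (if q mod (N + 1) = i then (1/2) ^ q else 0)" for i
    by (rule lacunary_series[OF \<kappa>(1,2)]) simp
  then obtain g where g: "\<And>i. g i \<in> C_per"
    and gc: "\<And>i q. fourier_coefficient (\<kappa> q) 0 (g i) = pi * (if q mod (N + 1) = i then (1/2) ^ q else 0)"
    by metis
  have lin: "linear (fourier_coefficient k a)" for k a
    by (rule bounded_linear.linear[OF bounded_linear_fourier_coefficient])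
  have "\<exists>i\<le>N. g i \<notin> span (W \<union> B)"
  proof (rule vector_outside_finite_extension[OF W B(1)])
    show "card B \<le> N" using B by simp
    fix a assume "(\<Sum>i\<le>N. a i *\<^sub>R g i) \<in> W"
    then obtain C where C: "\<And>k. k \<ge> 1 \<Longrightarrow> \<bar>fourier_coefficient k 0 (\<Sum>i\<le>N. a i *\<^sub>R g i)\<bar> \<le> C * \<psi> k"
      by (auto simp: W_def)
    show "\<forall>i\<le>N. a i = 0"
    proof (intro allI impI)
      fix i assume i: "i \<le> N"
      have "pi * \<bar>a i\<bar> \<le> \<bar>C\<bar> * (1/2) ^ r" for r
      proof -
        define q where "q = i + (N + 1) * r"
        have q: "q mod (N + 1) = i" unfolding q_def mod_mult_self2 using i by simp
        have "fourier_coefficient (\<kappa> q) 0 (\<Sum>i\<le>N. a i *\<^sub>R g i)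
          = (\<Sum>j\<le>N. if j = i then pi * a i * (1/2) ^ q else 0)"
          unfolding linear_sum[OF lin]
          using q by (intro sum.cong refl) (auto simp: linear_scale[OF lin] gc)
        also have "\<dots> = pi * a i * (1/2) ^ q" using i by simp
        finally have "pi * \<bar>a i\<bar> * (1/2) ^ q \<le> C * \<psi> (\<kappa> q)"
          using C[OF \<kappa>(2)[of q]] by (simp add: abs_mult)
        also have "\<dots> \<le> \<bar>C\<bar> * (1/4) ^ q"
          using \<kappa>(3)[of q] pos[OF \<kappa>(2)[of q]] by (intro mult_mono) auto
        also have "(1/4 :: real) ^ q = (1/2) ^ q * (1/2) ^ q" by (simp flip: power_mult_distrib)
        finally have "pi * \<bar>a i\<bar> \<le> \<bar>C\<bar> * (1/2) ^ q" by (simp flip: mult.assoc)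
        also have "\<dots> \<le> \<bar>C\<bar> * (1/2) ^ r"
          by (intro mult_left_mono power_decreasing) (auto simp: q_def)
        finally show ?thesis .
      qed
      moreover have "(\<lambda>r. \<bar>C\<bar> * (1/2) ^ r) \<longlonglongrightarrow> \<bar>C\<bar> * 0" by (intro tendsto_intros LIMSEQ_power_zero) simp
      ultimately have "pi * \<bar>a i\<bar> \<le> \<bar>C\<bar> * 0" by (intro LIMSEQ_le_const) auto
      then have "pi * \<bar>a i\<bar> \<le> 0" by simp
      then show "a i = 0" using mult_le_cancel_left_pos[OF pi_gt_zero, of "\<bar>a i\<bar>" 0] by simp
    qed
  qed
  moreover have "span (convolution_class_C \<Psi> \<union> F) \<subseteq> span (W \<union> B)"
    unfolding B using KW by (intro span_minimal Un_least subspace_span span_mono)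
      (auto intro: span_base)
  ultimately show ?thesis using g by blast
qed

lemma extensible: "extensible_class (convolution_class_C \<Psi>) C_per N"
proof
  show "convolution_class_C \<Psi> \<subseteq> C_per" by (auto simp: convolution_class_C_def)
qed (simp_all only: subspace_C_per continuous_function_outside)

section \<open>Bounds for the widths\<close>

text \<open>
  The \<open>\<epsilon>\<close> with \<open>pi * \<epsilon>\<^sup>2 * (1 / (\<psi> n)\<^sup>2 + 2 * (\<Sum>k=1..<n. 1 / (\<psi> k)\<^sup>2)) = 1\<close>.
\<close>

definition lower :: "nat \<Rightarrow> real" where
  "lower n = 1 / sqrt pi * (1 / (\<psi> n)\<^sup>2 + 2 * (\<Sum>k=1..<n. 1 / (\<psi> k)\<^sup>2)) powr (-1/2)"

lemma lower_eq: "n \<ge> 1 \<Longrightarrow> lower n = 1 / sqrt pi / sqrt (1 / (\<psi> n)\<^sup>2 + 2 * (\<Sum>k=1..<n. 1 / (\<psi> k)\<^sup>2))"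
  and lower_radicand_pos: "n \<ge> 1 \<Longrightarrow> 1 / (\<psi> n)\<^sup>2 + 2 * (\<Sum>k=1..<n. 1 / (\<psi> k)\<^sup>2) > 0"
proof -
  assume n: "n \<ge> 1"
  let ?x = "1 / (\<psi> n)\<^sup>2 + 2 * (\<Sum>k=1..<n. 1 / (\<psi> k)\<^sup>2)"
  show p: "?x > 0" using pos[OF n] by (intro add_pos_nonneg) (auto intro!: sum_nonneg)
  have "?x powr (-1/2) = 1 / sqrt ?x" using p powr_minus[of ?x "1/2"] by (simp add: powr_half_sqrt inverse_eq_divide)
  then show "lower n = 1 / sqrt pi / sqrt ?x" by (simp add: lower_def)
qed

lemma lower_pos: "n \<ge> 1 \<Longrightarrow> lower n > 0"
  using lower_radicand_pos by (simp add: lower_eq)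

lemma in_class_if_small_at_nodes:
  assumes n: "n \<ge> 1" and f: "f \<in> C_per" "\<And>x. apply_bcontfun f x = cos_poly n c \<rho> \<alpha> x"
    and le: "\<And>j. j < 2 * n \<Longrightarrow> \<bar>apply_bcontfun f (node n (\<alpha> n) j)\<bar> \<le> lower n"
  shows "f \<in> convolution_class_C \<Psi>"
proof (rule cos_poly_in_convolution_class[OF f])
  let ?x = "1 / (\<psi> n)\<^sup>2 + 2 * (\<Sum>k=1..<n. 1 / (\<psi> k)\<^sup>2)"
  have "(\<Sum>k=1..n. (\<rho> k / \<psi> k)\<^sup>2) \<le> (\<Sum>k=1..n. (if k = n then (lower n)\<^sup>2 else 2 * (lower n)\<^sup>2) / (\<psi> k)\<^sup>2)"
  proof (rule sum_mono)
    fix k assume k: "k \<in> {1..n}"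
    have "(\<rho> k)\<^sup>2 \<le> (if k = n then (lower n)\<^sup>2 else 2 * (lower n)\<^sup>2)"
      by (rule cos_poly_coefficient_le[OF n refl]) (use le k in \<open>auto simp: f(2)\<close>)
    then show "(\<rho> k / \<psi> k)\<^sup>2 \<le> (if k = n then (lower n)\<^sup>2 else 2 * (lower n)\<^sup>2) / (\<psi> k)\<^sup>2"
      unfolding power_divide by (rule divide_right_mono) simp
  qed
  also have "(\<Sum>k=1..n. (if k = n then (lower n)\<^sup>2 else 2 * (lower n)\<^sup>2) / (\<psi> k)\<^sup>2)
     = (lower n)\<^sup>2 / (\<psi> n)\<^sup>2 + (\<Sum>k=1..<n. 2 * (lower n)\<^sup>2 * (1 / (\<psi> k)\<^sup>2))"
  proof -
    have "{1..n} = insert n {1..<n}" using n by auto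
    then show ?thesis by (simp only:) (subst sum.insert, auto intro!: sum.cong)
  qed
  also have "\<dots> = (lower n)\<^sup>2 * ?x"
    unfolding sum_distrib_left[symmetric] by (simp add: algebra_simps)
  also have "(lower n)\<^sup>2 * ?x = 1 / pi"
  proof -
    have "(1 / sqrt pi / sqrt x)\<^sup>2 * x = 1 / pi" if "x > 0" for x
      using that by (simp add: power_divide power_mult_distrib)
    then show ?thesis unfolding lower_eq[OF n] using lower_radicand_pos[OF n] by blast
  qed
  finally show "pi * (\<Sum>k=1..n. (\<rho> k / \<psi> k)\<^sup>2) \<le> 1" by (simp add: field_simps)
qed

lemma bernstein_width_ge:
  assumes n: "n \<ge> 1"
  shows "ennreal (lower n) \<le> bernstein_width (convolution_class_C \<Psi>) C_per (2 * n)"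
proof -
  have "cball 0 (lower n) \<inter> span (harmonics n) \<subseteq> convolution_class_C \<Psi>"
  proof safe
    fix f assume f: "f \<in> cball 0 (lower n)" "f \<in> span (harmonics n)"
    obtain c \<rho> \<alpha> where "\<And>x. apply_bcontfun f x = cos_poly n c \<rho> \<alpha> x"
      using span_harmonics_cos_poly[OF f(2)] by blast
    then show "f \<in> convolution_class_C \<Psi>"
    proof (rule in_class_if_small_at_nodes[OF n, rotated])
      show "f \<in> C_per" using f span_harmonics_in_C_per by blast
      show "\<bar>apply_bcontfun f (node n (\<alpha> n) j)\<bar> \<le> lower n" for j
        using f(1) bcontfun_le_norm[of f] by (auto intro: order_trans)
    qed
  qed
  then show ?thesis
    unfolding bernstein_width_def
    by (intro SUP_upper2[OF span_harmonics_dim] SUP_upper) (simp add: lower_pos[OF n])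
qed

text \<open>
  If \<open>\<mu>\<close> annihilates \<open>F\<close> on the nodes, then \<open>f - u\<close> for \<open>u \<in> F\<close> has the same \<open>\<mu>\<close>-weighted sum over
  the nodes as \<open>f\<close>.  For the interpolant \<open>f\<close> of \<open>lower n * sgn (\<mu> j)\<close> this sum is
  \<open>lower n * (\<Sum>j<2*n. \<bar>\<mu> j\<bar>)\<close>, which forces the norm of \<open>f - u\<close> to be at least \<open>lower n\<close>.
\<close>

lemma kolmogorov_width_ge:
  assumes n: "n \<ge> 1"
  shows "ennreal (lower n) \<le> kolmogorov_width (convolution_class_C \<Psi>) C_per (2 * n)"
  unfolding kolmogorov_width_def
proof (rule INF_greatest)
  fix F assume "F \<in> subspaces_of_dim C_per (2 * n)"
  then obtain B where B: "finite B" "card B = 2 * n" "F = span B" "F \<subseteq> C_per"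
    by (auto simp: subspaces_of_dim_def)
  obtain h where h: "bij_betw h {0..<2 * n} B" using ex_bij_betw_nat_finite[OF B(1)] B(2) by auto
  have hB: "h ` {0..<2 * n} = B" using h by (simp add: bij_betw_def)
  have per: "apply_bcontfun (h i) (x + 2 * pi) = apply_bcontfun (h i) x" if "i < 2 * n" for i x
  proof -
    have "h i \<in> C_per" using B hB that span_superset by fastforce
    then show ?thesis by (simp add: C_per_def periodic_2pi_def)
  qed
  have "\<exists>\<theta> \<mu>. (\<exists>j<2*n. \<mu> j \<noteq> 0) \<and> (\<forall>i<2*n. (\<Sum>j<2*n. \<mu> j * apply_bcontfun (h i) (node n \<theta> j)) = 0)"
    by (rule annihilating_weights_at_nodes[OF n bcontfun_continuous per])
  then obtain \<theta> \<mu> where \<mu>: "\<exists>j<2*n. \<mu> j \<noteq> 0"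
    and ann: "\<And>i. i < 2 * n \<Longrightarrow> (\<Sum>j<2*n. \<mu> j * apply_bcontfun (h i) (node n \<theta> j)) = 0" by blast
  have annF: "(\<Sum>j<2*n. \<mu> j * apply_bcontfun u (node n \<theta> j)) = 0" if "u \<in> F" for u
  proof (rule linear_eq_0_on_span[where f = "\<lambda>u. \<Sum>j<2*n. \<mu> j * apply_bcontfun u (node n \<theta> j)"])
    show "linear (\<lambda>u. \<Sum>j<2*n. \<mu> j * apply_bcontfun u (node n \<theta> j))"
      by (rule linearI) (simp_all add: distrib_left sum.distrib sum_distrib_left mult.left_commute)
    show "u \<in> span B" using that B by simp
    show "(\<Sum>j<2*n. \<mu> j * apply_bcontfun b (node n \<theta> j)) = 0" if b: "b \<in> B" for b
    proof -
      obtain i where "i < 2 * n" "b = h i" using b hB by auto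
      then show ?thesis using ann by simp
    qed
  qed
  obtain c \<rho> \<alpha> where \<alpha>: "\<alpha> n = \<theta>"
    and y: "\<And>i. i < 2 * n \<Longrightarrow> cos_poly n c \<rho> \<alpha> (node n \<theta> i) = lower n * sgn (\<mu> i)"
    using cos_poly_interpolation[OF n, of \<theta> "\<lambda>i. lower n * sgn (\<mu> i)"] by blast
  obtain f where f: "f \<in> C_per" "\<And>x. apply_bcontfun f x = cos_poly n c \<rho> \<alpha> x"
    using cos_poly_in_C_per by blast
  have fK: "f \<in> convolution_class_C \<Psi>"
    by (rule in_class_if_small_at_nodes[OF n f])
      (use lower_pos[OF n] in \<open>auto simp: f(2) \<alpha> y abs_mult abs_sgn_eq\<close>)
  have "lower n \<le> norm (f - u)" if u: "u \<in> F" for u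
  proof -
    define s where "s = (\<Sum>j<2*n. \<bar>\<mu> j\<bar>)"
    have s: "s > 0" using \<mu> unfolding s_def by (auto intro!: sum_pos2)
    have "lower n * s = (\<Sum>j<2*n. \<mu> j * apply_bcontfun f (node n \<theta> j))"
      unfolding s_def sum_distrib_left
      by (intro sum.cong refl) (auto simp: f(2) y mult.left_commute mult_sgn_abs abs_sgn)
    also have "\<dots> = (\<Sum>j<2*n. \<mu> j * apply_bcontfun (f - u) (node n \<theta> j))"
      using annF[OF u] by (simp add: right_diff_distrib sum_subtractf)
    also have "\<dots> \<le> (\<Sum>j<2*n. \<bar>\<mu> j\<bar> * norm (f - u))"
    proof (rule sum_mono)
      fix j
      have "\<mu> j * apply_bcontfun (f - u) (node n \<theta> j) \<le> \<bar>\<mu> j\<bar> * \<bar>apply_bcontfun (f - u) (node n \<theta> j)\<bar>"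
        unfolding abs_mult[symmetric] by (rule abs_ge_self)
      also have "\<dots> \<le> \<bar>\<mu> j\<bar> * norm (f - u)" by (intro mult_left_mono bcontfun_le_norm) simp
      finally show "\<mu> j * apply_bcontfun (f - u) (node n \<theta> j) \<le> \<bar>\<mu> j\<bar> * norm (f - u)" .
    qed
    also have "\<dots> = norm (f - u) * s" by (simp add: s_def sum_distrib_left mult.commute)
    finally show ?thesis using s by simp
  qed
  then show "ennreal (lower n) \<le> (SUP f\<in>convolution_class_C \<Psi>. INF u\<in>F. ennreal (norm (f - u)))"
    by (intro SUP_upper2[OF fK] INF_greatest ennreal_leI)
qed

lemma fourier_sum_projection:
  "(\<lambda>f. fourier_sum m (apply_bcontfun f)) \<in> projections C_per (span (harmonics m))"
  using linear_fourier_sum[of m]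
  by (auto simp: projections_def linear_operators_def fourier_sum_in_span_harmonics
      fourier_sum_id_on_span_harmonics linear_iff)

lemma fourier_sum_error_le:
  "fourier_sum_error m (convolution_class_C \<Psi>) \<le> ennreal (1 / sqrt pi * tail m)"
  unfolding fourier_sum_error_def
  by (intro SUP_least ennreal_leI convolution_class_fourier_sum)

lemma projection_width_le_fourier_sum_error:
  "projection_width (convolution_class_C \<Psi>) C_per (2 * m + 1) \<le> fourier_sum_error m (convolution_class_C \<Psi>)"
  unfolding projection_width_def fourier_sum_error_def
  by (rule INF_lower2[OF span_harmonics_dim], rule INF_lower2[OF fourier_sum_projection]) simp

text \<open>
  A subspace of dimension \<open>2 * m + 2\<close> contains a nonzero function whose Fourier sum of order \<open>m\<close>
  vanishes; scaled to norm \<open>\<epsilon>\<close> it is its own error of approximation.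
\<close>

lemma bernstein_width_le:
  "bernstein_width (convolution_class_C \<Psi>) C_per (2 * m + 1) \<le> ennreal (1 / sqrt pi * tail m)"
  unfolding bernstein_width_def
proof (intro SUP_least)
  fix F \<epsilon> assume F: "F \<in> subspaces_of_dim C_per (2 * m + 1 + 1)"
    and \<epsilon>: "\<epsilon> \<in> {\<epsilon>. \<epsilon> > 0 \<and> cball 0 \<epsilon> \<inter> F \<subseteq> convolution_class_C \<Psi>}"
  obtain B where B: "finite B" "card B = 2 * m + 2" "independent B" "F = span B"
    using F by (auto simp: subspaces_of_dim_def)
  have "\<exists>f\<in>span B. f \<noteq> 0 \<and> fourier_sum m (apply_bcontfun f) = 0"
    by (rule linear_kernel_in_span[OF linear_fourier_sum B(1,3) harmonics_basis(1)[of m]])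
      (use B harmonics_basis fourier_sum_in_span_harmonics in auto)
  then obtain f where f: "f \<in> F" "f \<noteq> 0" "fourier_sum m (apply_bcontfun f) = 0" using B by blast
  define g where "g = (\<epsilon> / norm f) *\<^sub>R f"
  have ng: "norm g = \<epsilon>" using f \<epsilon> by (simp add: g_def)
  have "g \<in> F" using f B by (simp add: g_def span_scale)
  then have gK: "g \<in> convolution_class_C \<Psi>" using \<epsilon> ng by auto
  have "fourier_sum m (apply_bcontfun g) = 0"
    unfolding g_def using linear_scale[OF linear_fourier_sum, of m "\<epsilon> / norm f" f] f by simp
  then show "ennreal \<epsilon> \<le> ennreal (1 / sqrt pi * tail m)"
    using convolution_class_fourier_sum(1)[OF gK, of m] ng by (simp add: ennreal_leI)
qed

lemma width_bounds:
  assumes P: "P \<in> {bernstein_width, kolmogorov_width, linear_width, projection_width}" and n: "n \<ge> 1"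
  shows "ennreal (lower n) \<le> P (convolution_class_C \<Psi>) C_per (2 * n)"
    and "P (convolution_class_C \<Psi>) C_per (2 * n) \<le> P (convolution_class_C \<Psi>) C_per (2 * n - 1)"
    and "P (convolution_class_C \<Psi>) C_per (2 * n - 1) \<le> ennreal (1 / sqrt pi * tail (n - 1))"
proof -
  let ?K = "convolution_class_C \<Psi>"
  interpret extensible_class ?K C_per "2 * n - 1" by (rule extensible)
  have N: "2 * n - 1 + 1 = 2 * n" "2 * (n - 1) + 1 = 2 * n - 1" using n by auto
  note kl = kolmogorov_le_linear_width[OF sub] and lp = linear_le_projection_width
  have k: "ennreal (lower n) \<le> kolmogorov_width ?K C_per (2 * n)" by (rule kolmogorov_width_ge[OF n])
  have l: "ennreal (lower n) \<le> linear_width ?K C_per (2 * n)" using k kl by (rule order_trans)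
  have p: "ennreal (lower n) \<le> projection_width ?K C_per (2 * n)" using l lp by (rule order_trans)
  show "ennreal (lower n) \<le> P ?K C_per (2 * n)"
    using P k l p bernstein_width_ge[OF n] by auto
  show "P ?K C_per (2 * n) \<le> P ?K C_per (2 * n - 1)"
    using P kolmogorov_width_mono linear_width_mono projection_width_mono
      bernstein_width_mono[of ?K C_per "2 * n - 1"] unfolding N by auto
  have p': "projection_width ?K C_per (2 * n - 1) \<le> ennreal (1 / sqrt pi * tail (n - 1))"
    using order_trans[OF projection_width_le_fourier_sum_error fourier_sum_error_le, of "n - 1"] unfolding N .
  have l': "linear_width ?K C_per (2 * n - 1) \<le> ennreal (1 / sqrt pi * tail (n - 1))"
    using lp p' by (rule order_trans)
  have k': "kolmogorov_width ?K C_per (2 * n - 1) \<le> ennreal (1 / sqrt pi * tail (n - 1))"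
    using kl l' by (rule order_trans)
  show "P ?K C_per (2 * n - 1) \<le> ennreal (1 / sqrt pi * tail (n - 1))"
    using P k' l' p' bernstein_width_le[of "n - 1"] unfolding N by auto
qed

lemma fourier_sum_error_ge:
  assumes n: "n \<ge> 1"
  shows "ennreal (lower n) \<le> fourier_sum_error (n - 1) (convolution_class_C \<Psi>)"
proof -
  have N: "2 * (n - 1) + 1 = 2 * n - 1" using n by simp
  have "ennreal (lower n) \<le> projection_width (convolution_class_C \<Psi>) C_per (2 * n)"
    by (rule width_bounds(1)[OF _ n]) simp
  also have "\<dots> \<le> projection_width (convolution_class_C \<Psi>) C_per (2 * n - 1)"
    by (rule width_bounds(2)[OF _ n]) simp
  also have "\<dots> \<le> fourier_sum_error (n - 1) (convolution_class_C \<Psi>)"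
    using projection_width_le_fourier_sum_error[of "n - 1"] unfolding N .
  finally show ?thesis .
qed

section \<open>Asymptotic equalities\<close>

text \<open>
  With \<open>a\<close> the first entry of the maximum, \<open>lower n\<close> is \<open>\<psi> n / sqrt pi\<close> times
  \<open>1 / sqrt (1 + 2 * a\<^sup>2) \<ge> 1 / (1 + sqrt 2 * a) \<ge> 1 - sqrt 2 * a\<close>, and \<open>sqrt 2 \<le> sqrt pi\<close>.
\<close>

lemma lower_ge_remainder:
  assumes n: "n \<ge> 1"
  shows "lower n \<ge> \<psi> n * (1 / sqrt pi - remainder \<psi> n)"
proof -
  define S where "S = (\<Sum>k=1..<n. 1 / (\<psi> k)\<^sup>2)"
  have S: "S \<ge> 0" by (simp add: S_def sum_nonneg)
  note p = pos[OF n]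
  define a where "a = \<psi> n * sqrt S"
  have a: "a \<ge> 0" "a \<le> remainder \<psi> n" using p S by (simp_all add: a_def remainder_def S_def)
  have "1 / (\<psi> n)\<^sup>2 + 2 * S \<le> ((1 + sqrt 2 * a) / \<psi> n)\<^sup>2"
  proof -
    have "((1 + sqrt 2 * a) / \<psi> n)\<^sup>2 = (1 + 2 * sqrt 2 * a + 2 * a\<^sup>2) / (\<psi> n)\<^sup>2"
      by (simp add: power_divide power2_sum power_mult_distrib)
    also have "\<dots> = 1 / (\<psi> n)\<^sup>2 + 2 * S + 2 * sqrt 2 * a / (\<psi> n)\<^sup>2"
      using p S by (simp add: a_def power_mult_distrib add_divide_distrib)
    finally show ?thesis using a by simp
  qed
  then have "sqrt (1 / (\<psi> n)\<^sup>2 + 2 * S) \<le> (1 + sqrt 2 * a) / \<psi> n"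
    using p a by (intro real_le_lsqrt) auto
  moreover have "0 < sqrt (1 / (\<psi> n)\<^sup>2 + 2 * S)" using lower_radicand_pos[OF n] by (simp add: S_def)
  moreover have "0 < 1 + sqrt 2 * a" using a by (simp add: add_pos_nonneg)
  ultimately have "1 / ((1 + sqrt 2 * a) / \<psi> n) \<le> 1 / sqrt (1 / (\<psi> n)\<^sup>2 + 2 * S)"
    using p by (intro divide_left_mono mult_pos_pos divide_pos_pos) simp_all
  moreover have "\<psi> n * (1 - sqrt 2 * a) \<le> 1 / ((1 + sqrt 2 * a) / \<psi> n)"
  proof -
    have "(1 - sqrt 2 * a) * (1 + sqrt 2 * a) \<le> 1" by (simp add: algebra_simps)
    then have "1 - sqrt 2 * a \<le> 1 / (1 + sqrt 2 * a)"
      using a by (simp add: pos_le_divide_eq add_pos_nonneg)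
    from mult_left_mono[OF this, of "\<psi> n"] show ?thesis using p by simp
  qed
  ultimately have "1 / sqrt pi * (\<psi> n * (1 - sqrt 2 * a)) \<le> 1 / sqrt pi * (1 / sqrt (1 / (\<psi> n)\<^sup>2 + 2 * S))"
    by (intro mult_left_mono) auto
  then have "\<psi> n * (1 / sqrt pi - sqrt 2 / sqrt pi * a) \<le> lower n"
    unfolding lower_eq[OF n] S_def by (simp add: field_simps)
  moreover have "sqrt 2 / sqrt pi * a \<le> 1 * remainder \<psi> n"
    using a pi_ge_two by (intro mult_mono) auto
  then have "\<psi> n * (1 / sqrt pi - remainder \<psi> n) \<le> \<psi> n * (1 / sqrt pi - sqrt 2 / sqrt pi * a)"
    using p by (intro mult_left_mono) auto
  ultimately show ?thesis by linarith
qed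

text \<open>
  With \<open>b\<close> the second entry of the maximum, \<open>tail (n - 1)\<close> is
  \<open>\<psi> n * sqrt (1 + b\<^sup>2) \<le> \<psi> n * (1 + b)\<close>.
\<close>

lemma tail_le_remainder:
  assumes n: "n \<ge> 1"
  shows "1 / sqrt pi * tail (n - 1) \<le> \<psi> n * (1 / sqrt pi + remainder \<psi> n)"
proof -
  note p = pos[OF n]
  have e: "n - 1 + 1 + k = n + k" for k using n by simp
  have s: "summable (\<lambda>k. (\<psi> (n + k))\<^sup>2)" using summable_shift[of "n - 1"] unfolding e .
  have "(\<Sum>k. (\<psi> (n + k))\<^sup>2) = (\<psi> n)\<^sup>2 + (\<Sum>k. (\<psi> (n + 1 + k))\<^sup>2)"
    using suminf_split_head[OF s] by simp
  then have "(\<Sum>k. (\<psi> (n - 1 + 1 + k))\<^sup>2) = (\<psi> n)\<^sup>2 + (tail n)\<^sup>2"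
    unfolding e tail_def using suminf_nonneg[OF summable_shift[of n]] by simp
  then have "tail (n - 1) = sqrt ((\<psi> n)\<^sup>2 + (tail n)\<^sup>2)" unfolding tail_def[of "n - 1"] by simp
  also have "\<dots> \<le> \<psi> n + tail n"
    using p suminf_nonneg[OF summable_shift[of n]] by (intro sqrt_sum_squares_le_sum) (auto simp: tail_def)
  finally have t: "tail (n - 1) \<le> \<psi> n + tail n" .
  have r: "tail n \<le> \<psi> n * remainder \<psi> n" "tail n \<ge> 0"
  proof -
    have "tail n / \<psi> n \<le> remainder \<psi> n" by (simp add: remainder_def tail_def)
    then show "tail n \<le> \<psi> n * remainder \<psi> n" using p by (simp add: field_simps)
    show "tail n \<ge> 0" using suminf_nonneg[OF summable_shift[of n]] by (simp add: tail_def)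
  qed
  have "1 / sqrt pi * tail (n - 1) \<le> 1 / sqrt pi * (\<psi> n + tail n)"
    using t by (intro mult_left_mono) auto
  also have "\<dots> = \<psi> n * (1 / sqrt pi) + 1 / sqrt pi * tail n" by (simp add: algebra_simps)
  also have "1 / sqrt pi * tail n \<le> 1 * tail n"
    using r pi_ge_two by (intro mult_right_mono) auto
  finally show ?thesis using r by (simp add: distrib_left)
qed

lemma asymptotic_equality:
  assumes n: "n \<ge> 1" and v: "ennreal (lower n) \<le> v" "v \<le> ennreal (1 / sqrt pi * tail (n - 1))"
  shows "\<exists>\<omega>. \<bar>\<omega>\<bar> \<le> 1 \<and> enn2ereal v = ereal (\<psi> n * (1 / sqrt pi + \<omega> * remainder \<psi> n))"
proof -
  define x where "x = enn2real v"
  have t: "tail (n - 1) \<ge> 0" using suminf_nonneg[OF summable_shift[of "n - 1"]] by (simp add: tail_def)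
  have "v < top_class.top" using v(2) by (rule order.strict_trans1) simp
  then have vx: "v = ennreal x" by (simp add: x_def)
  have x0: "x \<ge> 0" by (simp add: x_def)
  have lx: "lower n \<le> x" "x \<le> 1 / sqrt pi * tail (n - 1)"
    using v x0 t unfolding vx by (simp_all add: ennreal_le_iff)
  note p = pos[OF n]
  define d where "d = x / \<psi> n - 1 / sqrt pi"
  have x: "x = \<psi> n * (1 / sqrt pi + d)" using p by (simp add: d_def)
  have "\<psi> n * (1 / sqrt pi - remainder \<psi> n) \<le> \<psi> n * (1 / sqrt pi + d)"
    "\<psi> n * (1 / sqrt pi + d) \<le> \<psi> n * (1 / sqrt pi + remainder \<psi> n)"
    using lower_ge_remainder[OF n] tail_le_remainder[OF n] lx unfolding x by linarith+
  then have d: "\<bar>d\<bar> \<le> remainder \<psi> n" using p by (simp add: abs_le_iff)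
  define \<omega> where "\<omega> = d / remainder \<psi> n"
  have "d = \<omega> * remainder \<psi> n" "\<bar>\<omega>\<bar> \<le> 1"
    using d by (auto simp: \<omega>_def abs_divide divide_le_eq)
  then show ?thesis using x0 x vx by (intro exI[of _ \<omega>]) (simp add: enn2ereal_ennreal)
qed

end

theorem theorem1:
  shows "\<exists>M::real. \<forall>(\<psi>::nat \<Rightarrow> real) (\<beta>::nat \<Rightarrow> real) (\<Psi>::real \<Rightarrow> real).
    (\<forall>k\<ge>1. \<psi> k > 0) \<and> summable (\<lambda>k. (\<psi> (k + 1))\<^sup>2) \<and> is_kernel \<psi> \<beta> \<Psi> \<longrightarrow>
      (\<forall>P\<in>{bernstein_width, kolmogorov_width, linear_width, projection_width}. \<forall>n\<ge>1.
         ennreal (1 / sqrt pi * (1 / (\<psi> n)\<^sup>2 + 2 * (\<Sum>k=1..<n. 1 / (\<psi> k)\<^sup>2)) powr (-1/2))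
           \<le> P (convolution_class_C \<Psi>) C_per (2 * n) \<and>
         P (convolution_class_C \<Psi>) C_per (2 * n) \<le> P (convolution_class_C \<Psi>) C_per (2 * n - 1) \<and>
         P (convolution_class_C \<Psi>) C_per (2 * n - 1)
           \<le> ennreal (1 / sqrt pi * sqrt (\<Sum>k. (\<psi> (n + k))\<^sup>2))) \<and>
      (remainder \<psi> \<longlonglongrightarrow> 0 \<longrightarrow>
         (\<forall>P\<in>{bernstein_width, kolmogorov_width, linear_width, projection_width}. \<forall>n\<ge>1.
            \<forall>N\<in>{2 * n, 2 * n - 1}. \<exists>\<omega>. \<bar>\<omega>\<bar> \<le> M \<and>
              enn2ereal (P (convolution_class_C \<Psi>) C_per N)
                = ereal (\<psi> n * (1 / sqrt pi + \<omega> * remainder \<psi> n))) \<and>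
         (\<forall>n\<ge>1. \<exists>\<omega>. \<bar>\<omega>\<bar> \<le> M \<and>
            enn2ereal (fourier_sum_error (n - 1) (convolution_class_C \<Psi>))
              = ereal (\<psi> n * (1 / sqrt pi + \<omega> * remainder \<psi> n))))"
proof (intro exI[of _ 1] allI impI)
  fix \<psi> \<beta> \<Psi>
  assume h: "(\<forall>k\<ge>1. \<psi> k > 0) \<and> summable (\<lambda>k. (\<psi> (k + 1))\<^sup>2) \<and> is_kernel \<psi> \<beta> \<Psi>"
  interpret convolution_kernel \<psi> \<beta> \<Psi> by unfold_locales (use h in auto)
  have tail: "tail (n - 1) = sqrt (\<Sum>k. (\<psi> (n + k))\<^sup>2)" if "n \<ge> 1" for n
    using that by (simp add: tail_def)
  let ?W = "{bernstein_width, kolmogorov_width, linear_width, projection_width}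
    :: ((real \<Rightarrow>\<^sub>C real) set \<Rightarrow> (real \<Rightarrow>\<^sub>C real) set \<Rightarrow> nat \<Rightarrow> ennreal) set"
  let ?K = "convolution_class_C \<Psi>"
  have bounds: "\<forall>P\<in>?W. \<forall>n\<ge>1.
         ennreal (1 / sqrt pi * (1 / (\<psi> n)\<^sup>2 + 2 * (\<Sum>k=1..<n. 1 / (\<psi> k)\<^sup>2)) powr (-1/2))
           \<le> P ?K C_per (2 * n) \<and>
         P ?K C_per (2 * n) \<le> P ?K C_per (2 * n - 1) \<and>
         P ?K C_per (2 * n - 1) \<le> ennreal (1 / sqrt pi * sqrt (\<Sum>k. (\<psi> (n + k))\<^sup>2))"
  proof (intro ballI allI impI conjI)
    fix P n assume P: "P \<in> ?W" and n: "n \<ge> (1::nat)"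
    show "ennreal (1 / sqrt pi * (1 / (\<psi> n)\<^sup>2 + 2 * (\<Sum>k=1..<n. 1 / (\<psi> k)\<^sup>2)) powr (-1/2))
           \<le> P ?K C_per (2 * n)"
      using width_bounds(1)[OF P n] unfolding lower_def .
    show "P ?K C_per (2 * n) \<le> P ?K C_per (2 * n - 1)" by (rule width_bounds(2)[OF P n])
    show "P ?K C_per (2 * n - 1) \<le> ennreal (1 / sqrt pi * sqrt (\<Sum>k. (\<psi> (n + k))\<^sup>2))"
      using width_bounds(3)[OF P n] unfolding tail[OF n] .
  qed
  have widths: "\<forall>P\<in>?W. \<forall>n\<ge>1. \<forall>N\<in>{2 * n, 2 * n - 1}. \<exists>\<omega>. \<bar>\<omega>\<bar> \<le> 1 \<and>
      enn2ereal (P ?K C_per N) = ereal (\<psi> n * (1 / sqrt pi + \<omega> * remainder \<psi> n))"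
  proof (intro ballI allI impI)
    fix P n N assume P: "P \<in> ?W" and n: "n \<ge> (1::nat)" and N: "N \<in> {2 * n, 2 * n - 1}"
    note b = width_bounds[OF P n]
    have "ennreal (lower n) \<le> P ?K C_per N" "P ?K C_per N \<le> ennreal (1 / sqrt pi * tail (n - 1))"
      using N b(1,3) order_trans[OF b(1,2)] order_trans[OF b(2,3)] by auto
    then show "\<exists>\<omega>. \<bar>\<omega>\<bar> \<le> 1 \<and>
      enn2ereal (P ?K C_per N) = ereal (\<psi> n * (1 / sqrt pi + \<omega> * remainder \<psi> n))"
      by (rule asymptotic_equality[OF n])
  qed
  have sums: "\<forall>n\<ge>1. \<exists>\<omega>. \<bar>\<omega>\<bar> \<le> 1 \<and>
      enn2ereal (fourier_sum_error (n - 1) ?K) = ereal (\<psi> n * (1 / sqrt pi + \<omega> * remainder \<psi> n))"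
    by (intro allI impI asymptotic_equality fourier_sum_error_ge fourier_sum_error_le)
  show "(\<forall>P\<in>?W. \<forall>n\<ge>1.
         ennreal (1 / sqrt pi * (1 / (\<psi> n)\<^sup>2 + 2 * (\<Sum>k=1..<n. 1 / (\<psi> k)\<^sup>2)) powr (-1/2))
           \<le> P ?K C_per (2 * n) \<and>
         P ?K C_per (2 * n) \<le> P ?K C_per (2 * n - 1) \<and>
         P ?K C_per (2 * n - 1) \<le> ennreal (1 / sqrt pi * sqrt (\<Sum>k. (\<psi> (n + k))\<^sup>2))) \<and>
      (remainder \<psi> \<longlonglongrightarrow> 0 \<longrightarrow>
         (\<forall>P\<in>?W. \<forall>n\<ge>1. \<forall>N\<in>{2 * n, 2 * n - 1}. \<exists>\<omega>. \<bar>\<omega>\<bar> \<le> 1 \<and>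
              enn2ereal (P ?K C_per N) = ereal (\<psi> n * (1 / sqrt pi + \<omega> * remainder \<psi> n))) \<and>
         (\<forall>n\<ge>1. \<exists>\<omega>. \<bar>\<omega>\<bar> \<le> 1 \<and>
            enn2ereal (fourier_sum_error (n - 1) ?K)
              = ereal (\<psi> n * (1 / sqrt pi + \<omega> * remainder \<psi> n))))"
    using bounds widths sums by blast
qed

end
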